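(* Suppose that one of the following holds: (a) for almost all $u\in(0,1)$, $f(X_{N(1)},u)\to f(X_1,u)$ in probability as $n\to\infty$; (b) for all $k=1,\ldots,K$ the mapping $x\mapsto Q_k(x)$ is $P_X$-almost everywhere continuous. Suppose further that $L_n=o_P(n^{1/4})$. Assume that $X$ and $Y$ are not independent. Then $\mathcal{I}_n\to\infty$ in probability as $n\to\infty$. The divergence rate is of order $\sqrt n$.
   Context: $(\mathcal{H},d)$ is a separable metric space, $X$ is an $\mathcal{H}$-valued random variable with law $P_X$, and $Y$ is categorical with levels $\{1,\ldots,K\}$, $K\ge2$, $p_k=P(Y=k)>0$ for all $k$. $Q_k(x)=P(Y=k\mid X=x)$ and $f(x,u)=\min\{k\in\{1,\ldots,K\}:\sum_{j=1}^kQ_j(x)>u\}$. Let $X_i$ be i.i.d. copies of $X$, $U_i$ i.i.d. uniform on $(0,1)$ and independent of the $X_i$, and $Y_i=f(X_i,U_i)$, so that $(X_1,Y_1),\ldots,(X_n,Y_n)$ is an i.i.d. sample from the law of $(X,Y)$. $N(i)=N_n(i)\in\{1,\ldots,n\}\setminus\{i\}$ is the index of the nearest neighbour of $X_i$ among the other $X_j$, $1\le j\le n$, $j\ne i$, with respect to $d$. It is assumed that $d(X_1,X_2)$ has a continuous distribution, so that nearest neighbours are almost surely unique. $L_n=\max_{1\le i\le n}\#\{j\le n:N(j)=i\}$ and $W_n=\frac1n\sum_{i=1}^n1\{N(N(i))=i\}$. Further $$\widehat p_{k,l}=\frac1n\sum_{i=1}^n1\{Y_i=k,Y_{N(i)}=l\},\quad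 \widehat p_k=\sum_{l=1}^K\widehat p_{k,l},\quad \widehat q_l=\sum_{k=1}^K\widehat p_{k,l},$$ $$P_n=\sqrt n\,\mathrm{vec}\Big(\big(\widehat p_{k,l}-\widehat p_k\widehat q_l\big)_{k,l=1}^{K-1}\Big),$$ where $\mathrm{vec}$ stacks the columns of a matrix into a vector. $\widehat\Sigma_n$ is the $(K-1)^2\times(K-1)^2$ matrix with entries, for $1\le k_1,l_1,k_2,l_2\le K-1$, $$\begin{aligned}\widehat\Sigma_n((k_1,l_1),(k_2,l_2))={}&\widehat p_{k_1}\widehat p_{l_1}\widehat p_{k_2}\widehat p_{l_2}(1+W_n)-\widehat p_{k_1}\widehat p_{l_1}\widehat p_{l_2}\big(1\{k_1=k_2\}+W_n1\{l_1=k_2\}\big)\\&-\widehat p_{k_1}\widehat p_{l_1}\widehat p_{k_2}\big(1\{l_1=l_2\}+W_n1\{k_1=l_2\}\big)\\&+\widehat p_{k_1}\widehat p_{l_1}\big(1\{k_1=k_2,l_1=l_2\}+W_n1\{k_1=l_2,l_1=k_2\}\big).\end{aligned}$$ The test statistic is $\mathcal{I}_n=P_n'\widehat\Sigma_n^{-1}P_n$.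
   Formalization: "The divergence rate is of order √n" is false for I_n itself, which is of exact order n under dependence; instead it is proved that the norm of P_n and the square root of I_n are both of exact order √n, with probability tending to one. *)

theory Defs
  imports "HOL-Probability.Probability" "Jordan_Normal_Form.Gauss_Jordan_Elimination"
begin

text \<open>
  Levels are \<open>{1..K}\<close> and sample indices are \<open>{1..n}\<close>. The sample statistics are functions of
  the realised sequences \<open>x\<close> (points) and \<open>y\<close> (levels); only the entries \<open>1, \<dots>, n\<close> matter.
\<close>

definition resp :: "nat \<Rightarrow> (nat \<Rightarrow> 'h \<Rightarrow> real) \<Rightarrow> 'h \<Rightarrow> real \<Rightarrow> nat" where
  "resp K Q x u = (LEAST k. k \<in> {1..K} \<and> (\<Sum>j=1..k. Q j x) > u)"

text \<open>Should several points be nearest to \<open>x i\<close>, the one with the smallest index is taken.\<close>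

definition nn :: "nat \<Rightarrow> (nat \<Rightarrow> 'h::metric_space) \<Rightarrow> nat \<Rightarrow> nat" where
  "nn n x i = (LEAST j. j \<in> {1..n} - {i} \<and>
      (\<forall>k\<in>{1..n} - {i}. dist (x i) (x j) \<le> dist (x i) (x k)))"

definition max_indegree :: "nat \<Rightarrow> (nat \<Rightarrow> 'h::metric_space) \<Rightarrow> nat" where
  "max_indegree n x = Max ((\<lambda>i. card {j \<in> {1..n}. nn n x j = i}) ` {1..n})"

definition mutual_frac :: "nat \<Rightarrow> (nat \<Rightarrow> 'h::metric_space) \<Rightarrow> real" where
  "mutual_frac n x = (1 / real n) * (\<Sum>i=1..n. of_bool (nn n x (nn n x i) = i))"

definition p_joint :: "nat \<Rightarrow> (nat \<Rightarrow> 'h::metric_space) \<Rightarrow> (nat \<Rightarrow> nat) \<Rightarrow> nat \<Rightarrow> nat \<Rightarrow> real" where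
  "p_joint n x y k l = (1 / real n) * (\<Sum>i=1..n. of_bool (y i = k \<and> y (nn n x i) = l))"

definition p_row :: "nat \<Rightarrow> nat \<Rightarrow> (nat \<Rightarrow> 'h::metric_space) \<Rightarrow> (nat \<Rightarrow> nat) \<Rightarrow> nat \<Rightarrow> real" where
  "p_row K n x y k = (\<Sum>l=1..K. p_joint n x y k l)"

definition q_col :: "nat \<Rightarrow> nat \<Rightarrow> (nat \<Rightarrow> 'h::metric_space) \<Rightarrow> (nat \<Rightarrow> nat) \<Rightarrow> nat \<Rightarrow> real" where
  "q_col K n x y l = (\<Sum>k=1..K. p_joint n x y k l)"

text \<open>
  Matrices and vectors count from \<open>0\<close>: stacking the columns of an \<open>m \<times> m\<close> matrix with entries
  indexed by \<open>{1..m} \<times> {1..m}\<close> puts the entry \<open>(k, l)\<close> at position \<open>(l - 1) * m + (k - 1)\<close>.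
  The functions below recover \<open>k\<close> and \<open>l\<close> from the position.
\<close>

definition row_of :: "nat \<Rightarrow> nat \<Rightarrow> nat" where
  "row_of m r = r mod m + 1"

definition col_of :: "nat \<Rightarrow> nat \<Rightarrow> nat" where
  "col_of m r = r div m + 1"

definition P_stat :: "nat \<Rightarrow> nat \<Rightarrow> (nat \<Rightarrow> 'h::metric_space) \<Rightarrow> (nat \<Rightarrow> nat) \<Rightarrow> real Matrix.vec" where
  "P_stat K n x y = Matrix.vec ((K - 1)\<^sup>2) (\<lambda>r.
     let k = row_of (K - 1) r; l = col_of (K - 1) r
     in sqrt (real n) * (p_joint n x y k l - p_row K n x y k * q_col K n x y l))"

definition Sigma_entry :: "nat \<Rightarrow> nat \<Rightarrow> (nat \<Rightarrow> 'h::metric_space) \<Rightarrow> (nat \<Rightarrow> nat) \<Rightarrow>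
    nat \<Rightarrow> nat \<Rightarrow> nat \<Rightarrow> nat \<Rightarrow> real" where
  "Sigma_entry K n x y k1 l1 k2 l2 =
     (let p = p_row K n x y; W = mutual_frac n x in
        p k1 * p l1 * p k2 * p l2 * (1 + W)
      - p k1 * p l1 * p l2 * (of_bool (k1 = k2) + W * of_bool (l1 = k2))
      - p k1 * p l1 * p k2 * (of_bool (l1 = l2) + W * of_bool (k1 = l2))
      + p k1 * p l1 * (of_bool (k1 = k2 \<and> l1 = l2) + W * of_bool (k1 = l2 \<and> l1 = k2)))"

definition Sigma_hat :: "nat \<Rightarrow> nat \<Rightarrow> (nat \<Rightarrow> 'h::metric_space) \<Rightarrow> (nat \<Rightarrow> nat) \<Rightarrow> real Matrix.mat" where
  "Sigma_hat K n x y = Matrix.mat ((K - 1)\<^sup>2) ((K - 1)\<^sup>2) (\<lambda>(r, s).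
     Sigma_entry K n x y (row_of (K - 1) r) (col_of (K - 1) r) (row_of (K - 1) s) (col_of (K - 1) s))"

text \<open>
  The test statistic is given the value \<open>0\<close> when \<open>Sigma_hat\<close> is singular, so that an undefined
  inverse never contributes to divergence.
\<close>

definition I_stat :: "nat \<Rightarrow> nat \<Rightarrow> (nat \<Rightarrow> 'h::metric_space) \<Rightarrow> (nat \<Rightarrow> nat) \<Rightarrow> real" where
  "I_stat K n x y = (case mat_inverse (Sigma_hat K n x y) of
       Some B \<Rightarrow> scalar_prod (P_stat K n x y) (B *\<^sub>v P_stat K n x y)
     | None \<Rightarrow> 0)"

definition vec_norm2 :: "real Matrix.vec \<Rightarrow> real" where
  "vec_norm2 v = sqrt (scalar_prod v v)"

text \<open>
  The library's \<open>indep_var\<close> asks for both random variables to have values in the same type.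
\<close>

definition indep_rv :: "'w measure \<Rightarrow> 'b measure \<Rightarrow> ('w \<Rightarrow> 'b) \<Rightarrow> 'c measure \<Rightarrow> ('w \<Rightarrow> 'c) \<Rightarrow> bool" where
  "indep_rv M S X T Y \<longleftrightarrow> X \<in> measurable M S \<and> Y \<in> measurable M T \<and>
     prob_space.indep_set M {X -` A \<inter> space M | A. A \<in> sets S} {Y -` B \<inter> space M | B. B \<in> sets T}"

definition tendsto_in_prob ::
    "'w measure \<Rightarrow> (nat \<Rightarrow> 'w \<Rightarrow> 'b::metric_space) \<Rightarrow> ('w \<Rightarrow> 'b) \<Rightarrow> bool" where
  "tendsto_in_prob M Z Z' \<longleftrightarrow>
     (\<forall>e>0. (\<lambda>n. measure M {w \<in> space M. dist (Z n w) (Z' w) > e}) \<longlonglongrightarrow> 0)"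

definition tendsto_top_in_prob :: "'w measure \<Rightarrow> (nat \<Rightarrow> 'w \<Rightarrow> real) \<Rightarrow> bool" where
  "tendsto_top_in_prob M Z \<longleftrightarrow>
     (\<forall>C. (\<lambda>n. measure M {w \<in> space M. Z n w > C}) \<longlonglongrightarrow> 1)"

definition small_o_prob :: "'w measure \<Rightarrow> (nat \<Rightarrow> 'w \<Rightarrow> real) \<Rightarrow> (nat \<Rightarrow> real) \<Rightarrow> bool" where
  "small_o_prob M Z a \<longleftrightarrow> tendsto_in_prob M (\<lambda>n w. Z n w / a n) (\<lambda>_. 0)"

definition exact_order_in_prob :: "'w measure \<Rightarrow> (nat \<Rightarrow> 'w \<Rightarrow> real) \<Rightarrow> (nat \<Rightarrow> real) \<Rightarrow> bool" where
  "exact_order_in_prob M Z a \<longleftrightarrow> (\<exists>c>0. \<exists>C>0.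
     (\<lambda>n. measure M {w \<in> space M. c * a n \<le> Z n w \<and> Z n w \<le> C * a n}) \<longlonglongrightarrow> 1)"

end

theory Submission
  imports Defs "Jordan_Normal_Form.Determinant"
begin

text \<open>
  Given the points, the levels are independent, and a level pair \<open>(Y\<^sub>i, Y\<^bsub>N(i)\<^esub>)\<close> is uncorrelated
  with all but \<open>2 + 2 L\<^sub>n\<close> of the others; so \<open>p\<^bsub>k,l\<^esub>\<close> concentrates at its conditional mean, which
  tends to \<open>E Q\<^sub>k(X) Q\<^sub>l(X)\<close> because nearest neighbours have asymptotically equal \<open>Q\<close>. The limit of
  \<open>P\<^sub>n / sqrt n\<close> is therefore \<open>Cov (Q\<^sub>k(X), Q\<^sub>l(X))\<close>, and under dependence one of its diagonal entries
  is positive.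

  With \<open>A = diag p - p p'\<close>, the matrix estimate is \<open>(A \<otimes> A) (1 + W T)\<close> for the flip \<open>T\<close>. It degenerates on
  antisymmetric arguments as \<open>W \<rightarrow> 1\<close>, but mutual pairs cancel in the antisymmetric part of \<open>P\<^sub>n\<close>, which
  is therefore of size \<open>sqrt n (1 - W)\<close>. Only \<open>W < 1\<close> with high probability is needed: among
  \<open>n + 1\<close> points there are at most three whose removal makes all nearest-neighbour pairs mutual, so
  \<open>P (W = 1) \<le> 3 / (n + 1)\<close> by exchangeability.
\<close>

section \<open>The quadratic form of the covariance estimate\<close>

text \<open>The lower and upper bounds on the statistic use different means. For the lower one, a
  test vector in the variational form of \<open>P' S^-1 P\<close> needs just one bounded diagonal
  entry of \<open>S\<close>. For the upper one, the form is split along the flip, and each half is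
  controlled by the coercivity of \<open>A \<otimes> A\<close>. This becomes explicit when
  \<open>A\<close> is read as the covariance of level indicators and the reference level is
  restored: the form is then a second moment under weights bounded below.

  Conditioning on the points is done by Fubini: the two driving sequences have a product law, in
  which the points are frozen and only the uniforms vary. A bound in probability on the in-degree
  does not control its mean, so the variance is computed on the event where the in-degree is small.

  Ties go to the smallest index. Every exchangeability argument therefore uses a relabelling that is
  increasing on the indices that compete to be a neighbour.\<close>

definition mcov :: "(nat \<Rightarrow> real) \<Rightarrow> nat \<Rightarrow> nat \<Rightarrow> real" where
  "mcov p k l = p k * of_bool (k = l) - p k * p l"

text \<open>The entry of \<open>A \<otimes> A\<close>; equivalently the covariance of products of
  centred level indicators for two independent draws.\<close>

definition kcov :: "(nat \<Rightarrow> real) \<Rightarrow> nat \<times> nat \<Rightarrow> nat \<times> nat \<Rightarrow> real" where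
  "kcov p a b = mcov p (fst a) (fst b) * mcov p (snd a) (snd b)"

definition kform :: "(nat \<Rightarrow> real) \<Rightarrow> nat \<Rightarrow> (nat \<times> nat \<Rightarrow> real) \<Rightarrow> (nat \<times> nat \<Rightarrow> real) \<Rightarrow> real" where
  "kform p m f g = (\<Sum>a\<in>{1..m} \<times> {1..m}. \<Sum>b\<in>{1..m} \<times> {1..m}. f a * kcov p a b * g b)"

text \<open>Level \<open>0\<close> stands for the omitted reference level, which carries the remaining mass.\<close>

definition lweight :: "(nat \<Rightarrow> real) \<Rightarrow> nat \<Rightarrow> nat \<Rightarrow> real" where
  "lweight p m j = (if j = 0 then 1 - (\<Sum>k=1..m. p k) else p j)"

definition centred :: "(nat \<Rightarrow> real) \<Rightarrow> nat \<Rightarrow> nat \<Rightarrow> real" where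
  "centred p j k = of_bool (j = k) - p k"

text \<open>The value at the level pair \<open>c\<close> of the random variable that pairs
  \<open>f\<close> with products of centred indicators of two independent draws;
  \<open>kform p m f f\<close> is its second moment.\<close>

definition ccoef :: "(nat \<Rightarrow> real) \<Rightarrow> nat \<Rightarrow> (nat \<times> nat \<Rightarrow> real) \<Rightarrow> nat \<times> nat \<Rightarrow> real" where
  "ccoef p m f c = (\<Sum>a\<in>{1..m} \<times> {1..m}. f a * (centred p (fst c) (fst a) * centred p (snd c) (snd a)))"

lemma mcov_sym: "mcov p k l = mcov p l k"
  by (auto simp: mcov_def)

lemma kcov_sym: "kcov p a b = kcov p b a"
  by (simp add: kcov_def mcov_sym)

lemma kcov_swap: "kcov p (prod.swap a) (prod.swap b) = kcov p a b"
  by (simp add: kcov_def mult.commute)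

text \<open>The right-hand side is the mean of a product of two centred indicators when level
  \<open>j\<close> is drawn with weight \<open>lweight p m j\<close>. At the reference level the
  indicators of \<open>k\<close> and \<open>l\<close> are both zero, which leaves
  \<open>p k * p l\<close> in the separate term.\<close>

lemma mcov_eq_sum:
  assumes "k \<in> {1..m}" "l \<in> {1..m}"
  shows "mcov p k l = (\<Sum>j\<le>m. lweight p m j * centred p j k * centred p j l)"
proof -
  have *: "(\<Sum>j=1..m. p j * of_bool (j = k)) = p k" if "k \<in> {1..m}" for k
  proof -
    have "(\<Sum>j=1..m. p j * of_bool (j = k)) = (\<Sum>j=1..m. if j = k then p j else 0)"
      by (intro sum.cong) auto
    then show ?thesis using that by simp
  qed
  have "{..m} = insert 0 {1..m}" by auto
  then have "(\<Sum>j\<le>m. lweight p m j * centred p j k * centred p j l) =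
      (1 - (\<Sum>j=1..m. p j)) * p k * p l + (\<Sum>j=1..m. p j * centred p j k * centred p j l)"
    using assms by (simp add: lweight_def centred_def)
  also have "(\<Sum>j=1..m. p j * centred p j k * centred p j l) =
      (\<Sum>j=1..m. p j * of_bool (j = k) * of_bool (k = l) - (p j * of_bool (j = k)) * p l
         - (p j * of_bool (j = l)) * p k + p j * (p k * p l))"
    by (intro sum.cong) (auto simp: centred_def algebra_simps)
  also have "\<dots> = p k * of_bool (k = l) - p k * p l - p l * p k + (\<Sum>j=1..m. p j) * (p k * p l)"
    using * assms by (simp add: sum.distrib sum_subtractf flip: sum_distrib_right)
  finally show ?thesis
    by (simp add: mcov_def algebra_simps)
qed

lemma kcov_eq_sum:
  assumes "a \<in> {1..m} \<times> {1..m}" "b \<in> {1..m} \<times> {1..m}"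
  shows "kcov p a b = (\<Sum>c\<in>{..m} \<times> {..m}. lweight p m (fst c) * lweight p m (snd c) *
     (centred p (fst c) (fst a) * centred p (snd c) (snd a)) *
     (centred p (fst c) (fst b) * centred p (snd c) (snd b)))"
  using assms unfolding kcov_def
  by (subst (1 2) mcov_eq_sum[of _ m])
    (auto simp: sum_product sum.cartesian_product case_prod_beta intro!: sum.cong)

text \<open>Inserting the level expansion of each factor turns the bilinear form into a diagonal one
  over the \<open>(m + 1)\<^sup>2\<close> level pairs, reference level included. Nonnegativity and
  coercivity are read off from it.\<close>

lemma kform_eq_sum:
  "kform p m f g = (\<Sum>c\<in>{..m} \<times> {..m}. lweight p m (fst c) * lweight p m (snd c) *
     ccoef p m f c * ccoef p m g c)"
proof -
  let ?J = "{1..m} \<times> {1..m}" and ?C = "{..m} \<times> {..m}"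
  let ?w = "\<lambda>c. lweight p m (fst c) * lweight p m (snd c)"
  let ?e = "\<lambda>c a. centred p (fst c) (fst a) * centred p (snd c) (snd a)"
  have "kform p m f g = (\<Sum>a\<in>?J. \<Sum>b\<in>?J. \<Sum>c\<in>?C. ?w c * (f a * ?e c a) * (g b * ?e c b))"
    unfolding kform_def
    by (intro sum.cong refl) (simp add: kcov_eq_sum sum_distrib_left sum_distrib_right algebra_simps)
  also have "\<dots> = (\<Sum>a\<in>?J. \<Sum>c\<in>?C. \<Sum>b\<in>?J. ?w c * (f a * ?e c a) * (g b * ?e c b))"
    by (intro sum.cong refl sum.swap)
  also have "\<dots> = (\<Sum>c\<in>?C. \<Sum>a\<in>?J. \<Sum>b\<in>?J. ?w c * (f a * ?e c a) * (g b * ?e c b))"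
    by (rule sum.swap)
  also have "\<dots> = (\<Sum>c\<in>?C. ?w c * ccoef p m f c * ccoef p m g c)"
    unfolding ccoef_def
    by (intro sum.cong refl) (simp only: mult.assoc sum_product sum_distrib_left[symmetric])
  finally show ?thesis .
qed

text \<open>For \<open>k\<close> different from \<open>0\<close>,
  \<open>centred p j k - centred p 0 k\<close> is the indicator of \<open>j = k\<close>.
  Differencing against the reference level in both coordinates thus isolates the coefficient at
  \<open>a\<close>.\<close>

lemma ccoef_recover:
  assumes "a \<in> {1..m} \<times> {1..m}"
  shows "f a = ccoef p m f a - ccoef p m f (fst a, 0) - ccoef p m f (0, snd a) + ccoef p m f (0, 0)"
proof -
  have "ccoef p m f a - ccoef p m f (fst a, 0) - ccoef p m f (0, snd a) + ccoef p m f (0, 0)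
     = (\<Sum>b\<in>{1..m} \<times> {1..m}. f b * of_bool (b = a))"
    unfolding ccoef_def sum.distrib[symmetric] sum_subtractf[symmetric]
  proof (intro sum.cong refl)
    fix b assume "b \<in> {1..m} \<times> {1..m}"
    then have "centred p 0 (fst b) = - p (fst b)" "centred p 0 (snd b) = - p (snd b)"
      by (auto simp: centred_def)
    moreover have "of_bool (b = a) = (of_bool (fst a = fst b) * of_bool (snd a = snd b) :: real)"
      by (auto simp: prod_eq_iff)
    ultimately show "f b * (centred p (fst a) (fst b) * centred p (snd a) (snd b)) -
        f b * (centred p (fst (fst a, 0)) (fst b) * centred p (snd (fst a, 0)) (snd b)) -
        f b * (centred p (fst (0, snd a)) (fst b) * centred p (snd (0, snd a)) (snd b)) +
        f b * (centred p (fst (0, 0)) (fst b) * centred p (snd (0, 0)) (snd b)) = f b * of_bool (b = a)"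
      unfolding centred_def[of p "fst a"] centred_def[of p "snd a"] fst_conv snd_conv
      by (simp add: algebra_simps del: of_bool_eq_1_iff)
  qed
  also have "\<dots> = (\<Sum>b\<in>{1..m} \<times> {1..m}. if b = a then f b else 0)"
    by (intro sum.cong) auto
  finally show ?thesis using assms by simp
qed

text \<open>\<open>p_rest\<close> is the lower bound \<open>\<pi>\<close> for the omitted reference
  level, so that all \<open>m + 1\<close> weights are bounded below.\<close>

locale level_probs =
  fixes p :: "nat \<Rightarrow> real" and m :: nat and \<pi> :: real
  assumes pi_pos: "\<pi> > 0" and p_ge: "\<And>k. k \<in> {1..m} \<Longrightarrow> \<pi> \<le> p k"
    and p_rest: "(\<Sum>k=1..m. p k) \<le> 1 - \<pi>"
begin

lemma lweight_ge: "j \<le> m \<Longrightarrow> \<pi> \<le> lweight p m j"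
  using p_ge[of j] p_rest by (auto simp: lweight_def)

lemma lweight_prod_ge:
  assumes "c \<in> {..m} \<times> {..m}"
  shows "\<pi>\<^sup>2 \<le> lweight p m (fst c) * lweight p m (snd c)"
  unfolding power2_eq_square using assms pi_pos
  by (intro mult_mono lweight_ge) (auto intro: order_trans[OF _ lweight_ge])

lemma kform_nonneg: "kform p m f f \<ge> 0"
  unfolding kform_eq_sum mult.assoc[of _ "ccoef p m f _"]
  by (intro sum_nonneg mult_nonneg_nonneg[OF order_trans[OF _ lweight_prod_ge]]) auto

text \<open>One summand of the diagonal form is at most the whole, and its weight is a product of
  two level weights, hence at least \<open>\<pi>\<^sup>2\<close>.\<close>

lemma ccoef_le:
  assumes "c \<in> {..m} \<times> {..m}"
  shows "\<bar>ccoef p m f c\<bar> \<le> sqrt (kform p m f f) / \<pi>"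
proof -
  have "\<pi>\<^sup>2 * (ccoef p m f c)\<^sup>2 \<le> lweight p m (fst c) * lweight p m (snd c) * (ccoef p m f c)\<^sup>2"
    using lweight_prod_ge[OF assms] by (intro mult_right_mono) auto
  also have "\<dots> \<le> (\<Sum>c\<in>{..m} \<times> {..m}. lweight p m (fst c) * lweight p m (snd c) * (ccoef p m f c)\<^sup>2)"
    by (rule member_le_sum[OF assms, where f = "\<lambda>c. lweight p m (fst c) * lweight p m (snd c) * (ccoef p m f c)\<^sup>2"])
      (auto intro!: mult_nonneg_nonneg[OF order_trans[OF _ lweight_prod_ge]])
  also have "\<dots> = kform p m f f"
    by (simp add: kform_eq_sum power2_eq_square mult.assoc)
  finally have "(\<pi> * \<bar>ccoef p m f c\<bar>)\<^sup>2 \<le> kform p m f f"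
    by (simp add: power_mult_distrib)
  then have "\<pi> * \<bar>ccoef p m f c\<bar> \<le> sqrt (kform p m f f)"
    by (rule real_le_rsqrt)
  then show ?thesis
    using pi_pos by (simp add: pos_le_divide_eq mult.commute)
qed

text \<open>Four coefficients recover \<open>f a\<close>, and each is at most
  \<open>sqrt (kform p m f f) / \<pi>\<close>; hence the factor \<open>4\<close>.\<close>

lemma kform_coercive:
  assumes "a \<in> {1..m} \<times> {1..m}"
  shows "\<bar>f a\<bar> \<le> 4 / \<pi> * sqrt (kform p m f f)"
proof -
  have "a \<in> {..m} \<times> {..m}" "(fst a, 0) \<in> {..m} \<times> {..m}" "(0, snd a) \<in> {..m} \<times> {..m}"
    "(0, 0) \<in> {..m} \<times> {..m}"
    using assms by auto
  from this[THEN ccoef_le[of _ f]] show ?thesis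
    by (subst ccoef_recover[OF assms, of f p]) (simp add: field_simps)
qed

lemma p_le_1: "k \<in> {1..m} \<Longrightarrow> p k \<le> 1"
proof -
  assume "k \<in> {1..m}"
  then have "p k \<le> (\<Sum>k=1..m. p k)"
    using pi_pos by (intro member_le_sum) (auto intro: order_trans[OF less_imp_le p_ge])
  with p_rest pi_pos show "p k \<le> 1" by linarith
qed

end

section \<open>The flip: symmetric and antisymmetric halves of the form\<close>

definition scov :: "(nat \<Rightarrow> real) \<Rightarrow> real \<Rightarrow> nat \<times> nat \<Rightarrow> nat \<times> nat \<Rightarrow> real" where
  "scov p W a b = kcov p a b + W * kcov p a (prod.swap b)"

lemma sum_swap_square:
  "(\<Sum>a\<in>A \<times> A. f (prod.swap a)) = (\<Sum>a\<in>A \<times> A. f a)"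
  by (rule sum.reindex_bij_witness[of _ prod.swap prod.swap]) auto

lemma scov_sym: "scov p W a b = scov p W b a"
  using kcov_swap[of p a "prod.swap b"] by (simp add: scov_def kcov_sym)

lemma kform_swap:
  "kform p m (f \<circ> prod.swap) (g \<circ> prod.swap) = kform p m f g"
proof -
  have "(\<Sum>b\<in>{1..m} \<times> {1..m}. f (prod.swap a) * kcov p a b * g (prod.swap b)) =
      (\<Sum>b\<in>{1..m} \<times> {1..m}. f (prod.swap a) * kcov p (prod.swap a) b * g b)" for a
    using sum_swap_square[of "\<lambda>b. f (prod.swap a) * kcov p (prod.swap a) b * g b" "{1..m}"]
    by (simp only: kcov_swap)
  then show ?thesis
    using sum_swap_square[of "\<lambda>a. \<Sum>b\<in>{1..m} \<times> {1..m}. f a * kcov p a b * g b" "{1..m}"]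
    by (simp only: kform_def o_apply)
qed

lemma ccoef_lin: "ccoef p m (\<lambda>a. (f a + s * g a) / 2) c = (ccoef p m f c + s * ccoef p m g c) / 2"
  unfolding ccoef_def sum_distrib_left sum.distrib[symmetric] sum_divide_distrib
  by (intro sum.cong refl) (simp add: field_simps)

lemma kform_lin:
  "kform p m (\<lambda>a. (f a + s * g a) / 2) (\<lambda>a. (f a + s * g a) / 2) =
    (kform p m f f + 2 * s * kform p m f g + s\<^sup>2 * kform p m g g) / 4"
  unfolding kform_eq_sum ccoef_lin sum_distrib_left sum.distrib[symmetric] sum_divide_distrib
  by (intro sum.cong refl) (simp add: field_simps power2_eq_square)

text \<open>The flip has eigenvalue \<open>1\<close> on symmetric and \<open>-1\<close> on
  antisymmetric functions and preserves \<open>kform\<close>. So the cross terms of the two halves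
  cancel, and \<open>1 + W T\<close> acts on them by the scalars \<open>1 + W\<close> and
  \<open>1 - W\<close>.\<close>

lemma scov_form_eq:
  "(\<Sum>a\<in>{1..m} \<times> {1..m}. \<Sum>b\<in>{1..m} \<times> {1..m}. f a * scov p W a b * f b) =
    (1 + W) * kform p m (\<lambda>a. (f a + 1 * (f \<circ> prod.swap) a) / 2) (\<lambda>a. (f a + 1 * (f \<circ> prod.swap) a) / 2) +
    (1 - W) * kform p m (\<lambda>a. (f a + - 1 * (f \<circ> prod.swap) a) / 2) (\<lambda>a. (f a + - 1 * (f \<circ> prod.swap) a) / 2)"
proof -
  have "(\<Sum>b\<in>{1..m} \<times> {1..m}. f a * kcov p a (prod.swap b) * f b) =
     (\<Sum>b\<in>{1..m} \<times> {1..m}. f a * kcov p a b * f (prod.swap b))" for a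
    using sum_swap_square[of "\<lambda>b. f a * kcov p a b * f (prod.swap b)" "{1..m}"]
    by (simp only: swap_swap)
  then have "(\<Sum>a\<in>{1..m} \<times> {1..m}. \<Sum>b\<in>{1..m} \<times> {1..m}. f a * kcov p a (prod.swap b) * f b) =
      kform p m f (f \<circ> prod.swap)"
    by (simp only: kform_def o_apply)
  moreover have "(\<Sum>a\<in>{1..m} \<times> {1..m}. \<Sum>b\<in>{1..m} \<times> {1..m}. f a * scov p W a b * f b) =
      kform p m f f + W * (\<Sum>a\<in>{1..m} \<times> {1..m}. \<Sum>b\<in>{1..m} \<times> {1..m}. f a * kcov p a (prod.swap b) * f b)"
    by (simp add: kform_def scov_def algebra_simps sum.distrib sum_distrib_left)
  ultimately have "(\<Sum>a\<in>{1..m} \<times> {1..m}. \<Sum>b\<in>{1..m} \<times> {1..m}. f a * scov p W a b * f b) =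
      kform p m f f + W * kform p m f (f \<circ> prod.swap)"
    by (simp only:)
  then show ?thesis
    unfolding kform_lin kform_swap by (simp add: field_simps o_def)
qed

text \<open>Expand the nonnegative form at \<open>V - s * e\<close>, with \<open>e\<close> the unit
  vector at \<open>a0\<close> and \<open>s = P a0\<close>: the cross terms give
  \<open>- 2 * s\<^sup>2\<close>, and the diagonal entry gives at most
  \<open>s\<^sup>2\<close>.\<close>

lemma quadratic_lower:
  fixes G :: "'i \<Rightarrow> 'i \<Rightarrow> real"
  assumes fin: "finite J" and sym: "\<And>a b. G a b = G b a"
    and psd: "\<And>f. (\<Sum>a\<in>J. \<Sum>b\<in>J. f a * G a b * f b) \<ge> 0"
    and sol: "\<And>a. a \<in> J \<Longrightarrow> (\<Sum>b\<in>J. G a b * V b) = P a"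
    and a0: "a0 \<in> J" "G a0 a0 \<le> 1"
  shows "(P a0)\<^sup>2 \<le> (\<Sum>a\<in>J. V a * P a)"
proof -
  define s where "s = P a0"
  define e :: "'i \<Rightarrow> real" where "e a = (if a = a0 then 1 else 0)" for a
  have e1: "(\<Sum>a\<in>J. e a * h a) = h a0" for h
  proof -
    have "(\<Sum>a\<in>J. e a * h a) = (\<Sum>a\<in>J. if a = a0 then h a else 0)"
      by (intro sum.cong) (auto simp: e_def)
    then show ?thesis using fin a0 by simp
  qed
  have 1: "(\<Sum>a\<in>J. \<Sum>b\<in>J. V a * G a b * V b) = (\<Sum>a\<in>J. V a * P a)"
    by (intro sum.cong refl) (simp add: mult.assoc sol flip: sum_distrib_left)
  have 2: "(\<Sum>a\<in>J. \<Sum>b\<in>J. e a * G a b * V b) = s"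
    by (simp add: mult.assoc sol e1 s_def a0 flip: sum_distrib_left)
  have 3: "(\<Sum>a\<in>J. \<Sum>b\<in>J. V a * G a b * e b) = s"
    by (subst sum.swap) (use 2 in \<open>simp add: mult_ac sym\<close>)
  have 4: "(\<Sum>a\<in>J. \<Sum>b\<in>J. e a * G a b * e b) = G a0 a0"
  proof -
    have "(\<Sum>a\<in>J. \<Sum>b\<in>J. e a * G a b * e b) = (\<Sum>a\<in>J. e a * (\<Sum>b\<in>J. e b * G a b))"
      by (simp add: sum_distrib_left mult_ac)
    then show ?thesis by (simp add: e1)
  qed
  have "0 \<le> (\<Sum>a\<in>J. \<Sum>b\<in>J. (V a - s * e a) * G a b * (V b - s * e b))"
    by (rule psd)
  also have "\<dots> = (\<Sum>a\<in>J. \<Sum>b\<in>J. V a * G a b * V b) - s * (\<Sum>a\<in>J. \<Sum>b\<in>J. e a * G a b * V b)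
      - s * (\<Sum>a\<in>J. \<Sum>b\<in>J. V a * G a b * e b) + s\<^sup>2 * (\<Sum>a\<in>J. \<Sum>b\<in>J. e a * G a b * e b)"
    unfolding sum_distrib_left sum.distrib[symmetric] sum_subtractf[symmetric]
    by (intro sum.cong refl) (simp add: algebra_simps power2_eq_square)
  also have "\<dots> = (\<Sum>a\<in>J. V a * P a) - 2 * s\<^sup>2 + s\<^sup>2 * G a0 a0"
    unfolding 1 2 3 4 by (simp add: power2_eq_square)
  also have "\<dots> \<le> (\<Sum>a\<in>J. V a * P a) - 2 * s\<^sup>2 + s\<^sup>2 * 1"
    using a0 by (intro add_left_mono mult_left_mono) auto
  finally show ?thesis by (simp add: s_def)
qed

context level_probs
begin

lemma scov_psd:
  assumes "0 \<le> W" "W \<le> 1"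
  shows "(\<Sum>a\<in>{1..m} \<times> {1..m}. \<Sum>b\<in>{1..m} \<times> {1..m}. f a * scov p W a b * f b) \<ge> 0"
  unfolding scov_form_eq using assms by (intro add_nonneg_nonneg mult_nonneg_nonneg kform_nonneg) auto

text \<open>Coercivity kills the symmetric and the antisymmetric half separately, and the two add up
  to \<open>f\<close>; \<open>W < 1\<close> keeps the weight of the second half positive.\<close>

lemma scov_definite:
  assumes W: "0 \<le> W" "W < 1" and a: "a \<in> {1..m} \<times> {1..m}"
    and 0: "(\<Sum>a\<in>{1..m} \<times> {1..m}. \<Sum>b\<in>{1..m} \<times> {1..m}. f a * scov p W a b * f b) = 0"
  shows "f a = 0"
proof -
  let ?s = "\<lambda>a. (f a + 1 * (f \<circ> prod.swap) a) / 2" and ?q = "\<lambda>a. (f a + - 1 * (f \<circ> prod.swap) a) / 2"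
  have nn: "(1 + W) * kform p m ?s ?s \<ge> 0" "(1 - W) * kform p m ?q ?q \<ge> 0"
    using W by (auto intro!: mult_nonneg_nonneg kform_nonneg)
  have "(1 + W) * kform p m ?s ?s + (1 - W) * kform p m ?q ?q = 0"
    using 0 unfolding scov_form_eq .
  with nn have "(1 + W) * kform p m ?s ?s = 0" "(1 - W) * kform p m ?q ?q = 0"
    by linarith+
  with W have "kform p m ?s ?s = 0" "kform p m ?q ?q = 0"
    by simp_all
  with kform_coercive[OF a, of ?s] kform_coercive[OF a, of ?q] show ?thesis
    by simp
qed

text \<open>The entry is \<open>1 + W\<close> times the square of a Bernoulli variance, and such a
  variance is at most \<open>1/4\<close>.\<close>

lemma scov_diag_le_1:
  assumes "0 \<le> W" "W \<le> 1" "k \<in> {1..m}"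
  shows "scov p W (k, k) (k, k) \<le> 1"
proof -
  have "p k - p k * p k \<le> 1 / 4" "p k - p k * p k \<ge> 0"
    using zero_le_power2[of "p k - 1/2"] mult_left_le[of "p k" "p k"] p_le_1[OF assms(3)] p_ge[OF assms(3)] pi_pos
    by (auto simp: power2_eq_square field_simps)
  note b = this
  then have "(p k - p k * p k) * (p k - p k * p k) \<le> 1/4 * (1/4)"
    by (intro mult_mono) auto
  moreover from b this assms have "W * ((p k - p k * p k) * (p k - p k * p k)) \<le> 1 * (1/4 * (1/4))"
    by (intro mult_mono mult_nonneg_nonneg) simp_all
  ultimately show ?thesis
    by (simp add: scov_def kcov_def mcov_def)
qed

lemma scov_lower:
  assumes "0 \<le> W" "W \<le> 1" "k \<in> {1..m}"
    and sol: "\<And>a. a \<in> {1..m} \<times> {1..m} \<Longrightarrow> (\<Sum>b\<in>{1..m} \<times> {1..m}. scov p W a b * V b) = P a"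
  shows "(P (k, k))\<^sup>2 \<le> (\<Sum>a\<in>{1..m} \<times> {1..m}. V a * P a)"
  using assms scov_psd scov_diag_le_1 
  by (intro quadratic_lower[where G = "scov p W"]) (auto intro: scov_sym)

text \<open>
  The form degenerates on antisymmetric arguments as \<open>W \<rightarrow> 1\<close>; the bound survives because the
  antisymmetric part of the right-hand side is of order \<open>1 - W\<close>.
\<close>

lemma scov_upper:
  assumes W: "0 \<le> W" "W \<le> 1"
    and sol: "\<And>a. a \<in> {1..m} \<times> {1..m} \<Longrightarrow> (\<Sum>b\<in>{1..m} \<times> {1..m}. scov p W a b * V b) = P a"
    and P: "\<And>a. a \<in> {1..m} \<times> {1..m} \<Longrightarrow> \<bar>P a\<bar> \<le> \<beta>"
    and Q: "\<And>a. a \<in> {1..m} \<times> {1..m} \<Longrightarrow> \<bar>P a - P (prod.swap a)\<bar> \<le> \<gamma> * (1 - W)"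
    and nn: "0 \<le> \<beta>" "0 \<le> \<gamma>"
  shows "sqrt (\<Sum>a\<in>{1..m} \<times> {1..m}. V a * P a) \<le> real (m\<^sup>2) * (4 / \<pi> * (\<beta> + \<gamma>))"
proof -
  let ?J = "{1..m} \<times> {1..m}"
  define S where "S a = (V a + 1 * (V \<circ> prod.swap) a) / 2" for a
  define D where "D a = (V a + - 1 * (V \<circ> prod.swap) a) / 2" for a
  define j where "j = (\<Sum>a\<in>?J. V a * P a)"
  define fS where "fS = kform p m S S"
  define fD where "fD = kform p m D D"
  have fnn: "fS \<ge> 0" "fD \<ge> 0" unfolding fS_def fD_def by (rule kform_nonneg)+
  have "j = (\<Sum>a\<in>?J. \<Sum>b\<in>?J. V a * scov p W a b * V b)"
    unfolding j_def by (intro sum.cong refl) (simp only: mult.assoc sol flip: sum_distrib_left)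
  also have "\<dots> = (1 + W) * fS + (1 - W) * fD"
    unfolding scov_form_eq fS_def fD_def S_def D_def ..
  finally have j: "j = (1 + W) * fS + (1 - W) * fD" .
  \<comment> \<open>\<open>j\<close> dominates each half of the form, but the antisymmetric one only
    together with its factor \<open>1 - W\<close>.\<close>
  have jS: "fS \<le> j" and jD: "(1 - W) * fD \<le> j" and j0: "0 \<le> j"
    using mult_left_mono[OF W(2) fnn(2)] mult_nonneg_nonneg[OF W(1) fnn(1)] fnn
    unfolding j by (simp_all add: algebra_simps)
  \<comment> \<open>\<open>D\<close> changes sign under the swap, so pairing it with
    \<open>P\<close> sees only the antisymmetric half of \<open>P\<close>, which is of order
    \<open>1 - W\<close>.\<close>
  have "(\<Sum>a\<in>?J. D a * P a) = (\<Sum>a\<in>?J. D (prod.swap a) * P (prod.swap a))"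
    by (rule sum_swap_square[of "\<lambda>a. D a * P a", symmetric])
  also have "\<dots> = - (\<Sum>a\<in>?J. D a * P (prod.swap a))"
    unfolding sum_negf[symmetric] by (intro sum.cong refl) (auto simp: D_def field_simps)
  finally have DP: "(\<Sum>a\<in>?J. D a * P a) = (\<Sum>a\<in>?J. D a * ((P a - P (prod.swap a)) / 2))"
    by (simp add: right_diff_distrib diff_divide_distrib sum_subtractf flip: sum_divide_distrib)
  have sum_const: "(\<Sum>a\<in>?J. t) = real (m\<^sup>2) * t" for t :: real
    by (simp add: power2_eq_square)
  have hS: "(\<Sum>a\<in>?J. S a * P a) \<le> real (m\<^sup>2) * (4 / \<pi> * sqrt fS * \<beta>)"
    unfolding sum_const[symmetric]
  proof (rule sum_mono)
    fix a assume a: "a \<in> ?J"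
    have "S a * P a \<le> \<bar>S a\<bar> * \<bar>P a\<bar>" by (simp flip: abs_mult)
    also have "\<dots> \<le> (4 / \<pi> * sqrt fS) * \<beta>"
      unfolding fS_def using P[OF a] pi_pos kform_nonneg by (intro mult_mono kform_coercive a) auto
    finally show "S a * P a \<le> (4 / \<pi> * sqrt fS) * \<beta>" .
  qed
  have hD: "(\<Sum>a\<in>?J. D a * P a) \<le> real (m\<^sup>2) * (4 / \<pi> * sqrt fD * (\<gamma> * (1 - W)))"
    unfolding DP sum_const[symmetric]
  proof (rule sum_mono)
    fix a assume a: "a \<in> ?J"
    have "D a * ((P a - P (prod.swap a)) / 2) \<le> \<bar>D a\<bar> * \<bar>(P a - P (prod.swap a)) / 2\<bar>"
      by (simp flip: abs_mult)
    also have "\<dots> \<le> (4 / \<pi> * sqrt fD) * (\<gamma> * (1 - W))"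
      unfolding fD_def using Q[OF a] pi_pos kform_nonneg by (intro mult_mono kform_coercive a) auto
    finally show "D a * ((P a - P (prod.swap a)) / 2) \<le> (4 / \<pi> * sqrt fD) * (\<gamma> * (1 - W))" .
  qed
  have "j = (\<Sum>a\<in>?J. S a * P a) + (\<Sum>a\<in>?J. D a * P a)"
    unfolding j_def sum.distrib[symmetric] by (intro sum.cong refl) (simp add: S_def D_def field_simps)
  then have "j \<le> real (m\<^sup>2) * (4 / \<pi> * sqrt fS * \<beta>) + real (m\<^sup>2) * (4 / \<pi> * sqrt fD * (\<gamma> * (1 - W)))"
    using hS hD by linarith
  also have "\<dots> = real (m\<^sup>2) * (4 / \<pi> * (sqrt fS * \<beta> + (1 - W) * sqrt fD * \<gamma>))"
    by (simp only: distrib_left ac_simps)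
  also have "\<dots> \<le> real (m\<^sup>2) * (4 / \<pi> * (sqrt j * \<beta> + sqrt j * \<gamma>))"
  proof -
    \<comment> \<open>The factor \<open>1 - W\<close> is split into two square roots: one is
      absorbed into \<open>(1 - W) * fD\<close>, which \<open>j\<close> dominates, and the other is
      at most \<open>1\<close>.\<close>
    have "(1 - W) * sqrt fD = sqrt (1 - W) * sqrt ((1 - W) * fD)"
      using W by (subst real_sqrt_mult) (simp add: mult.assoc[symmetric] del: real_sqrt_mult)
    also have "\<dots> \<le> 1 * sqrt j"
      using W jD fnn by (intro mult_mono) auto
    finally show ?thesis
      using jS pi_pos nn by (intro mult_left_mono add_mono mult_right_mono) auto
  qed
  finally have "sqrt j * sqrt j \<le> (real (m\<^sup>2) * (4 / \<pi> * (\<beta> + \<gamma>))) * sqrt j"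
    using j0 by (simp only: real_sqrt_mult_self abs_of_nonneg distrib_left distrib_right ac_simps)
  then have "sqrt j \<le> real (m\<^sup>2) * (4 / \<pi> * (\<beta> + \<gamma>))"
  proof (cases "sqrt j = 0")
    case True
    then show ?thesis using pi_pos nn by simp
  next
    case False
    then have "sqrt j > 0" using j0 by simp
    with \<open>sqrt j * sqrt j \<le> _\<close> show ?thesis by (rule mult_right_le_imp_le)
  qed
  then show ?thesis unfolding j_def .
qed

end

section \<open>Nearest-neighbour graphs\<close>

text \<open>An arbitrary index set in place of \<open>{1..n}\<close>, because deleting a sample
  point leaves a gap in the indices.\<close>

definition nn_in :: "nat set \<Rightarrow> (nat \<Rightarrow> 'h::metric_space) \<Rightarrow> nat \<Rightarrow> nat" where
  "nn_in S x i = (LEAST j. j \<in> S - {i} \<and> (\<forall>k\<in>S - {i}. dist (x i) (x j) \<le> dist (x i) (x k)))"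

lemma nn_eq: "nn n x i = nn_in {1..n} x i"
  by (simp add: nn_def nn_in_def)

lemma nn_in_props:
  assumes "finite S" "S - {i} \<noteq> {}"
  shows "nn_in S x i \<in> S - {i} \<and> (\<forall>k\<in>S - {i}. dist (x i) (x (nn_in S x i)) \<le> dist (x i) (x k))"
proof -
  from assms obtain j where "j \<in> S - {i}" "\<And>k. k \<in> S - {i} \<Longrightarrow> dist (x i) (x j) \<le> dist (x i) (x k)"
    using arg_min_if_finite(1)[of "S - {i}" "\<lambda>j. dist (x i) (x j)"]
      arg_min_least[of "S - {i}" _ "\<lambda>j. dist (x i) (x j)"] by (metis finite_Diff)
  then show ?thesis
    unfolding nn_in_def
    by (intro LeastI_ex[where P = "\<lambda>j. j \<in> S - {i} \<and> (\<forall>k\<in>S - {i}. dist (x i) (x j) \<le> dist (x i) (x k))"]) auto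
qed

lemma nn_in_eqI:
  assumes "j \<in> S - {i}" "\<And>k. k \<in> S - {i} \<Longrightarrow> dist (x i) (x j) \<le> dist (x i) (x k)"
    and "\<And>l. l \<in> S - {i} \<Longrightarrow> (\<And>k. k \<in> S - {i} \<Longrightarrow> dist (x i) (x l) \<le> dist (x i) (x k)) \<Longrightarrow> j \<le> l"
  shows "nn_in S x i = j"
  unfolding nn_in_def by (rule Least_equality) (use assms in auto)

lemma nn_in_le:
  assumes "l \<in> S - {i}" "\<And>k. k \<in> S - {i} \<Longrightarrow> dist (x i) (x l) \<le> dist (x i) (x k)"
  shows "nn_in S x i \<le> l"
  unfolding nn_in_def by (rule Least_le) (use assms in auto)

text \<open>Whatever is minimal after the removal was minimal before, since the old neighbour is
  still among the competitors; so the tie-breaking is unaffected as well.\<close>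

lemma nn_in_remove:
  assumes S: "finite S" "S - {a} \<noteq> {}" and i: "nn_in S x a \<noteq> i"
  shows "nn_in (S - {i}) x a = nn_in S x a"
proof (rule nn_in_eqI)
  note N = nn_in_props[OF S, of x]
  show "nn_in S x a \<in> S - {i} - {a}" using N i by auto
  show "dist (x a) (x (nn_in S x a)) \<le> dist (x a) (x k)" if "k \<in> S - {i} - {a}" for k
    using N that by auto
  fix l assume l: "l \<in> S - {i} - {a}" "\<And>k. k \<in> S - {i} - {a} \<Longrightarrow> dist (x a) (x l) \<le> dist (x a) (x k)"
  have "dist (x a) (x l) \<le> dist (x a) (x (nn_in S x a))"
    using N i by (intro l) auto
  with l N show "nn_in S x a \<le> l"
    by (intro nn_in_le) (auto intro: order_trans)
qed

text \<open>Monotonicity is asked only off \<open>t\<close>: a point does not compete to be its own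
  neighbour, so tie-breaking compares indices in \<open>T - {t}\<close> alone. This allows
  \<open>\<sigma>\<close> to move \<open>t\<close> to any place.\<close>

lemma nn_in_reindex:
  assumes T: "finite T" "T - {t} \<noteq> {}" and mono: "strict_mono_on (T - {t}) \<sigma>"
    and t: "\<sigma> t \<notin> \<sigma> ` (T - {t})"
  shows "nn_in (\<sigma> ` T) x (\<sigma> t) = \<sigma> (nn_in T (x \<circ> \<sigma>) t)"
proof (rule nn_in_eqI)
  note N = nn_in_props[OF T, of "x \<circ> \<sigma>"]
  have eq: "\<sigma> ` T - {\<sigma> t} = \<sigma> ` (T - {t})" using t by blast
  show "\<sigma> (nn_in T (x \<circ> \<sigma>) t) \<in> \<sigma> ` T - {\<sigma> t}" using N eq by auto
  show "dist (x (\<sigma> t)) (x (\<sigma> (nn_in T (x \<circ> \<sigma>) t))) \<le> dist (x (\<sigma> t)) (x k)" if "k \<in> \<sigma> ` T - {\<sigma> t}" for k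
    using N that by auto
  fix l assume l: "l \<in> \<sigma> ` T - {\<sigma> t}"
    "\<And>k. k \<in> \<sigma> ` T - {\<sigma> t} \<Longrightarrow> dist (x (\<sigma> t)) (x l) \<le> dist (x (\<sigma> t)) (x k)"
  then obtain s where s: "s \<in> T - {t}" "l = \<sigma> s" unfolding eq by auto
  have "nn_in T (x \<circ> \<sigma>) t \<le> s"
  proof (rule nn_in_le[OF s(1)])
    fix k assume "k \<in> T - {t}"
    then have "\<sigma> k \<in> \<sigma> ` T - {\<sigma> t}" unfolding eq by auto
    from l(2)[OF this] show "dist ((x \<circ> \<sigma>) t) ((x \<circ> \<sigma>) s) \<le> dist ((x \<circ> \<sigma>) t) ((x \<circ> \<sigma>) k)"
      by (simp add: s)
  qed
  then show "\<sigma> (nn_in T (x \<circ> \<sigma>) t) \<le> l"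
    using strict_mono_on_leD[OF mono] N s by auto
qed

lemma nn_in_cong:
  assumes "\<And>j. j \<in> S \<Longrightarrow> x j = y j" "i \<in> S"
  shows "nn_in S x i = nn_in S y i"
proof -
  have "(\<lambda>j. j \<in> S - {i} \<and> (\<forall>k\<in>S - {i}. dist (x i) (x j) \<le> dist (x i) (x k))) =
      (\<lambda>j. j \<in> S - {i} \<and> (\<forall>k\<in>S - {i}. dist (y i) (y j) \<le> dist (y i) (y k)))"
    using assms by (intro ext) (auto 4 3)
  then show ?thesis by (simp add: nn_in_def)
qed

lemma nn_in_range:
  assumes "2 \<le> n" "i \<in> {1..n}"
  shows "nn_in {1..n} x i \<in> {1..n} - {i}"
proof -
  have "(if i = 1 then 2 else 1) \<in> {1..n} - {i}" using assms by auto
  then show ?thesis by (intro nn_in_props[THEN conjunct1]) auto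
qed

text \<open>The event \<open>W = 1\<close>, stated on a general index set so that single points can
  be deleted.\<close>

definition all_mutual :: "nat set \<Rightarrow> (nat \<Rightarrow> 'h::metric_space) \<Rightarrow> bool" where
  "all_mutual S x \<longleftrightarrow> (\<forall>a\<in>S. nn_in S x (nn_in S x a) = a)"

lemma all_mutual_reindex:
  assumes T: "finite T" "2 \<le> card T" and mono: "strict_mono_on T \<sigma>"
  shows "all_mutual (\<sigma> ` T) x \<longleftrightarrow> all_mutual T (x \<circ> \<sigma>)"
proof -
  have inj: "inj_on \<sigma> T" using mono by (rule strict_mono_on_imp_inj_on)
  have ne: "T - {t} \<noteq> {}" for t
  proof
    assume "T - {t} = {}"
    then have "T \<subseteq> {t}" by auto
    from card_mono[OF _ this] T show False by auto
  qed
  have *: "nn_in (\<sigma> ` T) x (\<sigma> t) = \<sigma> (nn_in T (x \<circ> \<sigma>) t)" if "t \<in> T" for t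
    using that inj by (intro nn_in_reindex T ne monotone_on_subset[OF mono]) (auto dest: inj_onD)
  have "nn_in T (x \<circ> \<sigma>) t \<in> T" for t using nn_in_props[OF T(1) ne[of t], of "x \<circ> \<sigma>"] by auto
  then show ?thesis
    unfolding all_mutual_def using inj by (auto simp: * inj_on_eq_iff)
qed

text \<open>
  If \<open>a\<close> is not the nearest neighbour of its nearest neighbour, this persists after the removal of a
  point other than \<open>a\<close> and the next two points on its nearest-neighbour path. If all pairs are
  mutual, removing a point leaves its partner without a mutual neighbour.
\<close>

lemma card_all_mutual_removals:
  assumes S: "finite S" "3 \<le> card S"
  shows "card {i \<in> S. all_mutual (S - {i}) x} \<le> 3"
proof -
  let ?N = "nn_in S x"
  have ne2: "S - {t, s} \<noteq> {}" for t s
  proof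
    assume "S - {t, s} = {}"
    then have "S \<subseteq> {t, s}" by auto
    from card_mono[OF _ this] S show False by (simp add: card_insert_if split: if_splits)
  qed
  have ne: "S - {t} \<noteq> {}" for t using ne2[of t t] by simp
  have N: "?N t \<in> S - {t}" for t using nn_in_props[OF S(1) ne[of t], of x] by auto
  show ?thesis
  proof (cases "all_mutual S x")
    case False
    then obtain a where a: "a \<in> S" "?N (?N a) \<noteq> a" by (auto simp: all_mutual_def)
    have "i \<in> {a, ?N a, ?N (?N a)}" if i: "i \<in> S" "all_mutual (S - {i}) x" for i
    proof (rule ccontr)
      assume *: "i \<notin> {a, ?N a, ?N (?N a)}"
      then have "nn_in (S - {i}) x a = ?N a" "nn_in (S - {i}) x (?N a) = ?N (?N a)"
        using N by (auto intro!: nn_in_remove S ne)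
      moreover have "nn_in (S - {i}) x (nn_in (S - {i}) x a) = a"
        using i a(1) * unfolding all_mutual_def by blast
      ultimately show False using a(2) by simp
    qed
    then have "card {i \<in> S. all_mutual (S - {i}) x} \<le> card {a, ?N a, ?N (?N a)}"
      by (intro card_mono) auto
    also have "\<dots> \<le> 3" by (simp add: card_insert_if)
    finally show ?thesis .
  next
    case True
    have "\<not> all_mutual (S - {i}) x" if i: "i \<in> S" for i
    proof
      assume *: "all_mutual (S - {i}) x"
      let ?j = "?N i" let ?c = "nn_in (S - {i}) x ?j"
      have Nj: "?N ?j = i" and j: "?j \<in> S" "?j \<noteq> i" using True i N[of i] by (auto simp: all_mutual_def)
      have "S - {i} - {?j} \<noteq> {}" using ne2[of i ?j] by (simp add: Diff_insert2[symmetric] insert_commute)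
      from nn_in_props[OF _ this, of x] have c: "?c \<in> S" "?c \<noteq> i" "?c \<noteq> ?j" using S by auto
      \<comment> \<open>In \<open>S\<close> only \<open>?j\<close> points to \<open>i\<close>, so
        deleting \<open>i\<close> does not change the neighbour of \<open>?c\<close>. That neighbour
        is \<open>?j\<close> by mutuality without \<open>i\<close>, and then mutuality in
        \<open>S\<close> forces \<open>?c = i\<close>.\<close>
      have "?N ?c \<noteq> i" using True c(1,3) by (auto simp: all_mutual_def)
      then have "nn_in (S - {i}) x ?c = ?N ?c" by (intro nn_in_remove S ne)
      moreover have "nn_in (S - {i}) x ?c = ?j" using * j by (auto simp: all_mutual_def)
      ultimately have "?c = i" using True c(1) Nj unfolding all_mutual_def by metis
      with c show False by simp
    qed
    then have "{i \<in> S. all_mutual (S - {i}) x} = {}" by auto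
    then show ?thesis by (simp only: card.empty)
  qed
qed

lemma mutual_frac_eq:
  "mutual_frac n x = real (card {i \<in> {1..n}. nn n x (nn n x i) = i}) / real n"
proof -
  have "(\<Sum>i=1..n. of_bool (nn n x (nn n x i) = i)) = real (card {i \<in> {1..n}. nn n x (nn n x i) = i})"
    by (simp add: sum.If_cases Int_def flip: of_bool_def)
  then show ?thesis by (simp add: mutual_frac_def)
qed

lemma mutual_frac_bounds: "0 \<le> mutual_frac n x" "mutual_frac n x \<le> 1"
proof -
  have "card {i \<in> {1..n}. nn n x (nn n x i) = i} \<le> card {1..n}" by (rule card_mono) auto
  then show "mutual_frac n x \<le> 1" by (cases "n = 0") (auto simp: mutual_frac_eq divide_simps)
qed (simp add: mutual_frac_eq)

lemma mutual_frac_less_1: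
  assumes "\<not> all_mutual {1..n} x"
  shows "mutual_frac n x < 1"
proof -
  have "n \<noteq> 0" using assms by (auto simp: all_mutual_def)
  have "{i \<in> {1..n}. nn n x (nn n x i) = i} \<subset> {1..n}"
    using assms by (auto simp: all_mutual_def nn_eq)
  then have "card {i \<in> {1..n}. nn n x (nn n x i) = i} < card {1..n}" by (intro psubset_card_mono) auto
  with \<open>n \<noteq> 0\<close> show ?thesis by (simp add: mutual_frac_eq)
qed

section \<open>Frequencies of a single realisation\<close>

lemma p_joint_nonneg: "0 \<le> p_joint n x y k l"
  by (simp add: p_joint_def sum_nonneg)

lemma p_row_nonneg: "0 \<le> p_row K n x y k"
  by (simp add: p_row_def sum_nonneg p_joint_nonneg)

lemma q_col_nonneg: "0 \<le> q_col K n x y k"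
  by (simp add: q_col_def sum_nonneg p_joint_nonneg)

text \<open>Only an inequality, because \<open>y\<close> is arbitrary here and values outside
  \<open>{1..K}\<close> are not counted.\<close>

lemma sum_p_row_le_1: "(\<Sum>k=1..K. p_row K n x y k) \<le> 1"
proof -
  have inner: "(\<Sum>k=1..K. \<Sum>l=1..K. of_bool (y i = k \<and> y (nn n x i) = l) :: real) \<le> 1" for i
  proof -
    have "(\<Sum>k=1..K. \<Sum>l=1..K. of_bool (y i = k \<and> y (nn n x i) = l) :: real) =
      (\<Sum>k=1..K. of_bool (y i = k)) * (\<Sum>l=1..K. of_bool (y (nn n x i) = l))"
      by (simp only: sum_product of_bool_conj)
    moreover have "(\<Sum>k=1..K. of_bool (j = k) :: real) \<le> 1" for j
      by (cases "j \<in> {1..K}") (simp_all add: of_bool_def)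
    ultimately show ?thesis by (simp add: mult_le_one sum_nonneg)
  qed
  have "(\<Sum>k=1..K. p_row K n x y k) =
      (1 / real n) * (\<Sum>k=1..K. \<Sum>l=1..K. \<Sum>i=1..n. of_bool (y i = k \<and> y (nn n x i) = l))"
    by (simp only: p_row_def p_joint_def sum_distrib_left)
  also have "(\<Sum>k=1..K. \<Sum>l=1..K. \<Sum>i=1..n. of_bool (y i = k \<and> y (nn n x i) = l) :: real) =
      (\<Sum>k=1..K. \<Sum>i=1..n. \<Sum>l=1..K. of_bool (y i = k \<and> y (nn n x i) = l))"
    by (intro sum.cong refl sum.swap)
  also have "\<dots> = (\<Sum>i=1..n. \<Sum>k=1..K. \<Sum>l=1..K. of_bool (y i = k \<and> y (nn n x i) = l))"
    by (rule sum.swap)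
  also have "(1 / real n) * \<dots> \<le> (1 / real n) * (\<Sum>i=1..n. 1)"
    by (intro mult_left_mono sum_mono inner) auto
  also have "\<dots> \<le> 1" by simp
  finally show ?thesis .
qed

lemma sum_q_col: "(\<Sum>l=1..K. q_col K n x y l) = (\<Sum>k=1..K. p_row K n x y k)"
  unfolding q_col_def p_row_def by (rule sum.swap)

lemma p_row_le_1: "k \<in> {1..K} \<Longrightarrow> p_row K n x y k \<le> 1"
  using member_le_sum[of k "{1..K}" "p_row K n x y"] sum_p_row_le_1[of K n x y] p_row_nonneg
  by (metis (no_types, lifting) finite_atLeastAtMost order_trans)

lemma q_col_le_1: "k \<in> {1..K} \<Longrightarrow> q_col K n x y k \<le> 1"
  using member_le_sum[of k "{1..K}" "q_col K n x y"] sum_p_row_le_1[of K n x y] q_col_nonneg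
  by (metis (no_types, lifting) finite_atLeastAtMost order_trans sum_q_col)

lemma p_joint_le_1: "k \<in> {1..K} \<Longrightarrow> l \<in> {1..K} \<Longrightarrow> p_joint n x y k l \<le> 1"
  using member_le_sum[of l "{1..K}" "p_joint n x y k"] p_row_le_1[of k K n x y] p_joint_nonneg
  unfolding p_row_def by (metis (no_types, lifting) finite_atLeastAtMost order_trans)

text \<open>The contributions of mutual pairs cancel.\<close>

lemma p_joint_asym:
  assumes n: "2 \<le> n"
  shows "\<bar>p_joint n x y k l - p_joint n x y l k\<bar> \<le> 1 - mutual_frac n x"
proof -
  let ?N = "nn n x"
  define S where "S = {i \<in> {1..n}. ?N (?N i) = i}"
  define g :: "nat \<Rightarrow> nat \<Rightarrow> nat \<Rightarrow> real" where "g k l i = of_bool (y i = k \<and> y (?N i) = l)" for k l i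
  have N: "?N i \<in> {1..n}" if "i \<in> {1..n}" for i
    using nn_in_range[OF n that, of x] by (simp add: nn_eq)
  have S: "S \<subseteq> {1..n}" "finite S" by (auto simp: S_def)
  \<comment> \<open>The neighbour map is an involution of \<open>S\<close> that turns the pair of
    levels \<open>(k, l)\<close> into \<open>(l, k)\<close>.\<close>
  have "(\<Sum>i\<in>S. g k l i) = (\<Sum>i\<in>S. g l k i)"
    by (rule sum.reindex_bij_witness[of _ ?N ?N]) (use N in \<open>auto simp: S_def g_def simp del: One_nat_def atLeastAtMost_iff\<close>)
  then have "(\<Sum>i=1..n. g k l i) - (\<Sum>i=1..n. g l k i) = (\<Sum>i\<in>{1..n} - S. g k l i - g l k i)"
    by (simp only: sum.subset_diff[OF S(1) finite_atLeastAtMost] sum_subtractf)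
  also have "\<bar>\<dots>\<bar> \<le> (\<Sum>i\<in>{1..n} - S. 1)"
    by (rule order_trans[OF sum_abs sum_mono]) (auto simp: g_def)
  also have "\<dots> = real n - real (card S)"
    using S by (simp add: card_Diff_subset of_nat_diff card_mono[of "{1..n}", simplified])
  finally have "\<bar>(\<Sum>i=1..n. g k l i) - (\<Sum>i=1..n. g l k i)\<bar> / real n \<le> (real n - real (card S)) / real n"
    by (rule divide_right_mono) simp
  moreover have "p_joint n x y k l - p_joint n x y l k = ((\<Sum>i=1..n. g k l i) - (\<Sum>i=1..n. g l k i)) / real n"
    by (simp add: p_joint_def g_def diff_divide_distrib)
  moreover have "(real n - real (card S)) / real n = 1 - mutual_frac n x"
    using n by (simp add: mutual_frac_eq S_def diff_divide_distrib)
  ultimately show ?thesis by simp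
qed

text \<open>The difference of the margins is the sum over \<open>l\<close> of
  \<open>p_joint n x y k l - p_joint n x y l k\<close>, so the cancellation of mutual pairs carries
  over.\<close>

lemma p_row_q_col:
  assumes n: "2 \<le> n"
  shows "\<bar>p_row K n x y k - q_col K n x y k\<bar> \<le> real K * (1 - mutual_frac n x)"
proof -
  have "\<bar>p_row K n x y k - q_col K n x y k\<bar> \<le> (\<Sum>l=1..K. \<bar>p_joint n x y k l - p_joint n x y l k\<bar>)"
    unfolding p_row_def q_col_def sum_subtractf[symmetric] by (rule sum_abs)
  also have "\<dots> \<le> (\<Sum>l=1..K. 1 - mutual_frac n x)"
    by (intro sum_mono p_joint_asym n)
  finally show ?thesis by simp
qed

text \<open>An entry of \<open>P_n / sqrt n\<close>, indexed by a pair of levels rather than by its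
  position in the stacked vector.\<close>

definition dep_dev :: "nat \<Rightarrow> nat \<Rightarrow> (nat \<Rightarrow> 'h::metric_space) \<Rightarrow> (nat \<Rightarrow> nat) \<Rightarrow> nat \<times> nat \<Rightarrow> real" where
  "dep_dev K n x y a = p_joint n x y (fst a) (snd a) - p_row K n x y (fst a) * q_col K n x y (snd a)"

lemma dep_dev_le_1:
  assumes "a \<in> {1..K} \<times> {1..K}"
  shows "\<bar>dep_dev K n x y a\<bar> \<le> 1"
proof -
  have "p_row K n x y (fst a) * q_col K n x y (snd a) \<le> 1"
    using assms by (intro mult_le_one p_row_le_1 q_col_le_1 q_col_nonneg) auto
  moreover have "0 \<le> p_row K n x y (fst a) * q_col K n x y (snd a)"
    by (intro mult_nonneg_nonneg p_row_nonneg q_col_nonneg)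
  moreover have "p_joint n x y (fst a) (snd a) \<le> 1"
    using assms by (intro p_joint_le_1[of _ K]) auto
  moreover note p_joint_nonneg[of n x y "fst a" "snd a"]
  ultimately show ?thesis by (simp add: dep_dev_def)
qed

text \<open>Swapping the indices also exchanges row and column margins, which may differ by
  \<open>K * (1 - W)\<close>. The constant counts one such error for each of the two factors, plus
  the asymmetry of \<open>p_joint\<close>.\<close>

lemma dep_dev_asym:
  assumes n: "2 \<le> n" and a: "a \<in> {1..K} \<times> {1..K}"
  shows "\<bar>dep_dev K n x y a - dep_dev K n x y (prod.swap a)\<bar> \<le> (1 + 2 * real K) * (1 - mutual_frac n x)"
proof -
  let ?p = "p_row K n x y" and ?q = "q_col K n x y" and ?d = "1 - mutual_frac n x"
  obtain k l where kl: "a = (k, l)" "k \<in> {1..K}" "l \<in> {1..K}" using a by auto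
  have "\<bar>?p k * (?q l - ?p l)\<bar> \<le> 1 * (real K * ?d)"
    unfolding abs_mult using kl p_row_nonneg[of K n x y k] p_row_le_1[of k K n x y] p_row_q_col[OF n, of K x y l]
    by (intro mult_mono) (auto simp: abs_minus_commute)
  moreover have "\<bar>?p l * (?p k - ?q k)\<bar> \<le> 1 * (real K * ?d)"
    unfolding abs_mult using kl p_row_nonneg[of K n x y l] p_row_le_1[of l K n x y] p_row_q_col[OF n, of K x y k]
    by (intro mult_mono) auto
  moreover have "\<bar>p_joint n x y k l - p_joint n x y l k\<bar> \<le> ?d"
    by (rule p_joint_asym[OF n])
  moreover have "dep_dev K n x y a - dep_dev K n x y (prod.swap a) =
      (p_joint n x y k l - p_joint n x y l k) - ?p k * (?q l - ?p l) - ?p l * (?p k - ?q k)"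
    by (simp add: dep_dev_def kl algebra_simps)
  ultimately show ?thesis by (simp add: algebra_simps)
qed

section \<open>Bounds on the test statistic\<close>

definition vec_pos :: "nat \<Rightarrow> nat \<Rightarrow> nat \<times> nat" where
  "vec_pos m r = (row_of m r, col_of m r)"

definition vec_idx :: "nat \<Rightarrow> nat \<times> nat \<Rightarrow> nat" where
  "vec_idx m a = (snd a - 1) * m + (fst a - 1)"

lemma vec_idx_pos: "vec_idx m (vec_pos m r) = r"
  by (simp add: vec_idx_def vec_pos_def row_of_def col_of_def)

lemma square_indices_cases:
  assumes "a \<in> {1..m} \<times> {1..m}"
  obtains k l where "a = (Suc k, Suc l)" "k < m" "l < m"
  using assms by (cases a; cases "fst a"; cases "snd a") auto

lemma vec_pos_idx:
  assumes "a \<in> {1..m} \<times> {1..m}"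
  shows "vec_pos m (vec_idx m a) = a"
  using assms by (rule square_indices_cases) (simp add: vec_idx_def vec_pos_def row_of_def col_of_def)

lemma vec_pos_in: "r < m\<^sup>2 \<Longrightarrow> vec_pos m r \<in> {1..m} \<times> {1..m}"
  by (cases "m = 0")
    (auto simp: vec_pos_def row_of_def col_of_def power2_eq_square less_mult_imp_div_less Suc_le_eq)

lemma vec_idx_less:
  assumes "a \<in> {1..m} \<times> {1..m}"
  shows "vec_idx m a < m\<^sup>2"
proof -
  obtain k l where a: "a = (Suc k, Suc l)" "k < m" "l < m"
    using assms by (rule square_indices_cases)
  have "l * m + k < l * m + m" using a by simp
  also have "\<dots> = Suc l * m" by simp
  also have "\<dots> \<le> m * m" using a by (intro mult_le_mono1) simp
  finally show ?thesis by (simp add: vec_idx_def a power2_eq_square)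
qed

lemma sum_vec_pos: "(\<Sum>r = 0..<m\<^sup>2. h (vec_pos m r)) = (\<Sum>a\<in>{1..m} \<times> {1..m}. h a)"
  by (rule sum.reindex_bij_witness[of _ "vec_idx m" "vec_pos m"])
    (use vec_pos_in vec_idx_less vec_idx_pos vec_pos_idx in auto)

text \<open>The four groups of terms are the expansion of a product of two \<open>mcov\<close>
  factors; the terms carrying \<open>W\<close> are the same expansion with the second index pair
  swapped.\<close>

lemma Sigma_entry_eq:
  "Sigma_entry K n x y k1 l1 k2 l2 = scov (p_row K n x y) (mutual_frac n x) (k1, l1) (k2, l2)"
  by (cases "k1 = k2"; cases "l1 = l2"; cases "l1 = k2"; cases "k1 = l2")
    (simp_all add: Sigma_entry_def scov_def kcov_def mcov_def Let_def algebra_simps)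

lemma Sigma_hat_carrier: "Sigma_hat K n x y \<in> carrier_mat ((K - 1)\<^sup>2) ((K - 1)\<^sup>2)"
  by (simp add: Sigma_hat_def)

lemma P_stat_dim: "dim_vec (P_stat K n x y) = (K - 1)\<^sup>2"
  by (simp add: P_stat_def)

lemma P_stat_nth:
  "r < (K - 1)\<^sup>2 \<Longrightarrow> Matrix.vec_index (P_stat K n x y) r = sqrt n * dep_dev K n x y (vec_pos (K - 1) r)"
  by (simp add: P_stat_def dep_dev_def vec_pos_def Let_def)

lemma Sigma_hat_mult_nth:
  assumes "dim_vec v = (K - 1)\<^sup>2" "r < (K - 1)\<^sup>2"
  shows "Matrix.vec_index (Sigma_hat K n x y *\<^sub>v v) r =
    (\<Sum>b\<in>{1..K - 1} \<times> {1..K - 1}. scov (p_row K n x y) (mutual_frac n x) (vec_pos (K - 1) r) b *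
       Matrix.vec_index v (vec_idx (K - 1) b))"
proof -
  have "Matrix.vec_index (Sigma_hat K n x y *\<^sub>v v) r = (\<Sum>s = 0..<(K - 1)\<^sup>2.
     scov (p_row K n x y) (mutual_frac n x) (vec_pos (K - 1) r) (vec_pos (K - 1) s) * Matrix.vec_index v s)"
    using assms by (simp add: Sigma_hat_def scalar_prod_def Sigma_entry_eq vec_pos_def)
  also have "\<dots> = (\<Sum>s = 0..<(K - 1)\<^sup>2. (\<lambda>b. scov (p_row K n x y) (mutual_frac n x) (vec_pos (K - 1) r) b *
       Matrix.vec_index v (vec_idx (K - 1) b)) (vec_pos (K - 1) s))"
    by (simp add: vec_idx_pos)
  also have "\<dots> = (\<Sum>b\<in>{1..K - 1} \<times> {1..K - 1}. scov (p_row K n x y) (mutual_frac n x) (vec_pos (K - 1) r) b *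
       Matrix.vec_index v (vec_idx (K - 1) b))"
    by (rule sum_vec_pos)
  finally show ?thesis .
qed

text \<open>The conditions on one realisation that hold with probability tending to one; the bounds
  on the statistic are deterministic consequences of them.\<close>

locale stat_bounds =
  fixes K n :: nat and x :: "nat \<Rightarrow> 'h::metric_space" and y :: "nat \<Rightarrow> nat" and \<pi> :: real
  assumes K: "2 \<le> K" and n: "2 \<le> n" and pi: "0 < \<pi>"
    and p_row_ge: "\<And>k. k \<in> {1..K} \<Longrightarrow> \<pi> \<le> p_row K n x y k"
    and mutual: "mutual_frac n x < 1"
begin

sublocale level_probs "p_row K n x y" "K - 1" \<pi>
proof
  have "{1..K} = insert K {1..K - 1}" using K by auto
  then have "(\<Sum>k=1..K. p_row K n x y k) = p_row K n x y K + (\<Sum>k=1..K - 1. p_row K n x y k)"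
    using K by simp
  \<comment> \<open>Level \<open>K\<close> plays the reference level: its share of at least
    \<open>\<pi>\<close> comes out of a total of at most \<open>1\<close>.\<close>
  then show "(\<Sum>k=1..K - 1. p_row K n x y k) \<le> 1 - \<pi>"
    using sum_p_row_le_1[of K n x y] p_row_ge[of K] K by simp
qed (use pi p_row_ge in auto)

text \<open>A kernel vector has quadratic form zero, so \<open>scov_definite\<close> makes it
  vanish.\<close>

lemma Sigma_hat_unit: "Sigma_hat K n x y \<in> Units (ring_mat TYPE(real) ((K - 1)\<^sup>2) ())"
proof (rule det_non_zero_imp_unit[OF Sigma_hat_carrier])
  show "Determinant.det (Sigma_hat K n x y) \<noteq> 0"
  proof
    let ?m = "K - 1"
    let ?S = "Sigma_hat K n x y"
    assume "Determinant.det ?S = 0"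
    then obtain v where v: "v \<in> carrier_vec (?m\<^sup>2)" "v \<noteq> 0\<^sub>v (?m\<^sup>2)" "?S *\<^sub>v v = 0\<^sub>v (?m\<^sup>2)"
      using det_0_iff_vec_prod_zero_field[OF Sigma_hat_carrier] by blast
    define V where "V b = Matrix.vec_index v (vec_idx ?m b)" for b
    have 0: "(\<Sum>b\<in>{1..?m} \<times> {1..?m}. scov (p_row K n x y) (mutual_frac n x) a b * V b) = 0"
      if a: "a \<in> {1..?m} \<times> {1..?m}" for a
    proof -
      have "dim_vec v = ?m\<^sup>2" using v by auto
      from Sigma_hat_mult_nth[OF this vec_idx_less[OF a], of n x y] show ?thesis
        using vec_idx_less[OF a] unfolding v(3) V_def vec_pos_idx[OF a] by simp
    qed
    have V0: "V a = 0" if a: "a \<in> {1..?m} \<times> {1..?m}" for a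
      using mutual_frac_bounds(1)[of n x] mutual a
      by (rule scov_definite) (simp only: mult.assoc 0 sum_distrib_left[symmetric] mult_zero_right sum.neutral_const cong: sum.cong)
    have "v = 0\<^sub>v (?m\<^sup>2)"
    proof (rule eq_vecI)
      fix r assume "r < dim_vec (0\<^sub>v (?m\<^sup>2) :: real Matrix.vec)"
      then show "Matrix.vec_index v r = Matrix.vec_index (0\<^sub>v (?m\<^sup>2)) r"
        using V0[OF vec_pos_in, of r] by (simp add: V_def vec_idx_pos)
    qed (use v in auto)
    with v show False by simp
  qed
qed

text \<open>The inverse is traded for a solution \<open>V\<close> of the linear system, the form
  that \<open>scov_lower\<close> and \<open>scov_upper\<close> work with. The estimate is invertible
  under these conditions, so the default value of \<open>I_stat\<close> does not occur.\<close>

lemma I_stat_cases: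
  obtains V where
    "\<And>a. a \<in> {1..K - 1} \<times> {1..K - 1} \<Longrightarrow>
      (\<Sum>b\<in>{1..K - 1} \<times> {1..K - 1}. scov (p_row K n x y) (mutual_frac n x) a b * V b) = sqrt n * dep_dev K n x y a"
    "I_stat K n x y = (\<Sum>a\<in>{1..K - 1} \<times> {1..K - 1}. V a * (sqrt n * dep_dev K n x y a))"
proof -
  let ?m = "K - 1"
  let ?S = "Sigma_hat K n x y" and ?P = "P_stat K n x y"
  obtain B where B: "mat_inverse ?S = Some B"
    using mat_inverse(1)[OF Sigma_hat_carrier] Sigma_hat_unit by fastforce
  note SB = mat_inverse(2)[OF Sigma_hat_carrier B]
  define v where "v = B *\<^sub>v ?P"
  have P: "?P \<in> carrier_vec (?m\<^sup>2)" by (simp add: P_stat_dim carrier_vecI)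
  have dv: "dim_vec v = ?m\<^sup>2" using SB by (auto simp: v_def)
  have Sv: "?S *\<^sub>v v = ?P"
    using SB P unfolding v_def by (subst assoc_mult_mat_vec[symmetric, OF Sigma_hat_carrier]) auto
  define V where "V b = Matrix.vec_index v (vec_idx ?m b)" for b
  show ?thesis
  proof (rule that[of V])
    fix a assume a: "a \<in> {1..?m} \<times> {1..?m}"
    show "(\<Sum>b\<in>{1..?m} \<times> {1..?m}. scov (p_row K n x y) (mutual_frac n x) a b * V b) = sqrt n * dep_dev K n x y a"
      using Sigma_hat_mult_nth[OF dv vec_idx_less[OF a], of n x y] P_stat_nth[OF vec_idx_less[OF a], of n x y]
      by (simp only: Sv V_def vec_pos_idx[OF a])
  next
    have "I_stat K n x y = (\<Sum>r = 0..<?m\<^sup>2. Matrix.vec_index ?P r * Matrix.vec_index v r)"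
      using dv by (simp add: I_stat_def B scalar_prod_def v_def)
    also have "\<dots> = (\<Sum>r = 0..<?m\<^sup>2. (\<lambda>a. V a * (sqrt n * dep_dev K n x y a)) (vec_pos ?m r))"
      by (intro sum.cong refl) (simp add: P_stat_nth V_def vec_idx_pos mult.commute)
    also have "\<dots> = (\<Sum>a\<in>{1..?m} \<times> {1..?m}. V a * (sqrt n * dep_dev K n x y a))"
      by (rule sum_vec_pos)
    finally show "I_stat K n x y = (\<Sum>a\<in>{1..?m} \<times> {1..?m}. V a * (sqrt n * dep_dev K n x y a))" .
  qed
qed

lemma I_stat_lower:
  assumes "k \<in> {1..K - 1}"
  shows "real n * (dep_dev K n x y (k, k))\<^sup>2 \<le> I_stat K n x y"
proof -
  obtain V where V: "\<And>a. a \<in> {1..K - 1} \<times> {1..K - 1} \<Longrightarrow>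
      (\<Sum>b\<in>{1..K - 1} \<times> {1..K - 1}. scov (p_row K n x y) (mutual_frac n x) a b * V b) = sqrt n * dep_dev K n x y a"
    "I_stat K n x y = (\<Sum>a\<in>{1..K - 1} \<times> {1..K - 1}. V a * (sqrt n * dep_dev K n x y a))"
    using I_stat_cases by blast
  have "(sqrt n * dep_dev K n x y (k, k))\<^sup>2 \<le> I_stat K n x y"
    unfolding V(2) by (rule scov_lower[OF mutual_frac_bounds assms V(1)])
  then show ?thesis by (simp add: power_mult_distrib)
qed

lemma sqrt_I_stat_upper:
  "sqrt (I_stat K n x y) \<le> sqrt n * (real ((K - 1)\<^sup>2) * (4 / \<pi> * (2 + 2 * real K)))"
proof -
  obtain V where V: "\<And>a. a \<in> {1..K - 1} \<times> {1..K - 1} \<Longrightarrow>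
      (\<Sum>b\<in>{1..K - 1} \<times> {1..K - 1}. scov (p_row K n x y) (mutual_frac n x) a b * V b) = sqrt n * dep_dev K n x y a"
    "I_stat K n x y = (\<Sum>a\<in>{1..K - 1} \<times> {1..K - 1}. V a * (sqrt n * dep_dev K n x y a))"
    using I_stat_cases by blast
  have sub: "a \<in> {1..K} \<times> {1..K}" if "a \<in> {1..K - 1} \<times> {1..K - 1}" for a
    using that by auto
  \<comment> \<open>\<open>scov_upper\<close> with \<open>\<beta> = sqrt n\<close> from
    \<open>dep_dev_le_1\<close> and \<open>\<gamma> = sqrt n * (1 + 2 * real K)\<close> from
    \<open>dep_dev_asym\<close>; the two add up to \<open>sqrt n * (2 + 2 * real K)\<close>.\<close>
  have "sqrt (I_stat K n x y) \<le> real ((K - 1)\<^sup>2) * (4 / \<pi> * (sqrt n + sqrt n * (1 + 2 * real K)))"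
    unfolding V(2)
  proof (rule scov_upper[OF mutual_frac_bounds V(1)])
    fix a assume a: "a \<in> {1..K - 1} \<times> {1..K - 1}"
    show "\<bar>sqrt n * dep_dev K n x y a\<bar> \<le> sqrt n"
      using mult_left_mono[OF dep_dev_le_1[OF sub[OF a], of n x y], of "sqrt n"] by (simp add: abs_mult)
    show "\<bar>sqrt n * dep_dev K n x y a - sqrt n * dep_dev K n x y (prod.swap a)\<bar>
        \<le> sqrt n * (1 + 2 * real K) * (1 - mutual_frac n x)"
      using mult_left_mono[OF dep_dev_asym[OF n sub[OF a], of x y], of "sqrt n"]
      by (simp add: abs_mult mult.assoc flip: right_diff_distrib)
  qed auto
  then show ?thesis by (simp add: algebra_simps)
qed

end

lemma vec_norm2_P_stat:
  "vec_norm2 (P_stat K n x y) = sqrt n * sqrt (\<Sum>a\<in>{1..K - 1} \<times> {1..K - 1}. (dep_dev K n x y a)\<^sup>2)"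
proof -
  have "scalar_prod (P_stat K n x y) (P_stat K n x y) =
      (\<Sum>r = 0..<(K - 1)\<^sup>2. (\<lambda>a. real n * (dep_dev K n x y a)\<^sup>2) (vec_pos (K - 1) r))"
    unfolding scalar_prod_def P_stat_dim
  proof (intro sum.cong refl)
    fix r assume "r \<in> {0..<(K - 1)\<^sup>2}"
    then show "Matrix.vec_index (P_stat K n x y) r * Matrix.vec_index (P_stat K n x y) r =
        real n * (dep_dev K n x y (vec_pos (K - 1) r))\<^sup>2"
      by (simp add: P_stat_nth power2_eq_square mult_ac)
  qed
  also have "\<dots> = real n * (\<Sum>a\<in>{1..K - 1} \<times> {1..K - 1}. (dep_dev K n x y a)\<^sup>2)"
    unfolding sum_distrib_left by (rule sum_vec_pos)
  finally show ?thesis by (simp add: vec_norm2_def real_sqrt_mult)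
qed

lemma vec_norm2_P_stat_lower:
  assumes "k \<in> {1..K - 1}"
  shows "sqrt n * \<bar>dep_dev K n x y (k, k)\<bar> \<le> vec_norm2 (P_stat K n x y)"
proof -
  have "(dep_dev K n x y (k, k))\<^sup>2 \<le> (\<Sum>a\<in>{1..K - 1} \<times> {1..K - 1}. (dep_dev K n x y a)\<^sup>2)"
    using assms by (intro member_le_sum[where f = "\<lambda>a. (dep_dev K n x y a)\<^sup>2"]) auto
  then have "\<bar>dep_dev K n x y (k, k)\<bar> \<le> sqrt (\<Sum>a\<in>{1..K - 1} \<times> {1..K - 1}. (dep_dev K n x y a)\<^sup>2)"
    by (intro real_le_rsqrt) simp
  then show ?thesis unfolding vec_norm2_P_stat by (intro mult_left_mono) auto
qed

lemma vec_norm2_P_stat_upper: "vec_norm2 (P_stat K n x y) \<le> sqrt n * real (K - 1)"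
proof -
  have "(\<Sum>a\<in>{1..K - 1} \<times> {1..K - 1}. (dep_dev K n x y a)\<^sup>2) \<le> (\<Sum>a\<in>{1..K - 1} \<times> {1..K - 1}. 1)"
  proof (rule sum_mono)
    fix a assume "a \<in> {1..K - 1} \<times> {1..K - 1}"
    then have "\<bar>dep_dev K n x y a\<bar> \<le> 1" by (intro dep_dev_le_1) auto
    then show "(dep_dev K n x y a)\<^sup>2 \<le> 1" by (simp add: abs_square_le_1)
  qed
  also have "\<dots> = (real (K - 1))\<^sup>2" by (simp add: power2_eq_square)
  finally have "sqrt (\<Sum>a\<in>{1..K - 1} \<times> {1..K - 1}. (dep_dev K n x y a)\<^sup>2) \<le> real (K - 1)"
    by (intro real_le_lsqrt) (auto intro: sum_nonneg)
  then show ?thesis unfolding vec_norm2_P_stat by (intro mult_left_mono) auto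
qed

section \<open>Second moments and measurability\<close>

text \<open>A dependency-graph bound: pairs outside \<open>R\<close> contribute nothing to the
  expanded square, and each remaining pair at most \<open>1\<close>.\<close>

lemma (in prob_space) second_moment_sum:
  fixes Z :: "'i \<Rightarrow> 'a \<Rightarrow> real"
  assumes I: "finite I" and meas[measurable]: "\<And>i. i \<in> I \<Longrightarrow> Z i \<in> borel_measurable M"
    and bd: "\<And>i w. i \<in> I \<Longrightarrow> w \<in> space M \<Longrightarrow> \<bar>Z i w\<bar> \<le> 1"
    and uncor: "\<And>i j. i \<in> I \<Longrightarrow> j \<in> I \<Longrightarrow> (i, j) \<notin> R \<Longrightarrow> expectation (\<lambda>w. Z i w * Z j w) = 0"
  shows "expectation (\<lambda>w. (\<Sum>i\<in>I. Z i w)\<^sup>2) \<le> real (card (R \<inter> I \<times> I))"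
proof -
  have bd2: "\<bar>Z i w * Z j w\<bar> \<le> 1" if "i \<in> I" "j \<in> I" "w \<in> space M" for i j w
    using mult_le_one[OF bd[OF that(1,3)] _ bd[OF that(2,3)]] by (simp add: abs_mult)
  have int: "integrable M (\<lambda>w. Z i w * Z j w)" if "i \<in> I" "j \<in> I" for i j
    using that bd2 by (intro integrable_const_bound[where B = 1]) auto
  have le: "expectation (\<lambda>w. Z i w * Z j w) \<le> of_bool ((i, j) \<in> R)" if "i \<in> I" "j \<in> I" for i j
  proof (cases "(i, j) \<in> R")
    case True
    have "expectation (\<lambda>w. Z i w * Z j w) \<le> expectation (\<lambda>w. 1)"
      by (rule integral_mono) (use int that bd2 in \<open>auto simp: abs_le_iff\<close>)
    with True show ?thesis by (simp add: prob_space)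
  qed (use uncor that in simp)
  have "expectation (\<lambda>w. (\<Sum>i\<in>I. Z i w)\<^sup>2) = expectation (\<lambda>w. \<Sum>i\<in>I. \<Sum>j\<in>I. Z i w * Z j w)"
    by (simp add: power2_eq_square sum_product)
  also have "\<dots> = (\<Sum>i\<in>I. \<Sum>j\<in>I. expectation (\<lambda>w. Z i w * Z j w))"
    using int by (subst Bochner_Integration.integral_sum; (intro sum.cong refl Bochner_Integration.integral_sum)?) auto
  also have "\<dots> \<le> (\<Sum>i\<in>I. \<Sum>j\<in>I. of_bool ((i, j) \<in> R))"
    by (intro sum_mono le)
  also have "\<dots> = real (card (R \<inter> I \<times> I))"
  proof -
    have "R \<inter> I \<times> I = (SIGMA i:I. I \<inter> {j. (i, j) \<in> R})" by auto
    then show ?thesis using I by simp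
  qed
  finally show ?thesis .
qed

text \<open>The neighbour map \<open>N\<close> is a fixed function here. The term of
  \<open>i\<close> involves only the levels at \<open>i\<close> and \<open>N i\<close>; it has mean
  zero because these are independent, and it is independent of the term of \<open>j\<close> when the
  two index pairs are disjoint.\<close>

lemma (in prob_space) second_moment_pairs:
  fixes T :: "nat \<Rightarrow> 'a \<Rightarrow> nat"
  assumes indep: "indep_vars (\<lambda>_. count_space UNIV) T I" and I: "finite I"
    and N: "\<And>i. i \<in> I \<Longrightarrow> N i \<in> I - {i}"
    and L: "\<And>i. i \<in> I \<Longrightarrow> card {j \<in> I. N j = i} \<le> L"
  shows "expectation (\<lambda>w. (\<Sum>i\<in>I. of_bool (T i w = k \<and> T (N i) w = l) -
      prob {w \<in> space M. T i w = k} * prob {w \<in> space M. T (N i) w = l})\<^sup>2) \<le> real (card I) * (2 + 2 * real L)"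
proof -
  define Z where "Z i w = (of_bool (T i w = k \<and> T (N i) w = l) -
      prob {w \<in> space M. T i w = k} * prob {w \<in> space M. T (N i) w = l} :: real)" for i w
  define R where "R = {(i, j). {i, N i} \<inter> {j, N j} \<noteq> {}}"
  have T[measurable]: "T i \<in> measurable M (count_space UNIV)" if "i \<in> I" for i
    using indep that by (auto simp: indep_vars_def)
  have TN[measurable]: "T (N i) \<in> measurable M (count_space UNIV)" if "i \<in> I" for i
    using N[OF that] by (intro T) auto
  have Z[measurable]: "Z i \<in> borel_measurable M" if "i \<in> I" for i
    unfolding Z_def using that by measurable
  have bd: "\<bar>Z i w\<bar> \<le> 1" for i w
  proof -
    have "0 \<le> prob {w \<in> space M. T i w = k} * prob {w \<in> space M. T (N i) w = l}"
      "prob {w \<in> space M. T i w = k} * prob {w \<in> space M. T (N i) w = l} \<le> 1"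
      by (auto intro!: mult_le_one)
    then show ?thesis by (auto simp: Z_def)
  qed
  have intZ: "integrable M (Z i)" if "i \<in> I" for i
    using that bd by (intro integrable_const_bound[where B = 1]) auto
  have EZ: "expectation (Z i) = 0" if i: "i \<in> I" for i
  proof -
    have "{w \<in> space M. T i w = k \<and> T (N i) w = l} =
        (\<Inter>j\<in>{i, N i}. T j -` (if j = i then {k} else {l}) \<inter> space M)"
      using N[OF i] by auto
    then have "prob {w \<in> space M. T i w = k \<and> T (N i) w = l} =
        (\<Prod>j\<in>{i, N i}. prob (T j -` (if j = i then {k} else {l}) \<inter> space M))"
      using indep_varsD[OF indep, of "{i, N i}" "\<lambda>j. if j = i then {k} else {l}"] N[OF i] i by auto
    also have "\<dots> = prob {w \<in> space M. T i w = k} * prob {w \<in> space M. T (N i) w = l}"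
      using N[OF i] by (auto simp: vimage_def Int_def conj_commute)
    finally have *: "prob {w \<in> space M. T i w = k \<and> T (N i) w = l} = \<dots>" .
    have "expectation (\<lambda>w. of_bool (T i w = k \<and> T (N i) w = l)) =
        expectation (indicator {w \<in> space M. T i w = k \<and> T (N i) w = l})"
      by (intro Bochner_Integration.integral_cong) (auto simp: indicator_def)
    also have "\<dots> = prob {w \<in> space M. T i w = k \<and> T (N i) w = l}"
      using i by (subst Bochner_Integration.integral_indicator) (auto simp: Int_def intro!: arg_cong[where f = prob])
    finally show ?thesis
      unfolding Z_def using i
      by (subst Bochner_Integration.integral_diff)
        (auto simp: * prob_space intro!: integrable_const_bound[where B = 1])
  qed
  have "expectation (\<lambda>w. (\<Sum>i\<in>I. Z i w)\<^sup>2) \<le> real (card (R \<inter> I \<times> I))"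
  proof (rule second_moment_sum[OF I Z bd])
    fix i j assume ij: "i \<in> I" "j \<in> I" "(i, j) \<notin> R"
    have "indep_var borel (Z i) borel (Z j)"
    proof -
      define F where "F i = (\<lambda>f :: nat \<Rightarrow> nat. of_bool (f i = k \<and> f (N i) = l) -
        prob {w \<in> space M. T i w = k} * prob {w \<in> space M. T (N i) w = l} :: real)" for i
      have F: "F i \<in> borel_measurable (PiM {i, N i} (\<lambda>_. count_space UNIV))" for i
        unfolding F_def by measurable
      have "indep_var (PiM {i, N i} (\<lambda>_. count_space UNIV)) (\<lambda>w. restrict (\<lambda>i. T i w) {i, N i})
          (PiM {j, N j} (\<lambda>_. count_space UNIV)) (\<lambda>w. restrict (\<lambda>i. T i w) {j, N j})"
        using ij N by (intro indep_var_restrict[OF indep]) (auto simp: R_def)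
      from indep_var_compose[OF this F F]
      show ?thesis by (simp add: F_def Z_def[abs_def] o_def)
    qed
    then have "expectation (\<lambda>w. Z i w * Z j w) = expectation (Z i) * expectation (Z j)"
      using intZ ij by (intro indep_var_lebesgue_integral)
    then show "expectation (\<lambda>w. Z i w * Z j w) = 0"
      using EZ ij by simp
  qed
  also have "card (R \<inter> I \<times> I) = (\<Sum>i\<in>I. card {j \<in> I. (i, j) \<in> R})"
  proof -
    have "R \<inter> I \<times> I = (SIGMA i:I. {j \<in> I. (i, j) \<in> R})" by auto
    then show ?thesis using I by simp
  qed
  also have "\<dots> \<le> (\<Sum>i\<in>I. 2 + 2 * L)"
  proof (rule sum_mono)
    fix i assume i: "i \<in> I"
    \<comment> \<open>Overlap means that \<open>j\<close> is \<open>i\<close> or \<open>N i\<close>,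
      or that its neighbour is \<open>i\<close> or \<open>N i\<close>: two single indices and two
      in-degrees, hence \<open>2 + 2 * L\<close>.\<close>
    have "{j \<in> I. (i, j) \<in> R} \<subseteq> {i} \<union> {N i} \<union> {j \<in> I. N j = i} \<union> {j \<in> I. N j = N i}"
      by (auto simp: R_def)
    then have "card {j \<in> I. (i, j) \<in> R} \<le> card ({i} \<union> {N i} \<union> {j \<in> I. N j = i} \<union> {j \<in> I. N j = N i})"
      using I by (intro card_mono) auto
    also have "\<dots> \<le> card {i} + card {N i} + card {j \<in> I. N j = i} + card {j \<in> I. N j = N i}"
      by (meson card_Un_le add_mono order_trans order_refl)
    also have "\<dots> \<le> 2 + 2 * L"
      using L[OF i] L[of "N i"] N[OF i] by simp
    finally show "card {j \<in> I. (i, j) \<in> R} \<le> 2 + 2 * L" .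
  qed
  finally show ?thesis
    unfolding Z_def by (simp add: distrib_left)
qed

lemma (in prob_space) distr_pair_indep_rv:
  assumes "indep_rv M S A T B"
  shows "distr M (S \<Otimes>\<^sub>M T) (\<lambda>w. (A w, B w)) = distr M S A \<Otimes>\<^sub>M distr M T B"
proof -
  have A[measurable]: "A \<in> measurable M S" and B[measurable]: "B \<in> measurable M T"
    and ind: "indep_set {A -` a \<inter> space M | a. a \<in> sets S} {B -` b \<inter> space M | b. b \<in> sets T}"
    using assms by (auto simp: indep_rv_def)
  interpret D1: prob_space "distr M S A" by (rule prob_space_distr) simp
  interpret D2: prob_space "distr M T B" by (rule prob_space_distr) simp
  show ?thesis
  proof (rule pair_measure_eqI[symmetric])
    fix a b assume "a \<in> sets (distr M S A)" "b \<in> sets (distr M T B)"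
    then have [measurable]: "a \<in> sets S" "b \<in> sets T" by auto
    have "emeasure (distr M (S \<Otimes>\<^sub>M T) (\<lambda>w. (A w, B w))) (a \<times> b) =
        emeasure M ((A -` a \<inter> space M) \<inter> (B -` b \<inter> space M))"
      by (subst emeasure_distr) (auto intro!: arg_cong[where f = "emeasure M"])
    also have "\<dots> = ennreal (prob (A -` a \<inter> space M) * prob (B -` b \<inter> space M))"
      unfolding emeasure_eq_measure
      by (subst indep_setD[OF ind]) (use \<open>a \<in> sets S\<close> \<open>b \<in> sets T\<close> in blast)+
    also have "\<dots> = emeasure (distr M S A) a * emeasure (distr M T B) b"
      by (simp add: emeasure_distr emeasure_eq_measure ennreal_mult)
    finally show "emeasure (distr M S A) a * emeasure (distr M T B) b =
        emeasure (distr M (S \<Otimes>\<^sub>M T) (\<lambda>w. (A w, B w))) (a \<times> b)" ..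
  qed (auto intro: D1.sigma_finite_measure_axioms D2.sigma_finite_measure_axioms)
qed

text \<open>The substitute for conditioning on \<open>A\<close>: \<open>w\<close> fixes the value of
  \<open>A\<close>, and \<open>w'\<close> is a second, independent argument over which
  \<open>B\<close> is averaged.\<close>

lemma (in prob_space) nn_integral_indep_rv:
  assumes ind: "indep_rv M S A T B" and h[measurable]: "h \<in> borel_measurable (S \<Otimes>\<^sub>M T)"
  shows "(\<integral>\<^sup>+w. h (A w, B w) \<partial>M) = (\<integral>\<^sup>+w. \<integral>\<^sup>+w'. h (A w, B w') \<partial>M \<partial>M)"
proof -
  have [measurable]: "A \<in> measurable M S" "B \<in> measurable M T"
    using ind by (auto simp: indep_rv_def)
  interpret D2: prob_space "distr M T B" by (rule prob_space_distr) simp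
  have "(\<integral>\<^sup>+w. h (A w, B w) \<partial>M) = (\<integral>\<^sup>+z. h z \<partial>distr M (S \<Otimes>\<^sub>M T) (\<lambda>w. (A w, B w)))"
    by (subst nn_integral_distr) auto
  also have "\<dots> = (\<integral>\<^sup>+x. \<integral>\<^sup>+y. h (x, y) \<partial>distr M T B \<partial>distr M S A)"
    unfolding distr_pair_indep_rv[OF ind]
    by (subst D2.nn_integral_fst) auto
  also have "\<dots> = (\<integral>\<^sup>+w. \<integral>\<^sup>+y. h (A w, y) \<partial>distr M T B \<partial>M)"
    by (subst nn_integral_distr) (auto intro!: D2.borel_measurable_nn_integral)
  also have "\<dots> = (\<integral>\<^sup>+w. \<integral>\<^sup>+w'. h (A w, B w') \<partial>M \<partial>M)"
    by (intro nn_integral_cong, subst nn_integral_distr) (auto dest: measurable_space)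
  finally show ?thesis .
qed

section \<open>Measurability of neighbours and statistics\<close>

lemma measurable_nn_in:
  fixes X :: "nat \<Rightarrow> 's \<Rightarrow> 'h::{metric_space, second_countable_topology}"
  assumes [measurable]: "\<And>j. j \<in> {1..n} \<Longrightarrow> X j \<in> borel_measurable S" and i: "i \<in> {1..n}"
  shows "(\<lambda>s. nn_in {1..n} (\<lambda>j. X j s) i) \<in> measurable S (count_space UNIV)"
  unfolding nn_in_def
proof (rule measurable_Least)
  fix j
  show "Measurable.pred S (\<lambda>s. j \<in> {1..n} - {i} \<and> (\<forall>k\<in>{1..n} - {i}. dist (X i s) (X j s) \<le> dist (X i s) (X k s)))"
  proof (cases "j \<in> {1..n} - {i}")
    case True
    then have [measurable]: "X j \<in> borel_measurable S" by auto
    have "Measurable.pred S (\<lambda>s. \<forall>k\<in>{1..n} - {i}. dist (X i s) (X j s) \<le> dist (X i s) (X k s))"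
      using i by measurable
    with True show ?thesis by simp
  qed simp
qed

lemma measurable_p_joint:
  fixes X :: "nat \<Rightarrow> 's \<Rightarrow> 'h::{metric_space, second_countable_topology}"
  assumes X: "\<And>j. j \<in> {1..n} \<Longrightarrow> X j \<in> borel_measurable S"
    and Y[measurable]: "\<And>j. j \<in> {1..n} \<Longrightarrow> Y j \<in> measurable S (count_space UNIV)" and n: "2 \<le> n"
  shows "(\<lambda>s. p_joint n (\<lambda>j. X j s) (\<lambda>j. Y j s) k l) \<in> borel_measurable S"
proof -
  note N = measurable_nn_in[OF X]
  \<comment> \<open>The level at a random index is resolved into a finite case distinction over the
    value of that index.\<close>
  have eq: "(Y i s = k \<and> Y (nn_in {1..n} (\<lambda>j. X j s) i) s = l) \<longleftrightarrow>
    (\<exists>j\<in>{1..n}. nn_in {1..n} (\<lambda>j. X j s) i = j \<and> Y i s = k \<and> Y j s = l)" if "i \<in> {1..n}" for i s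
    using nn_in_range[OF n that, of "\<lambda>j. X j s"] by auto
  have [measurable]: "Measurable.pred S (\<lambda>s. Y i s = k \<and> Y (nn_in {1..n} (\<lambda>j. X j s) i) s = l)" if "i \<in> {1..n}" for i
    unfolding eq[OF that] using N[OF _ that] that by measurable
  show ?thesis
    unfolding p_joint_def nn_eq by measurable
qed

lemma p_joint_cong:
  assumes n: "2 \<le> n" and "\<And>i. i \<in> {1..n} \<Longrightarrow> nn n x i = nn n x' i" "\<And>i. i \<in> {1..n} \<Longrightarrow> y i = y' i"
  shows "p_joint n x y = p_joint n x' y'"
proof (intro ext)
  fix k l
  have "of_bool (y i = k \<and> y (nn n x i) = l) = (of_bool (y' i = k \<and> y' (nn n x' i) = l) :: real)"
    if i: "i \<in> {1..n}" for i
    using nn_in_range[OF n i, of x] assms(2)[OF i] assms(3)[OF i] assms(3)[of "nn n x i"] by (simp add: nn_eq)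
  then show "p_joint n x y k l = p_joint n x' y' k l"
    unfolding p_joint_def by (intro arg_cong[where f = "\<lambda>t. 1 / real n * t"] sum.cong refl)
qed

lemma stats_cong:
  assumes n: "2 \<le> n" and N: "\<And>i. i \<in> {1..n} \<Longrightarrow> nn n x i = nn n x' i" and "\<And>i. i \<in> {1..n} \<Longrightarrow> y i = y' i"
  shows "I_stat K n x y = I_stat K n x' y'" "P_stat K n x y = P_stat K n x' y'"
proof -
  have pj: "p_joint n x y k l = p_joint n x' y' k l" for k l
    using p_joint_cong[OF assms] by (simp only:)
  have *: "p_row K n x y = p_row K n x' y'" "q_col K n x y = q_col K n x' y'"
    by (auto simp: fun_eq_iff p_row_def q_col_def pj)
  have "of_bool (nn n x (nn n x i) = i) = (of_bool (nn n x' (nn n x' i) = i) :: real)" if i: "i \<in> {1..n}" for i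
    using nn_in_range[OF n i, of x] N[OF i] N[of "nn n x i"] by (simp add: nn_eq)
  then have "mutual_frac n x = mutual_frac n x'"
    unfolding mutual_frac_def by (intro arg_cong[where f = "\<lambda>t. 1 / real n * t"] sum.cong refl)
  with * have "Sigma_hat K n x y = Sigma_hat K n x' y'"
    by (simp add: Sigma_hat_def Sigma_entry_def Let_def)
  moreover show "P_stat K n x y = P_stat K n x' y'"
    by (simp add: P_stat_def * pj Let_def)
  ultimately show "I_stat K n x y = I_stat K n x' y'"
    by (simp only: I_stat_def)
qed

lemma measurable_map_count_space:
  fixes g :: "'i \<Rightarrow> 's \<Rightarrow> 'b::countable"
  assumes "\<And>i. i \<in> set L \<Longrightarrow> g i \<in> measurable S (count_space UNIV)"
  shows "(\<lambda>s. map (\<lambda>i. g i s) L) \<in> measurable S (count_space UNIV)"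
proof -
  have [measurable]: "\<And>i. i < length L \<Longrightarrow> g (L ! i) \<in> measurable S (count_space UNIV)"
    using assms by simp
  have "(\<lambda>s. map (\<lambda>i. g i s) L) -` {xs} \<inter> space S \<in> sets S" for xs
  proof -
    have "(\<lambda>s. map (\<lambda>i. g i s) L) -` {xs} \<inter> space S =
        {s \<in> space S. length L = length xs \<and> (\<forall>i\<in>{..<length L}. g (L ! i) s = xs ! i)}"
      by (auto simp: list_eq_iff_nth_eq)
    also have "\<dots> \<in> sets S" by measurable
    finally show ?thesis .
  qed
  then show ?thesis by (subst measurable_count_space_eq_countable) auto
qed

text \<open>The statistics are functions of countably valued data.\<close>

lemma sets_stat_event:
  fixes X :: "nat \<Rightarrow> 's \<Rightarrow> 'h::{metric_space, second_countable_topology}"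
  assumes X: "\<And>j. j \<in> {1..n} \<Longrightarrow> X j \<in> borel_measurable S"
    and Y: "\<And>j. j \<in> {1..n} \<Longrightarrow> Y j \<in> measurable S (count_space UNIV)" and n: "2 \<le> n"
  shows "{s \<in> space S. \<Phi> (I_stat K n (\<lambda>j. X j s) (\<lambda>j. Y j s)) (P_stat K n (\<lambda>j. X j s) (\<lambda>j. Y j s))} \<in> sets S"
proof -
  let ?E = "{s \<in> space S. \<Phi> (I_stat K n (\<lambda>j. X j s) (\<lambda>j. Y j s)) (P_stat K n (\<lambda>j. X j s) (\<lambda>j. Y j s))}"
  define D where "D s = (map (\<lambda>i. nn n (\<lambda>j. X j s) i) [1..<Suc n], map (\<lambda>i. Y i s) [1..<Suc n])" for s
  have "D \<in> measurable S (count_space UNIV \<Otimes>\<^sub>M count_space UNIV)"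
    unfolding D_def nn_eq using X Y
    by (intro measurable_Pair measurable_map_count_space measurable_nn_in) auto
  then have D: "D \<in> measurable S (count_space UNIV)"
    by (simp add: pair_measure_countable)
  \<comment> \<open>Membership in \<open>?E\<close> depends on \<open>D s\<close> alone, and every
    set of values of \<open>D\<close> is measurable. This covers an arbitrary \<open>\<Phi>\<close>,
    in particular events that involve the matrix inverse.\<close>
  have "?E = D -` (D ` ?E) \<inter> space S"
  proof (intro equalityI subsetI)
    fix s assume s: "s \<in> D -` (D ` ?E) \<inter> space S"
    then obtain s' where s': "s' \<in> ?E" "D s = D s'" by auto
    then have "\<And>i. i \<in> {1..n} \<Longrightarrow> nn n (\<lambda>j. X j s) i = nn n (\<lambda>j. X j s') i" "\<And>i. i \<in> {1..n} \<Longrightarrow> Y i s = Y i s'"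
      by (auto simp: D_def less_Suc_eq_le simp del: upt_Suc)
    from stats_cong[OF n this] s s'(1) show "s \<in> ?E" by simp
  qed auto
  also have "\<dots> \<in> sets S" using D by (rule measurable_sets) simp
  finally show ?thesis .
qed

section \<open>The sampling model\<close>

lemma pred_all_mutual:
  fixes X :: "nat \<Rightarrow> 's \<Rightarrow> 'h::{metric_space, second_countable_topology}"
  assumes X: "\<And>j. j \<in> {1..n} \<Longrightarrow> X j \<in> borel_measurable S" and n: "2 \<le> n"
  shows "Measurable.pred S (\<lambda>s. all_mutual {1..n} (\<lambda>j. X j s))"
proof -
  note N = measurable_nn_in[OF X]
  have eq: "all_mutual {1..n} (\<lambda>j. X j s) \<longleftrightarrow>
    (\<forall>a\<in>{1..n}. \<exists>b\<in>{1..n}. nn_in {1..n} (\<lambda>j. X j s) a = b \<and> nn_in {1..n} (\<lambda>j. X j s) b = a)" for s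
    using nn_in_range[OF n, of _ "\<lambda>j. X j s"] unfolding all_mutual_def by (metis Diff_iff)
  show ?thesis unfolding eq using N by measurable
qed

lemma all_mutual_cong:
  assumes n: "2 \<le> n" and x: "\<And>j. j \<in> {1..n} \<Longrightarrow> x j = y j"
  shows "all_mutual {1..n} x \<longleftrightarrow> all_mutual {1..n} y"
proof -
  have "nn_in {1..n} x a = nn_in {1..n} y a" if "a \<in> {1..n}" for a
    using x that by (rule nn_in_cong)
  moreover have "nn_in {1..n} y a \<in> {1..n}" if "a \<in> {1..n}" for a
    using nn_in_range[OF n that, of y] by auto
  ultimately show ?thesis unfolding all_mutual_def by simp
qed

lemma borel_measurable_nn_point:
  fixes X :: "nat \<Rightarrow> 's \<Rightarrow> 'h::{metric_space, second_countable_topology}"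
  assumes X: "\<And>j. j \<in> {1..n} \<Longrightarrow> X j \<in> borel_measurable S" and n: "2 \<le> n" and i: "i \<in> {1..n}"
  shows "(\<lambda>s. X (nn_in {1..n} (\<lambda>j. X j s) i) s) \<in> borel_measurable S"
proof (rule measurable_compose_countable'[OF X])
  have "nn_in {1..n} (\<lambda>j. X j s) i \<in> {1..n}" for s
    using nn_in_range[OF n i, of "\<lambda>j. X j s"] by auto
  then show "(\<lambda>s. nn_in {1..n} (\<lambda>j. X j s) i) \<in> measurable S (count_space {1..n})"
    using measurable_nn_in[OF X i] by (subst measurable_count_space_eq2_countable) (auto dest: measurable_sets)
qed auto

text \<open>Positivity of the level probabilities, the two alternatives on neighbours, the degree
  condition and dependence are kept out of the model; they appear as hypotheses of the lemmas that
  use them.\<close>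

locale nn_sample = prob_space M for M :: "'w measure" +
  fixes X :: "'w \<Rightarrow> 'h::{metric_space, second_countable_topology}"
    and Y :: "'w \<Rightarrow> nat" and K :: nat and Q :: "nat \<Rightarrow> 'h \<Rightarrow> real"
    and Xs :: "nat \<Rightarrow> 'w \<Rightarrow> 'h" and Us :: "nat \<Rightarrow> 'w \<Rightarrow> real"
  assumes X_meas[measurable]: "X \<in> borel_measurable M"
    and K2: "2 \<le> K"
    and Y_meas: "Y \<in> measurable M (count_space {1..K})"
    and Q_meas[measurable]: "\<And>k. k \<in> {1..K} \<Longrightarrow> Q k \<in> borel_measurable borel"
    and Q_cond: "\<And>k. k \<in> {1..K} \<Longrightarrow> AE w in M. Q k (X w) =
      real_cond_exp M (vimage_algebra (space M) X borel) (indicator {w \<in> space M. Y w = k}) w"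
    and Xs_indep: "indep_vars (\<lambda>_. borel) Xs {1..}"
    and Xs_distr: "\<And>i. i \<ge> 1 \<Longrightarrow> distr M borel (Xs i) = distr M borel X"
    and Us_indep: "indep_vars (\<lambda>_. borel) Us {1..}"
    and Us_distr: "\<And>i. i \<ge> 1 \<Longrightarrow> distr M lborel (Us i) = uniform_measure lborel {0<..<1}"
    and XU_indep: "indep_rv M (PiM {1..} (\<lambda>_. borel)) (\<lambda>w. \<lambda>i\<in>{1..}. Xs i w)
        (PiM {1..} (\<lambda>_. borel)) (\<lambda>w. \<lambda>i\<in>{1..}. Us i w)"
begin

abbreviation "F \<equiv> vimage_algebra (space M) X borel"

lemma Y_event[measurable]: "{w \<in> space M. Y w = k} \<in> events"
proof -
  have "{w \<in> space M. Y w = k} = Y -` ({k} \<inter> {1..K}) \<inter> space M"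
    using measurable_space[OF Y_meas] by auto
  also have "\<dots> \<in> events" by (rule measurable_sets[OF Y_meas]) auto
  finally show ?thesis .
qed

lemma Y_range: "w \<in> space M \<Longrightarrow> Y w \<in> {1..K}"
  using measurable_space[OF Y_meas] by auto

lemma integrable_bounded_1:
  "f \<in> borel_measurable M \<Longrightarrow> (\<And>w. \<bar>f w\<bar> \<le> 1) \<Longrightarrow> integrable M (f :: 'w \<Rightarrow> real)"
  by (intro integrable_const_bound[where B = 1]) auto

lemma integrable_event: "A \<in> events \<Longrightarrow> integrable M (indicator A :: 'w \<Rightarrow> real)"
  by (rule integrable_bounded_1) (auto simp: indicator_def)

lemma integrable_Y[simp]: "integrable M (indicator {w \<in> space M. Y w = k} :: 'w \<Rightarrow> real)"
  by (intro integrable_event Y_event)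

lemma F_subalg: "subalgebra M F"
  by (auto simp: subalgebra_def sets_vimage_algebra2)

sublocale F: sigma_finite_subalgebra M F
  by (rule finite_measure_subalgebra_is_sigma_finite)
    (simp add: finite_measure_subalgebra_def finite_measure_subalgebra_axioms_def F_subalg finite_measure_axioms)

lemma integral_Q_indicator:
  assumes k: "k \<in> {1..K}" and [measurable]: "A \<in> sets borel"
  shows "(\<integral>w. indicator A (X w) * Q k (X w) \<partial>M) = prob {w \<in> space M. X w \<in> A \<and> Y w = k}"
proof -
  let ?Y = "indicator {w \<in> space M. Y w = k} :: 'w \<Rightarrow> real"
  have "X -` A \<inter> space M \<in> sets F"
    by (auto simp: sets_vimage_algebra2)
  from F.real_cond_exp_intA[OF _ this, of ?Y]
  have "(\<integral>w. indicator (X -` A \<inter> space M) w * ?Y w \<partial>M) =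
      (\<integral>w. indicator (X -` A \<inter> space M) w * real_cond_exp M F ?Y w \<partial>M)"
    by (simp add: set_lebesgue_integral_def)
  also have "\<dots> = (\<integral>w. indicator A (X w) * Q k (X w) \<partial>M)"
    using Q_cond[OF k] k by (intro integral_cong_AE) (auto simp: indicator_def elim!: eventually_mono)
  also have "(\<integral>w. indicator (X -` A \<inter> space M) w * ?Y w \<partial>M) =
      (\<integral>w. indicator {w \<in> space M. X w \<in> A \<and> Y w = k} w \<partial>M)"
    by (intro Bochner_Integration.integral_cong) (auto simp: indicator_def)
  also have "\<dots> = prob {w \<in> space M. X w \<in> A \<and> Y w = k}"
    by (subst Bochner_Integration.integral_indicator) (auto simp: Int_def intro!: arg_cong[where f = prob])
  finally show ?thesis ..
qed

text \<open>\<open>Q\<close> is pinned down only up to null sets. \<open>G\<close> collects the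
  points at which it really is a probability vector; by \<open>AE_X_G\<close> it has full
  measure.\<close>

definition G :: "'h set" where
  "G = {x. (\<forall>k\<in>{1..K}. 0 \<le> Q k x) \<and> (\<Sum>k=1..K. Q k x) = 1}"

lemma G_meas[measurable]: "G \<in> sets borel"
  unfolding G_def by measurable

text \<open>Conditional expectation is positive and additive up to null sets, and the level
  indicators add up to \<open>1\<close>.\<close>

lemma AE_X_G: "AE w in M. X w \<in> G"
proof -
  let ?Y = "\<lambda>k. indicator {w \<in> space M. Y w = k} :: 'w \<Rightarrow> real"
  have pos: "AE w in M. \<forall>k\<in>{1..K}. 0 \<le> Q k (X w)"
  proof (intro AE_finite_allI)
    fix k assume k: "k \<in> {1..K}"
    have "AE w in M. 0 \<le> real_cond_exp M F (?Y k) w"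
      by (rule F.real_cond_exp_pos) auto
    with Q_cond[OF k] show "AE w in M. 0 \<le> Q k (X w)" by eventually_elim simp
  qed simp
  have "AE w in M. \<forall>k\<in>{1..K}. Q k (X w) = real_cond_exp M F (?Y k) w"
    using Q_cond by (intro AE_finite_allI) auto
  moreover have "AE w in M. real_cond_exp M F (\<lambda>w. \<Sum>k=1..K. ?Y k w) w = (\<Sum>k=1..K. real_cond_exp M F (?Y k) w)"
    by (rule F.real_cond_exp_sum) auto
  moreover have "AE w in M. real_cond_exp M F (\<lambda>w. \<Sum>k=1..K. ?Y k w) w = real_cond_exp M F (\<lambda>w. 1) w"
  proof (rule F.real_cond_exp_cong)
    have "(\<Sum>k=1..K. ?Y k w) = 1" if "w \<in> space M" for w
    proof -
      have "(\<Sum>k=1..K. ?Y k w) = (\<Sum>k=1..K. if k = Y w then 1 else 0)"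
        using that by (intro sum.cong) (auto simp: indicator_def)
      then show ?thesis using Y_range[OF that] by simp
    qed
    then show "AE w in M. (\<Sum>k=1..K. ?Y k w) = 1" by (intro AE_I2)
  qed auto
  moreover have "AE w in M. real_cond_exp M F (\<lambda>w. 1) w = 1"
    by (rule F.real_cond_exp_F_meas) auto
  ultimately have "AE w in M. (\<Sum>k=1..K. Q k (X w)) = 1"
    by eventually_elim simp
  with pos show ?thesis by eventually_elim (simp add: G_def)
qed

text \<open>Set to zero off \<open>G\<close>, so that the bounds \<open>0\<close> and
  \<open>1\<close> hold at every point and not only almost everywhere.\<close>

definition q :: "nat \<Rightarrow> 'h \<Rightarrow> real" where
  "q k x = (if x \<in> G then Q k x else 0)"

lemma q_meas[measurable]: "k \<in> {1..K} \<Longrightarrow> q k \<in> borel_measurable borel"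
  unfolding q_def[abs_def] by measurable

lemma q_bounds: "k \<in> {1..K} \<Longrightarrow> 0 \<le> q k x" "k \<in> {1..K} \<Longrightarrow> q k x \<le> 1"
proof -
  assume k: "k \<in> {1..K}"
  show "0 \<le> q k x" using k by (auto simp: q_def G_def)
  show "q k x \<le> 1"
  proof (cases "x \<in> G")
    case True
    then have "Q k x \<le> (\<Sum>k=1..K. Q k x)" using k by (intro member_le_sum) (auto simp: G_def)
    with True show ?thesis by (simp add: q_def G_def)
  qed (simp add: q_def)
qed

definition c :: "nat \<Rightarrow> nat \<Rightarrow> real" where
  "c k l = (\<integral>w. q k (X w) * q l (X w) \<partial>M)"

definition pr :: "nat \<Rightarrow> real" where
  "pr k = prob {w \<in> space M. Y w = k}"

lemma sum_q: "x \<in> G \<Longrightarrow> (\<Sum>k=1..K. q k x) = 1"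
  unfolding q_def by simp (simp add: G_def)

lemma integrable_q: "k \<in> {1..K} \<Longrightarrow> integrable M (\<lambda>w. q k (X w))"
  using q_bounds[of k] by (intro integrable_bounded_1) (auto simp: abs_le_iff intro: order_trans[of "- 1 :: real" 0])

lemma qq_bound: "k \<in> {1..K} \<Longrightarrow> l \<in> {1..K} \<Longrightarrow> 0 \<le> q k x * q l y \<and> q k x * q l y \<le> 1"
  using q_bounds[of k x] q_bounds[of l y] by (auto intro: mult_le_one)

lemma integrable_qq: "k \<in> {1..K} \<Longrightarrow> l \<in> {1..K} \<Longrightarrow> integrable M (\<lambda>w. q k (X w) * q l (X w))"
  using qq_bound[of k l] by (intro integrable_bounded_1) (auto simp: abs_le_iff intro: order_trans[of "- 1 :: real" 0])

lemma integral_q_indicator: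
  assumes k: "k \<in> {1..K}" and [measurable]: "A \<in> sets borel"
  shows "(\<integral>w. indicator A (X w) * q k (X w) \<partial>M) = prob {w \<in> space M. X w \<in> A \<and> Y w = k}"
  unfolding integral_Q_indicator[OF assms, symmetric]
  using AE_X_G k by (intro integral_cong_AE) (auto simp: q_def elim!: eventually_mono)

lemma integral_q: "k \<in> {1..K} \<Longrightarrow> (\<integral>w. q k (X w) \<partial>M) = pr k"
  using integral_q_indicator[of k UNIV] by (simp add: pr_def)

lemma sum_c: "k \<in> {1..K} \<Longrightarrow> (\<Sum>l=1..K. c k l) = pr k"
proof -
  assume k: "k \<in> {1..K}"
  have "(\<Sum>l=1..K. c k l) = (\<integral>w. (\<Sum>l=1..K. q k (X w) * q l (X w)) \<partial>M)"
    unfolding c_def using k by (intro Bochner_Integration.integral_sum[symmetric] integrable_qq)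
  also have "\<dots> = (\<integral>w. q k (X w) \<partial>M)"
    using AE_X_G k
    by (intro integral_cong_AE) (auto simp: q_def G_def simp flip: sum_distrib_left elim!: eventually_mono)
  finally show ?thesis using k by (simp add: integral_q)
qed

lemma c_sym: "c k l = c l k"
  by (simp add: c_def mult.commute)

lemma pr_bounds: "0 \<le> pr k" "pr k \<le> 1"
  by (simp_all add: pr_def)

lemma variance_q:
  assumes k: "k \<in> {1..K}"
  shows "c k k - (pr k)\<^sup>2 = (\<integral>w. (q k (X w) - pr k)\<^sup>2 \<partial>M)"
proof -
  have "(\<integral>w. (q k (X w) - pr k)\<^sup>2 \<partial>M) = (\<integral>w. q k (X w) * q k (X w) - 2 * pr k * q k (X w) + (pr k)\<^sup>2 \<partial>M)"
    by (intro Bochner_Integration.integral_cong) (auto simp: power2_eq_square algebra_simps)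
  also have "\<dots> = c k k - 2 * pr k * pr k + (pr k)\<^sup>2"
    using integrable_q[OF k] integrable_qq[OF k k] integral_q[OF k]
    by (simp add: c_def prob_space)
  finally show ?thesis by (simp add: power2_eq_square)
qed

lemma integrable_var: "k \<in> {1..K} \<Longrightarrow> integrable M (\<lambda>w. (q k (X w) - pr k)\<^sup>2)"
proof -
  assume k: "k \<in> {1..K}"
  have "\<bar>q k (X w) - pr k\<bar> \<le> 1" for w
    using q_bounds[OF k, of "X w"] pr_bounds[of k] by (auto simp: abs_le_iff)
  then have "\<bar>(q k (X w) - pr k)\<^sup>2\<bar> \<le> 1" for w by (simp add: abs_square_le_1)
  then show ?thesis using k by (intro integrable_bounded_1) auto
qed

text \<open>If the variances of \<open>q k (X w)\<close> vanish for all \<open>k < K\<close>, these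
  variables are almost surely constant, and so is the one for \<open>K\<close> because they sum to
  \<open>1\<close>. Integrating the constants over \<open>X w \<in> A\<close> factorises the joint
  probabilities. The witness must avoid level \<open>K\<close>, which has no row in the
  matrix.\<close>

lemma dependent_variance:
  assumes dep: "\<not> indep_rv M borel X (count_space {1..K}) Y"
  obtains k where "k \<in> {1..K - 1}" "c k k - (pr k)\<^sup>2 > 0"
proof (rule ccontr)
  assume "\<not> thesis"
  with that have no: "\<And>k. k \<in> {1..K - 1} \<Longrightarrow> c k k - (pr k)\<^sup>2 \<le> 0" by force
  have const: "AE w in M. \<forall>k\<in>{1..K - 1}. q k (X w) = pr k"
  proof (intro AE_finite_allI)
    fix k assume k: "k \<in> {1..K - 1}"
    then have k': "k \<in> {1..K}" by auto
    have "(\<integral>w. (q k (X w) - pr k)\<^sup>2 \<partial>M) = 0"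
      using no[OF k] variance_q[OF k'] by (intro antisym Bochner_Integration.integral_nonneg) auto
    then have "AE w in M. (q k (X w) - pr k)\<^sup>2 = 0"
      using integrable_var[OF k'] by (subst (asm) integral_nonneg_eq_0_iff_AE) auto
    then show "AE w in M. q k (X w) = pr k" by simp
  qed simp
  have set_eq: "{1..K} = insert K {1..K - 1}" using K2 by auto
  have "(\<Sum>k=1..K. pr k) = (\<integral>w. (\<Sum>k=1..K. q k (X w)) \<partial>M)"
    by (subst Bochner_Integration.integral_sum) (auto simp: integrable_q integral_q)
  also have "\<dots> = (\<integral>w. 1 \<partial>M)"
    using AE_X_G by (intro integral_cong_AE) (auto simp del: One_nat_def simp: sum_q elim!: eventually_mono)
  finally have sum_pr: "(\<Sum>k=1..K. pr k) = 1" by (simp add: prob_space)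
  have all: "AE w in M. \<forall>k\<in>{1..K}. q k (X w) = pr k"
    using AE_X_G const
  proof eventually_elim
    case (elim w)
    have "(\<Sum>k=1..K. q k (X w)) = 1" using elim by (intro sum_q) simp
    then have "q K (X w) + (\<Sum>k=1..K - 1. q k (X w)) = pr K + (\<Sum>k=1..K - 1. pr k)"
      using sum_pr set_eq K2 by simp
    moreover have "(\<Sum>k=1..K - 1. q k (X w)) = (\<Sum>k=1..K - 1. pr k)"
      using elim by (intro sum.cong) auto
    ultimately show ?case using elim set_eq by simp
  qed
  have one: "prob {w \<in> space M. X w \<in> A \<and> Y w = k} = prob {w \<in> space M. X w \<in> A} * pr k"
    if [measurable]: "A \<in> sets borel" and k: "k \<in> {1..K}" for A k
  proof -
    have "prob {w \<in> space M. X w \<in> A \<and> Y w = k} = (\<integral>w. indicator A (X w) * q k (X w) \<partial>M)"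
      using integral_q_indicator[OF k that(1)] by simp
    also have "\<dots> = (\<integral>w. indicator {w \<in> space M. X w \<in> A} w * pr k \<partial>M)"
      using all k by (intro integral_cong_AE) (auto simp: indicator_def elim!: eventually_mono)
    also have "\<dots> = prob {w \<in> space M. X w \<in> A} * pr k"
      by (subst Bochner_Integration.integral_mult_left)
        (auto intro!: integrable_event simp: Int_def intro!: arg_cong[where f = prob])
    finally show ?thesis .
  qed
  have "indep_rv M borel X (count_space {1..K}) Y"
    unfolding indep_rv_def
  proof (intro conjI X_meas Y_meas indep_setI)
    show "{X -` A \<inter> space M |A. A \<in> sets borel} \<subseteq> events"
      "{Y -` B \<inter> space M |B. B \<in> sets (count_space {1..K})} \<subseteq> events"
      using Y_meas by (auto intro: measurable_sets)
    fix a b assume "a \<in> {X -` A \<inter> space M |A. A \<in> sets borel}" "b \<in> {Y -` B \<inter> space M |B. B \<in> sets (count_space {1..K})}"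
    then obtain A B where AB: "A \<in> sets borel" "B \<subseteq> {1..K}" "a = X -` A \<inter> space M" "b = Y -` B \<inter> space M"
      by auto
    have [measurable]: "A \<in> sets borel" by fact
    have fin: "finite B" using AB(2) finite_subset by blast
    have "prob (a \<inter> b) = prob (\<Union>k\<in>B. {w \<in> space M. X w \<in> A \<and> Y w = k})"
      by (rule arg_cong[where f = prob]) (auto simp: AB)
    also have "\<dots> = (\<Sum>k\<in>B. prob {w \<in> space M. X w \<in> A \<and> Y w = k})"
      by (rule finite_measure_finite_Union[OF fin]) (auto simp: disjoint_family_on_def)
    also have "\<dots> = (\<Sum>k\<in>B. prob a * pr k)"
      using AB(2) by (intro sum.cong refl) (subst one, auto simp: AB(3) vimage_def Int_def conj_commute)
    also have "\<dots> = prob a * (\<Sum>k\<in>B. prob {w \<in> space M. Y w = k})"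
      by (simp add: pr_def sum_distrib_left)
    also have "(\<Sum>k\<in>B. prob {w \<in> space M. Y w = k}) = prob (\<Union>k\<in>B. {w \<in> space M. Y w = k})"
      by (rule finite_measure_finite_Union[OF fin, symmetric]) (auto simp: disjoint_family_on_def)
    also have "(\<Union>k\<in>B. {w \<in> space M. Y w = k}) = b" by (auto simp: AB)
    finally show "prob (a \<inter> b) = prob a * prob b" .
  qed
  with dep show False by simp
qed

section \<open>The law of the sample points\<close>

lemma Xs_meas[measurable]: "i \<in> {1..} \<Longrightarrow> Xs i \<in> borel_measurable M"
  using Xs_indep by (auto simp: indep_vars_def)

lemma Xs_meas': "i \<in> {1..n} \<Longrightarrow> Xs i \<in> borel_measurable M"
  by (rule Xs_meas) auto

lemma Us_meas[measurable]: "i \<in> {1..} \<Longrightarrow> Us i \<in> borel_measurable M"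
  using Us_indep by (auto simp: indep_vars_def)

lemma AE_Xs:
  assumes [measurable]: "A \<in> sets borel" and A: "AE w in M. X w \<in> A" and i: "1 \<le> i"
  shows "AE w in M. Xs i w \<in> A"
proof -
  have "AE x in distr M borel X. x \<in> A" using A by (subst AE_distr_iff) auto
  then have "AE x in distr M borel (Xs i). x \<in> A" unfolding Xs_distr[OF i] .
  then show ?thesis using i by (subst (asm) AE_distr_iff) auto
qed

lemma AE_Xs_G: "AE w in M. \<forall>i\<ge>1. Xs i w \<in> G"
  using AE_Xs[OF G_meas AE_X_G] by (subst AE_all_countable) auto

text \<open>Exchangeability in the form used below: reading the sample along any injective list of
  indices gives the same product law.\<close>

lemma Xs_law:
  assumes inj: "inj_on \<tau> {1..n}" and im: "\<tau> ` {1..n} \<subseteq> {1..}"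
  shows "distr M (PiM {1..n} (\<lambda>_. borel)) (\<lambda>w. \<lambda>i\<in>{1..n}. Xs (\<tau> i) w) = PiM {1..n} (\<lambda>_. distr M borel X)"
proof -
  let ?\<mu> = "distr M borel X"
  have \<tau>: "\<tau> i \<in> {1..}" if "i \<in> {1..n}" for i using im that by blast
  interpret mu: prob_space ?\<mu> by (rule prob_space_distr) simp
  have full: "distr M (PiM {1..} (\<lambda>_. borel)) (\<lambda>w. \<lambda>i\<in>{1..}. Xs i w) = PiM {1..} (\<lambda>_. ?\<mu>)"
  proof -
    have "distr M (PiM {1..} (\<lambda>_. borel)) (\<lambda>w. \<lambda>i\<in>{1..}. Xs i w) = PiM {1..} (\<lambda>i. distr M borel (Xs i))"
      using Xs_indep by (subst (asm) indep_vars_iff_distr_eq_PiM') auto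
    also have "\<dots> = PiM {1..} (\<lambda>_. ?\<mu>)"
      by (intro PiM_cong) (auto simp: Xs_distr)
    finally show ?thesis .
  qed
  have meas: "(\<lambda>\<omega>. \<lambda>i\<in>{1..n}. \<omega> (\<tau> i)) \<in> measurable (PiM {1..} (\<lambda>_. borel :: 'h measure)) (PiM {1..n} (\<lambda>_. borel))"
    using \<tau> by (intro measurable_restrict measurable_component_singleton)
  have "PiM {1..n} (\<lambda>_. ?\<mu>) = distr (PiM {1..} (\<lambda>_. ?\<mu>)) (PiM {1..n} (\<lambda>_. ?\<mu>)) (\<lambda>\<omega>. \<lambda>i\<in>{1..n}. \<omega> (\<tau> i))"
    using im by (intro distr_PiM_reindex[symmetric] inj mu.prob_space_axioms) auto
  also have "\<dots> = distr (distr M (PiM {1..} (\<lambda>_. borel)) (\<lambda>w. \<lambda>i\<in>{1..}. Xs i w)) (PiM {1..n} (\<lambda>_. borel)) (\<lambda>\<omega>. \<lambda>i\<in>{1..n}. \<omega> (\<tau> i))"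
    unfolding full by (rule distr_cong) (auto intro!: sets_PiM_cong)
  also have "\<dots> = distr M (PiM {1..n} (\<lambda>_. borel)) (\<lambda>w. \<lambda>i\<in>{1..n}. Xs (\<tau> i) w)"
  proof -
    have seq: "(\<lambda>w. \<lambda>i\<in>{1..}. Xs i w) \<in> measurable M (PiM {1..} (\<lambda>_. borel))"
      by (intro measurable_restrict Xs_meas)
    show ?thesis
      by (subst distr_distr[OF meas seq]) (use \<tau> in \<open>auto intro!: distr_cong simp: restrict_def fun_eq_iff\<close>)
  qed
  finally show ?thesis ..
qed

lemma prob_all_mutual:
  assumes n: "2 \<le> n"
  shows "real (Suc n) * prob {w \<in> space M. all_mutual {1..n} (\<lambda>i. Xs i w)} \<le> 3"
proof -
  define P where "P = prob {w \<in> space M. all_mutual {1..n} (\<lambda>i. Xs i w)}"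
  \<comment> \<open>\<open>\<sigma> i\<close> lists \<open>{1..Suc n} - {i}\<close> in increasing
    order, so the sample without point \<open>i\<close> keeps its tie-breaking.\<close>
  define \<sigma> where "\<sigma> i j = (if j < i then j else Suc j)" for i j :: nat
  let ?E = "\<lambda>i. {w \<in> space M. all_mutual {1..n} (\<lambda>j. Xs (\<sigma> i j) w)}"
  have \<sigma>: "inj_on (\<sigma> i) {1..n}" "\<sigma> i ` {1..n} = {1..Suc n} - {i}" "strict_mono_on {1..n} (\<sigma> i)"
    if i: "i \<in> {1..Suc n}" for i
  proof -
    show "strict_mono_on {1..n} (\<sigma> i)" by (auto simp: strict_mono_on_def \<sigma>_def)
    then show "inj_on (\<sigma> i) {1..n}" by (rule strict_mono_on_imp_inj_on)
    show "\<sigma> i ` {1..n} = {1..Suc n} - {i}"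
    proof (intro equalityI subsetI)
      fix j assume j: "j \<in> {1..Suc n} - {i}"
      show "j \<in> \<sigma> i ` {1..n}"
      proof (cases "j < i")
        case True
        then show ?thesis using i j by (intro image_eqI[of _ _ j]) (auto simp: \<sigma>_def)
      next
        case False
        then show ?thesis using i j by (intro image_eqI[of _ _ "j - 1"]) (auto simp: \<sigma>_def)
      qed
    qed (use i in \<open>auto simp: \<sigma>_def split: if_splits\<close>)
  qed
  have [measurable]: "Xs (\<sigma> i j) \<in> borel_measurable M" if "j \<in> {1..n}" for i j
    using that by (intro Xs_meas) (auto simp: \<sigma>_def)
  have E[measurable]: "?E i \<in> events" for i
    using pred_all_mutual[OF _ n, of "\<lambda>j. Xs (\<sigma> i j)" M] by (simp add: pred_def)
  have [measurable]: "Measurable.pred (PiM {1..n} (\<lambda>_. borel :: 'h measure)) (\<lambda>x. all_mutual {1..n} x)"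
    using pred_all_mutual[OF _ n, of "\<lambda>j x. x j" "PiM {1..n} (\<lambda>_. borel :: 'h measure)"] by simp
  have law: "prob {w \<in> space M. all_mutual {1..n} (\<lambda>j. Xs (\<tau> j) w)} =
      measure (PiM {1..n} (\<lambda>_. distr M borel X)) {x \<in> space (PiM {1..n} (\<lambda>_. borel)). all_mutual {1..n} x}"
    if "inj_on \<tau> {1..n}" "\<tau> ` {1..n} \<subseteq> {1..}" for \<tau>
  proof -
    have [measurable]: "Xs (\<tau> j) \<in> borel_measurable M" if "j \<in> {1..n}" for j
      using that \<open>\<tau> ` {1..n} \<subseteq> {1..}\<close> by (intro Xs_meas) blast
    have set_eq: "(\<lambda>w. \<lambda>i\<in>{1..n}. Xs (\<tau> i) w) -` {x \<in> space (PiM {1..n} (\<lambda>_. borel)). all_mutual {1..n} x} \<inter> space M =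
        {w \<in> space M. all_mutual {1..n} (\<lambda>j. Xs (\<tau> j) w)}"
      using all_mutual_cong[OF n, of "restrict (\<lambda>i. Xs (\<tau> i) _) {1..n}" "\<lambda>j. Xs (\<tau> j) _"]
      by (auto simp: space_PiM)
    show ?thesis
      unfolding Xs_law[OF that, symmetric] set_eq[symmetric]
      by (rule measure_distr[symmetric]) measurable
  qed
  have "prob (?E i) = P" if "i \<in> {1..Suc n}" for i
  proof -
    have "{1..Suc n} - {i} \<subseteq> {1..}" by auto
    then show ?thesis using law[of "\<sigma> i"] law[of "\<lambda>j. j"] \<sigma>[OF that] by (auto simp: P_def)
  qed
  \<comment> \<open>All \<open>n + 1\<close> deletions have the same probability. Their sum is the
    expected number of deletions that leave only mutual pairs, and this number is at most
    \<open>3\<close> for every outcome.\<close>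
  then have "real (Suc n) * P = (\<Sum>i\<in>{1..Suc n}. prob (?E i))"
    by simp
  also have "\<dots> = (\<integral>w. (\<Sum>i\<in>{1..Suc n}. indicator (?E i) w) \<partial>M)"
    by (subst Bochner_Integration.integral_sum) (auto simp: Int_absorb2 simp del: One_nat_def intro!: integrable_event E sum.cong arg_cong[where f = prob])
  also have "\<dots> \<le> (\<integral>w. 3 \<partial>M)"
  proof (rule integral_mono)
    fix w assume w: "w \<in> space M"
    have eq: "w \<in> ?E i \<longleftrightarrow> all_mutual ({1..Suc n} - {i}) (\<lambda>i. Xs i w)" if "i \<in> {1..Suc n}" for i
      using all_mutual_reindex[of "{1..n}" "\<sigma> i" "\<lambda>i. Xs i w"] \<sigma>[OF that] n w by (simp add: o_def)
    have "(\<Sum>i\<in>{1..Suc n}. indicator (?E i) w :: real) =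
        (\<Sum>i\<in>{1..Suc n}. if all_mutual ({1..Suc n} - {i}) (\<lambda>i. Xs i w) then 1 else 0)"
      by (intro sum.cong refl) (simp only: indicator_def of_bool_def eq)
    also have "\<dots> = real (card {i \<in> {1..Suc n}. all_mutual ({1..Suc n} - {i}) (\<lambda>i. Xs i w)})"
      by (simp add: sum.If_cases Int_def del: sum.cl_ivl_Suc)
    also have "\<dots> \<le> 3"
      using card_all_mutual_removals[of "{1..Suc n}" "\<lambda>i. Xs i w"] n by simp
    finally show "(\<Sum>i\<in>{1..Suc n}. indicator (?E i) w :: real) \<le> 3" .
  next
    show "integrable M (\<lambda>w. \<Sum>i\<in>{1..Suc n}. indicator (?E i) w :: real)"
      by (intro Bochner_Integration.integrable_sum integrable_event E)
  qed simp
  also have "\<dots> = 3" by (simp add: prob_space)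
  finally show ?thesis by (simp add: P_def)
qed

lemma prob_all_mutual_tendsto:
  "(\<lambda>n. prob {w \<in> space M. all_mutual {1..n} (\<lambda>i. Xs i w)}) \<longlonglongrightarrow> 0"
proof (rule tendsto_sandwich[of "\<lambda>_. 0" _ _ "\<lambda>n. 3 / real (Suc n)"])
  show "\<forall>\<^sub>F n in sequentially. prob {w \<in> space M. all_mutual {1..n} (\<lambda>i. Xs i w)} \<le> 3 / real (Suc n)"
    using eventually_ge_at_top[of 2]
  proof eventually_elim
    case (elim n)
    from prob_all_mutual[OF elim] show ?case by (simp add: pos_le_divide_eq mult.commute)
  qed
  show "(\<lambda>n. 3 / real (Suc n)) \<longlonglongrightarrow> 0"
    using tendsto_mult_right[OF LIMSEQ_inverse_real_of_nat, of 3] by (simp add: field_simps)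
qed auto

end

section \<open>Nearest neighbours have asymptotically equal conditional probabilities\<close>

lemma measurable_resp:
  assumes Q[measurable]: "\<And>k. k \<in> {1..K} \<Longrightarrow> Q k \<in> borel_measurable borel"
    and [measurable]: "A \<in> borel_measurable S" "B \<in> borel_measurable S"
  shows "(\<lambda>s. resp K Q (A s) (B s :: real)) \<in> measurable S (count_space UNIV)"
  unfolding resp_def
proof (rule measurable_Least)
  fix k
  show "Measurable.pred S (\<lambda>s. k \<in> {1..K} \<and> B s < (\<Sum>j = 1..k. Q j (A s)))"
  proof (cases "k \<in> {1..K}")
    case True
    then have [measurable]: "\<And>j. j \<in> {1..k} \<Longrightarrow> Q j \<in> borel_measurable borel"
      by (intro Q) auto
    show ?thesis by measurable
  qed simp
qed

context nn_sample
begin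

lemma resp_meas:
  "A \<in> borel_measurable S \<Longrightarrow> B \<in> borel_measurable S \<Longrightarrow>
    (\<lambda>s. resp K Q (A s) (B s)) \<in> measurable S (count_space UNIV)"
  using Q_meas by (rule measurable_resp)

lemma pred_resp_eq:
  assumes "A \<in> borel_measurable S" "C \<in> borel_measurable S"
  shows "Measurable.pred S (\<lambda>s. resp K Q (A s) (C s) = l)"
proof -
  define a where "a s = resp K Q (A s) (C s)" for s
  have [measurable]: "a \<in> measurable S (count_space UNIV)"
    unfolding a_def[abs_def] by (rule resp_meas[OF assms])
  have "Measurable.pred S (\<lambda>s. a s = l)" by measurable
  then show ?thesis by (simp add: a_def)
qed

lemma pred_resp_neq:
  assumes "A \<in> borel_measurable S" "B \<in> borel_measurable S" "C \<in> borel_measurable S"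
  shows "Measurable.pred S (\<lambda>s. resp K Q (A s) (C s) \<noteq> resp K Q (B s) (C s))"
proof -
  define b where "b s = resp K Q (B s) (C s)" for s
  have [measurable]: "b \<in> measurable S (count_space UNIV)"
    unfolding b_def[abs_def] by (rule resp_meas[OF assms(2,3)])
  have "Measurable.pred S (\<lambda>s. resp K Q (A s) (C s) \<noteq> b s)"
    by (rule measurable_compose_countable[where f = "\<lambda>i s. i \<noteq> b s", OF _ resp_meas[OF assms(1,3)]]) measurable
  then show ?thesis by (simp add: b_def)
qed

lemma borel_measurable_resp_neq:
  assumes [measurable]: "A \<in> borel_measurable S" "B \<in> borel_measurable S" "C \<in> borel_measurable S"
  shows "(\<lambda>s. of_bool (resp K Q (A s) (C s) \<noteq> resp K Q (B s) (C s)) :: ennreal) \<in> borel_measurable S"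
proof -
  define P where "P s \<longleftrightarrow> resp K Q (A s) (C s) \<noteq> resp K Q (B s) (C s)" for s
  have [measurable]: "Measurable.pred S P"
    using pred_resp_neq[OF assms] by (simp add: P_def[abs_def])
  have "(\<lambda>s. if P s then 1 else 0 :: ennreal) \<in> borel_measurable S"
    by measurable
  then show ?thesis by (simp add: P_def of_bool_def)
qed

definition part :: "nat \<Rightarrow> 'h \<Rightarrow> real" where
  "part k x = (\<Sum>j=1..k. Q j x)"

lemma part_mono: "x \<in> G \<Longrightarrow> k \<le> l \<Longrightarrow> l \<le> K \<Longrightarrow> part k x \<le> part l x"
  unfolding part_def by (rule sum_mono2) (auto simp: G_def)

text \<open>\<open>resp\<close> is the quantile transform: it picks the cell between consecutive
  partial sums that contains \<open>u\<close>. On \<open>G\<close> the partial sums increase, so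
  comparing \<open>u\<close> with two of them settles the least index.\<close>

lemma resp_eq_iff:
  assumes x: "x \<in> G" and u: "u \<in> {0<..<1}" and l: "l \<in> {1..K}"
  shows "resp K Q x u = l \<longleftrightarrow> part (l - 1) x \<le> u \<and> u < part l x"
proof -
  let ?P = "\<lambda>k. k \<in> {1..K} \<and> part k x > u"
  have r: "resp K Q x u = (LEAST k. ?P k)" by (simp add: resp_def part_def)
  have "?P K" using x u K2 by (auto simp: G_def part_def)
  then have R: "?P (resp K Q x u)" unfolding r by (rule LeastI)
  show ?thesis
  proof
    assume eq: "resp K Q x u = l"
    show "part (l - 1) x \<le> u \<and> u < part l x"
    proof (cases "l = 1")
      case True
      then show ?thesis using R eq u by (simp add: part_def)
    next
      case False
      have "\<not> ?P (l - 1)" using not_less_Least[of "l - 1" ?P] eq r l by auto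
      then show ?thesis using R eq l False by auto
    qed
  next
    assume *: "part (l - 1) x \<le> u \<and> u < part l x"
    show "resp K Q x u = l"
      unfolding r
    proof (rule Least_equality)
      show "?P l" using * l by auto
      fix k assume k: "?P k"
      show "l \<le> k"
      proof (rule ccontr)
        assume "\<not> l \<le> k"
        then have "part k x \<le> part (l - 1) x" using l by (intro part_mono x) auto
        with k * show False by auto
      qed
    qed
  qed
qed

definition U :: "real measure" where
  "U = uniform_measure lborel {0<..<1}"

lemma sets_U[measurable_cong, simp]: "sets U = sets borel"
  by (simp add: U_def)

lemma space_U[simp]: "space U = UNIV"
  by (simp add: U_def)

lemma emeasure_U: "A \<in> sets borel \<Longrightarrow> emeasure U A = emeasure lborel ({0<..<1} \<inter> A)"
  by (simp add: U_def divide_ennreal_def)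

lemma prob_space_U: "prob_space U"
  unfolding U_def by (rule prob_space_uniform_measure) auto

lemma AE_U: "(AE u in U. P u) \<longleftrightarrow> (AE u in lborel. u \<in> {0<..<1} \<longrightarrow> P u)"
  unfolding U_def by (rule AE_uniform_measure) auto

lemma prob_resp:
  assumes x: "x \<in> G" and l: "l \<in> {1..K}"
  shows "emeasure U {u. resp K Q x u = l} = ennreal (q l x)"
proof -
  have "l - 1 \<le> K" using l by auto
  then have 0: "0 \<le> part (l - 1) x" using part_mono[OF x, of 0 "l - 1"] by (simp add: part_def)
  have 1: "part l x \<le> 1" using part_mono[OF x, of l K] l x by (simp add: part_def G_def)
  have m: "part (l - 1) x \<le> part l x" using part_mono[OF x, of "l - 1" l] l by simp
  have "(\<lambda>u. resp K Q x u) \<in> measurable borel (count_space UNIV)"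
    by (rule resp_meas) auto
  then have meas: "{u. resp K Q x u = l} \<in> sets borel"
    by (auto dest: measurable_sets[of _ _ _ "{l}"] simp: vimage_def)
  have "{0<..<1} \<inter> {u. resp K Q x u = l} = {0<..<1} \<inter> {part (l - 1) x..<part l x}"
    unfolding set_eq_iff by (simp add: resp_eq_iff[OF x _ l] cong: conj_cong)
  then have "emeasure U {u. resp K Q x u = l} = emeasure lborel ({0<..<1} \<inter> {part (l - 1) x..<part l x})"
    using meas by (simp add: emeasure_U)
  also have "\<dots> = emeasure lborel {part (l - 1) x..<part l x}"
  proof (rule emeasure_eq_AE)
    \<comment> \<open>The cell lies in \<open>[0, 1]\<close> and is open on the right, so cutting it
      down to the open unit interval removes at most the point \<open>0\<close>.\<close>
    show "AE u in lborel. u \<in> {0<..<1} \<inter> {part (l - 1) x..<part l x} \<longleftrightarrow> u \<in> {part (l - 1) x..<part l x}"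
      using AE_lborel_singleton[of 0] by eventually_elim (use 0 1 in auto)
  qed auto
  also have "\<dots> = ennreal (q l x)"
  proof -
    have "part l x = part (l - 1) x + Q l x" using l by (cases l) (auto simp: part_def)
    then have "part l x - part (l - 1) x = q l x" using x by (simp add: q_def)
    then show ?thesis using m by simp
  qed
  finally show ?thesis .
qed

definition XN :: "nat \<Rightarrow> 'w \<Rightarrow> 'h" where
  "XN n w = Xs (nn_in {1..n} (\<lambda>j. Xs j w) 1) w"

lemma XN_meas: "2 \<le> n \<Longrightarrow> XN n \<in> borel_measurable M"
  unfolding XN_def[abs_def] by (rule borel_measurable_nn_point[OF Xs_meas']) auto

lemma X1_meas[measurable]: "Xs 1 \<in> borel_measurable M"
  by (rule Xs_meas) simp

lemma XN_G: "\<forall>i\<ge>1. Xs i w \<in> G \<Longrightarrow> 2 \<le> n \<Longrightarrow> XN n w \<in> G"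
  using nn_in_range[of n 1 "\<lambda>j. Xs j w"] by (auto simp: XN_def)

text \<open>The mean change of \<open>q l\<close> from the first point to its neighbour. Both
  alternatives of the theorem act only through its convergence to zero.\<close>

definition gap :: "nat \<Rightarrow> nat \<Rightarrow> ennreal" where
  "gap l n = (\<integral>\<^sup>+w. ennreal \<bar>q l (XN n w) - q l (Xs 1 w)\<bar> \<partial>M)"

text \<open>Take a countable basis. A basic set of positive mass is almost surely hit by a later
  sample point, and one of mass zero almost surely misses the first point. So every neighbourhood of
  the first point contains another sample point, and the nearest neighbour is at least as
  close.\<close>

lemma AE_XN_tendsto: "AE w in M. (\<lambda>n. XN n w) \<longlonglongrightarrow> Xs 1 w"
proof -
  obtain B :: "'h set set" where B: "countable B" "topological_basis B"
    using ex_countable_basis by blast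
  have hit: "AE w in M. \<exists>j\<ge>2. Xs j w \<in> b" if b: "b \<in> B" and pos: "prob {w \<in> space M. X w \<in> b} > 0" for b
  proof -
    have [measurable]: "b \<in> sets borel" using topological_basis_open[OF B(2) b] by simp
    let ?p = "prob {w \<in> space M. X w \<notin> b}"
    have pX: "prob {w \<in> space M. Xs j w \<notin> b} = ?p" if "1 \<le> j" for j
    proof -
      have "prob {w \<in> space M. Xs j w \<notin> b} = measure (distr M borel (Xs j)) (- b)"
        using that by (subst measure_distr) (auto intro!: arg_cong[where f = prob])
      also have "\<dots> = ?p"
        unfolding Xs_distr[OF that] by (subst measure_distr) (auto intro!: arg_cong[where f = prob])
      finally show ?thesis .
    qed
    have "?p = 1 - prob {w \<in> space M. X w \<in> b}"
      by (subst prob_compl[symmetric]) (auto intro!: arg_cong[where f = prob])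
    then have p: "0 \<le> ?p" "?p < 1" using pos by auto
    let ?E = "{w \<in> space M. \<forall>j\<ge>2. Xs j w \<notin> b}"
    have E: "?E \<in> events"
    proof (rule sets.sets_Collect_countable_All)
      fix j show "{w \<in> space M. 2 \<le> j \<longrightarrow> Xs j w \<notin> b} \<in> events"
      proof (cases "2 \<le> j")
        case True
        then have [measurable]: "Xs j \<in> borel_measurable M" by (intro Xs_meas) auto
        show ?thesis by measurable
      qed simp
    qed
    \<comment> \<open>Only the \<open>n\<close> independent points \<open>2, ..., n + 1\<close> are
      looked at; letting \<open>n\<close> grow leaves probability zero.\<close>
    have "prob ?E \<le> ?p ^ n" for n
    proof (cases "n = 0")
      case False
      have "prob ?E \<le> prob (\<Inter>j\<in>{2..Suc n}. Xs j -` (- b) \<inter> space M)"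
        by (intro finite_measure_mono) (use False in \<open>auto intro!: sets.finite_INT measurable_sets[OF Xs_meas]\<close>)
      also have "\<dots> = (\<Prod>j\<in>{2..Suc n}. prob (Xs j -` (- b) \<inter> space M))"
        using False by (intro indep_varsD[OF Xs_indep]) auto
      also have "\<dots> = (\<Prod>j\<in>{2..Suc n}. ?p)"
      proof (intro prod.cong refl)
        fix j assume "j \<in> {2..Suc n}"
        moreover have "Xs j -` (- b) \<inter> space M = {w \<in> space M. Xs j w \<notin> b}" by auto
        ultimately show "prob (Xs j -` (- b) \<inter> space M) = ?p" using pX[of j] by simp
      qed
      finally show ?thesis by simp
    qed simp
    moreover have "(\<lambda>n. ?p ^ n) \<longlonglongrightarrow> 0"
      using p by (intro LIMSEQ_realpow_zero) auto
    ultimately have "prob ?E \<le> 0"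
      by (intro LIMSEQ_le_const) auto
    then have "prob ?E = 0" by (intro antisym) auto
    then have "?E \<in> null_sets M" using E by (auto simp: null_sets_def emeasure_eq_measure)
    then have "AE w in M. w \<notin> ?E" by (rule AE_not_in)
    then show ?thesis by (rule AE_mp) (auto intro!: AE_I2)
  qed
  have miss: "AE w in M. Xs 1 w \<notin> b" if b: "b \<in> B" and null: "\<not> prob {w \<in> space M. X w \<in> b} > 0" for b
  proof -
    have [measurable]: "b \<in> sets borel" using topological_basis_open[OF B(2) b] by simp
    have "prob {w \<in> space M. X w \<in> b} = 0" using null by (simp add: zero_less_measure_iff)
    then have "{w \<in> space M. X w \<in> b} \<in> null_sets M" by (auto simp: null_sets_def emeasure_eq_measure)
    then have "AE w in M. w \<notin> {w \<in> space M. X w \<in> b}" by (rule AE_not_in)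
    then have "AE w in M. X w \<in> - b" by (rule AE_mp) (auto intro!: AE_I2)
    from AE_Xs[OF _ this, of 1] show ?thesis by simp
  qed
  have "AE w in M. \<forall>b\<in>B. Xs 1 w \<in> b \<longrightarrow> (\<exists>j\<ge>2. Xs j w \<in> b)"
    unfolding AE_ball_countable[OF B(1)]
  proof
    fix b assume b: "b \<in> B"
    show "AE w in M. Xs 1 w \<in> b \<longrightarrow> (\<exists>j\<ge>2. Xs j w \<in> b)"
      using hit[OF b] miss[OF b] by (cases "prob {w \<in> space M. X w \<in> b} > 0") auto
  qed
  then show ?thesis
  proof eventually_elim
    case (elim w)
    show ?case
    proof (rule metric_LIMSEQ_I)
      fix e :: real assume e: "e > 0"
      obtain b where b: "b \<in> B" "Xs 1 w \<in> b" "b \<subseteq> ball (Xs 1 w) e"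
        using topological_basisE[OF B(2), of "ball (Xs 1 w) e" "Xs 1 w"] e by auto
      with elim obtain j where j: "2 \<le> j" "Xs j w \<in> b" by auto
      have "dist (XN n w) (Xs 1 w) < e" if n: "j \<le> n" for n
      proof -
        have "j \<in> {1..n} - {1}" using j n by auto
        then have "dist (Xs 1 w) (XN n w) \<le> dist (Xs 1 w) (Xs j w)"
          unfolding XN_def by (intro nn_in_props[THEN conjunct2, rule_format]) auto
        also have "\<dots> < e" using b j by auto
        finally show ?thesis by (simp add: dist_commute)
      qed
      then show "\<exists>N. \<forall>n\<ge>N. dist (XN n w) (Xs 1 w) < e" by blast
    qed
  qed
qed

text \<open>The neighbour converges to the point, at which \<open>Q l\<close> is almost surely
  continuous; the bound \<open>1\<close> permits dominated convergence.\<close>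

lemma gap_tendsto_continuous:
  assumes l: "l \<in> {1..K}" and cont: "AE x in distr M borel X. isCont (Q l) x"
  shows "gap l \<longlonglongrightarrow> 0"
proof -
  have c1: "AE w in M. isCont (Q l) (Xs 1 w)"
    using cont unfolding Xs_distr[OF order_refl, symmetric] by (rule AE_distrD[rotated]) simp
  \<comment> \<open>Shifted by two, because a neighbour exists only from two points on.\<close>
  have "(\<lambda>n. gap l (n + 2)) \<longlonglongrightarrow> (\<integral>\<^sup>+w. 0 \<partial>M)"
    unfolding gap_def
  proof (rule nn_integral_dominated_convergence[where w = "\<lambda>_. 1"])
    fix n show "(\<lambda>w. ennreal \<bar>q l (XN (n + 2) w) - q l (Xs 1 w)\<bar>) \<in> borel_measurable M"
      using XN_meas[of "n + 2"] l by measurable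
    show "AE w in M. ennreal \<bar>q l (XN (n + 2) w) - q l (Xs 1 w)\<bar> \<le> 1"
    proof (intro AE_I2)
      fix w show "ennreal \<bar>q l (XN (n + 2) w) - q l (Xs 1 w)\<bar> \<le> 1"
        using q_bounds[OF l, of "XN (n + 2) w"] q_bounds[OF l, of "Xs 1 w"] by simp
    qed
  next
    show "AE w in M. (\<lambda>n. ennreal \<bar>q l (XN (n + 2) w) - q l (Xs 1 w)\<bar>) \<longlonglongrightarrow> 0"
      using AE_XN_tendsto AE_Xs_G c1
    proof eventually_elim
      case (elim w)
      have "(\<lambda>n. XN (n + 2) w) \<longlonglongrightarrow> Xs 1 w"
        using elim(1) by (rule LIMSEQ_ignore_initial_segment)
      then have "(\<lambda>n. Q l (XN (n + 2) w)) \<longlonglongrightarrow> Q l (Xs 1 w)"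
        by (rule isCont_tendsto_compose[OF elim(3)])
      then have "(\<lambda>n. \<bar>Q l (XN (n + 2) w) - Q l (Xs 1 w)\<bar>) \<longlonglongrightarrow> \<bar>Q l (Xs 1 w) - Q l (Xs 1 w)\<bar>"
        by (intro tendsto_intros)
      then have "(\<lambda>n. ennreal \<bar>Q l (XN (n + 2) w) - Q l (Xs 1 w)\<bar>) \<longlonglongrightarrow> ennreal 0"
        by (intro tendsto_ennrealI) simp
      \<comment> \<open>The cut-off \<open>q\<close> need not inherit continuity, but along the
        sample it coincides with \<open>Q\<close>, since all sample points lie in
        \<open>G\<close>.\<close>
      moreover have "Q l (XN (n + 2) w) = q l (XN (n + 2) w)" for n
        using XN_G[OF elim(2), of "n + 2"] by (simp add: q_def)
      moreover have "Q l (Xs 1 w) = q l (Xs 1 w)"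
        using elim(2) by (simp add: q_def)
      ultimately show ?case by simp
    qed
  qed (auto simp: emeasure_space_1)
  then have "(\<lambda>n. gap l (n + 2)) \<longlonglongrightarrow> 0" by (simp del: add_2_eq_Suc')
  then show ?thesis by (rule LIMSEQ_offset)
qed

text \<open>A coupling inequality: both levels are generated from the same \<open>u\<close>, so
  their probabilities differ by at most the probability that the levels differ.\<close>

lemma q_diff_le_resp:
  assumes x: "x \<in> G" "x' \<in> G" and l: "l \<in> {1..K}"
  shows "ennreal \<bar>q l x - q l x'\<bar> \<le> (\<integral>\<^sup>+u. of_bool (resp K Q x u \<noteq> resp K Q x' u) \<partial>U)"
proof -
  have rm[measurable]: "(\<lambda>u. resp K Q x u) \<in> measurable borel (count_space UNIV)" for x
    by (rule resp_meas) auto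
  have sets_resp: "{u. resp K Q x u = l} \<in> sets borel" "{u. resp K Q x u \<noteq> resp K Q x' u} \<in> sets borel" for x x'
  proof -
    have "Measurable.pred borel (\<lambda>u. resp K Q x u = l)" "Measurable.pred borel (\<lambda>u. resp K Q x u \<noteq> resp K Q x' u)"
      by (auto intro!: pred_resp_eq pred_resp_neq)
    then show "{u. resp K Q x u = l} \<in> sets borel" "{u. resp K Q x u \<noteq> resp K Q x' u} \<in> sets borel"
      by (simp_all add: pred_def)
  qed
  interpret U: prob_space U by (rule prob_space_U)
  have one: "q l x = U.prob {u. resp K Q x u = l}" if "x \<in> G" for x
    using prob_resp[OF that l] q_bounds[OF l, of x] by (simp add: U.emeasure_eq_measure)
  have half: "q l x \<le> q l x' + U.prob {u. resp K Q x u \<noteq> resp K Q x' u}" if "x \<in> G" "x' \<in> G" for x x'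
  proof -
    have "q l x \<le> U.prob ({u. resp K Q x' u = l} \<union> {u. resp K Q x u \<noteq> resp K Q x' u})"
      unfolding one[OF that(1)] by (intro U.finite_measure_mono) (auto simp: sets_resp)
    also have "\<dots> \<le> U.prob {u. resp K Q x' u = l} + U.prob {u. resp K Q x u \<noteq> resp K Q x' u}"
      by (intro measure_Un_le) (auto simp: sets_resp)
    finally show ?thesis using one[OF that(2)] by simp
  qed
  have "\<bar>q l x - q l x'\<bar> \<le> U.prob {u. resp K Q x u \<noteq> resp K Q x' u}"
    using half[OF x] half[OF x(2,1)] by (simp add: abs_le_iff eq_commute)
  then have "ennreal \<bar>q l x - q l x'\<bar> \<le> emeasure U {u. resp K Q x u \<noteq> resp K Q x' u}"
    by (simp add: U.emeasure_eq_measure)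
  also have "\<dots> = (\<integral>\<^sup>+u. indicator {u. resp K Q x u \<noteq> resp K Q x' u} u \<partial>U)"
    by (rule nn_integral_indicator[symmetric]) (simp add: sets_resp)
  also have "\<dots> = (\<integral>\<^sup>+u. of_bool (resp K Q x u \<noteq> resp K Q x' u) \<partial>U)"
    by (intro nn_integral_cong) (simp add: indicator_def)
  finally show ?thesis .
qed

text \<open>The coupling bound is averaged over the sample, and Tonelli exchanges the order of
  integration. The hypothesis then applies for almost every fixed \<open>u\<close>, and dominated
  convergence integrates over \<open>u\<close>.\<close>

lemma gap_tendsto_resp:
  assumes l: "l \<in> {1..K}"
    and conv: "AE u in lborel. u \<in> {0<..<1} \<longrightarrow>
      tendsto_in_prob M (\<lambda>n w. resp K Q (Xs (nn n (\<lambda>i. Xs i w) 1) w) u) (\<lambda>w. resp K Q (Xs 1 w) u)"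
  shows "gap l \<longlonglongrightarrow> 0"
proof -
  interpret U: prob_space U by (rule prob_space_U)
  interpret MU: pair_sigma_finite M U ..
  define d where "d n u = (\<integral>\<^sup>+w. of_bool (resp K Q (XN (n + 2) w) u \<noteq> resp K Q (Xs 1 w) u) \<partial>M)" for n u
  have XN[measurable]: "XN (n + 2) \<in> borel_measurable M" for n
    by (rule XN_meas) simp
  have meas: "(\<lambda>(w, u). of_bool (resp K Q (XN (n + 2) w) u \<noteq> resp K Q (Xs 1 w) u) :: ennreal)
      \<in> borel_measurable (M \<Otimes>\<^sub>M U)" for n
    unfolding case_prod_beta by (rule borel_measurable_resp_neq) measurable
  have le: "gap l (n + 2) \<le> (\<integral>\<^sup>+u. d n u \<partial>U)" for n
  proof -
    have "gap l (n + 2) \<le> (\<integral>\<^sup>+w. \<integral>\<^sup>+u. of_bool (resp K Q (XN (n + 2) w) u \<noteq> resp K Q (Xs 1 w) u) \<partial>U \<partial>M)"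
      unfolding gap_def
    proof (rule nn_integral_mono_AE)
      show "AE w in M. ennreal \<bar>q l (XN (n + 2) w) - q l (Xs 1 w)\<bar>
          \<le> (\<integral>\<^sup>+u. of_bool (resp K Q (XN (n + 2) w) u \<noteq> resp K Q (Xs 1 w) u) \<partial>U)"
        using AE_Xs_G
      proof eventually_elim
        case (elim w)
        show ?case using XN_G[OF elim, of "n + 2"] elim by (intro q_diff_le_resp l) auto
      qed
    qed
    also have "\<dots> = (\<integral>\<^sup>+u. d n u \<partial>U)"
      unfolding d_def by (rule MU.Fubini'[OF meas, symmetric])
    finally show ?thesis .
  qed
  have "(\<lambda>n. \<integral>\<^sup>+u. d n u \<partial>U) \<longlonglongrightarrow> (\<integral>\<^sup>+u. 0 \<partial>U)"
  proof (rule nn_integral_dominated_convergence[where w = "\<lambda>_. 1"])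
    show "d n \<in> borel_measurable U" for n
    proof -
      have "(\<lambda>(u, w). of_bool (resp K Q (XN (n + 2) w) u \<noteq> resp K Q (Xs 1 w) u) :: ennreal)
          \<in> borel_measurable (U \<Otimes>\<^sub>M M)"
        unfolding case_prod_beta by (rule borel_measurable_resp_neq) measurable
      then show ?thesis
        unfolding d_def[abs_def] by (rule borel_measurable_nn_integral)
    qed
    have "d n u \<le> (\<integral>\<^sup>+w. 1 \<partial>M)" for n u
      unfolding d_def by (intro nn_integral_mono) auto
    then show "AE u in U. d n u \<le> 1" for n by (simp add: emeasure_space_1)
    show "AE u in U. (\<lambda>n. d n u) \<longlonglongrightarrow> 0"
      unfolding AE_U using conv
    proof eventually_elim
      case (elim u)
      show ?case
      proof
        assume u: "u \<in> {0<..<1}"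
        have "(\<lambda>n. prob {w \<in> space M. dist (resp K Q (Xs (nn n (\<lambda>i. Xs i w) 1) w) u) (resp K Q (Xs 1 w) u) > 1/2}) \<longlonglongrightarrow> 0"
          using elim u unfolding tendsto_in_prob_def by (auto elim!: allE[of _ "1/2"])
        then have "(\<lambda>n. prob {w \<in> space M. dist (resp K Q (Xs (nn (n + 2) (\<lambda>i. Xs i w) 1) w) u) (resp K Q (Xs 1 w) u) > 1/2}) \<longlonglongrightarrow> 0"
          by (rule LIMSEQ_ignore_initial_segment)
        \<comment> \<open>Levels are natural numbers, so the tolerance \<open>1/2\<close> detects
          exactly the event that they differ.\<close>
        moreover have "dist (real a) (real b) > 1/2 \<longleftrightarrow> a \<noteq> b" for a b
          by (cases a b rule: linorder_cases) (auto simp: dist_real_def)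
        ultimately have "(\<lambda>n. prob {w \<in> space M. resp K Q (XN (n + 2) w) u \<noteq> resp K Q (Xs 1 w) u}) \<longlonglongrightarrow> 0"
          by (simp add: XN_def nn_eq)
        then have "(\<lambda>n. ennreal (prob {w \<in> space M. resp K Q (XN (n + 2) w) u \<noteq> resp K Q (Xs 1 w) u})) \<longlonglongrightarrow> ennreal 0"
          by (rule tendsto_ennrealI)
        moreover have "d n u = ennreal (prob {w \<in> space M. resp K Q (XN (n + 2) w) u \<noteq> resp K Q (Xs 1 w) u})" for n
        proof -
          have "Measurable.pred M (\<lambda>w. resp K Q (XN (n + 2) w) u \<noteq> resp K Q (Xs 1 w) u)"
            by (rule pred_resp_neq) measurable
          then have [measurable]: "{w \<in> space M. resp K Q (XN (n + 2) w) u \<noteq> resp K Q (Xs 1 w) u} \<in> events"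
            by (simp add: pred_def)
          have "d n u = (\<integral>\<^sup>+w. indicator {w \<in> space M. resp K Q (XN (n + 2) w) u \<noteq> resp K Q (Xs 1 w) u} w \<partial>M)"
            unfolding d_def by (intro nn_integral_cong) (simp add: indicator_def)
          also have "\<dots> = emeasure M {w \<in> space M. resp K Q (XN (n + 2) w) u \<noteq> resp K Q (Xs 1 w) u}"
            by (rule nn_integral_indicator) measurable
          finally show ?thesis by (simp only: emeasure_eq_measure)
        qed
        ultimately show "(\<lambda>n. d n u) \<longlonglongrightarrow> 0" by simp
      qed
    qed
  qed (auto simp: U.emeasure_space_1[simplified])
  then have "(\<lambda>n. \<integral>\<^sup>+u. d n u \<partial>U) \<longlonglongrightarrow> 0" by simp
  then have "(\<lambda>n. gap l (n + 2)) \<longlonglongrightarrow> 0"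
    by (rule tendsto_sandwich[OF _ _ tendsto_const, rotated 2]) (use le in \<open>auto intro!: always_eventually simp del: add_2_eq_Suc'\<close>)
  then show ?thesis by (rule LIMSEQ_offset)
qed

end

section \<open>Concentration of the joint frequencies\<close>

lemma max_indegree_ge:
  assumes "i \<in> {1..n}"
  shows "card {j \<in> {1..n}. nn n x j = i} \<le> max_indegree n x"
  unfolding max_indegree_def using assms by (intro Max_ge) auto

lemma max_indegree_le_iff:
  assumes "1 \<le> n"
  shows "real (max_indegree n x) \<le> a \<longleftrightarrow> (\<forall>i\<in>{1..n}. real (card {j \<in> {1..n}. nn n x j = i}) \<le> a)"
proof
  assume "real (max_indegree n x) \<le> a"
  then show "\<forall>i\<in>{1..n}. real (card {j \<in> {1..n}. nn n x j = i}) \<le> a"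
    using max_indegree_ge[of _ n x] by (meson of_nat_mono order_trans)
next
  assume *: "\<forall>i\<in>{1..n}. real (card {j \<in> {1..n}. nn n x j = i}) \<le> a"
  have "max_indegree n x \<in> (\<lambda>i. card {j \<in> {1..n}. nn n x j = i}) ` {1..n}"
    unfolding max_indegree_def using assms by (intro Max_in) auto
  with * show "real (max_indegree n x) \<le> a" by auto
qed

lemma pred_max_indegree:
  fixes X :: "nat \<Rightarrow> 's \<Rightarrow> 'h::{metric_space, second_countable_topology}"
  assumes X: "\<And>j. j \<in> {1..n} \<Longrightarrow> X j \<in> borel_measurable S" and n: "1 \<le> n"
  shows "Measurable.pred S (\<lambda>s. real (max_indegree n (\<lambda>j. X j s)) \<le> a)"
proof -
  have [measurable]: "(\<lambda>s. nn_in {1..n} (\<lambda>j. X j s) i) \<in> measurable S (count_space UNIV)" if "i \<in> {1..n}" for i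
    using X that by (rule measurable_nn_in)
  have eq: "real (card {j \<in> {1..n}. nn n (\<lambda>j. X j s) j = i}) = (\<Sum>j\<in>{1..n}. if nn_in {1..n} (\<lambda>j. X j s) j = i then 1 else 0)" for s i
    by (simp add: sum.If_cases Int_def nn_eq)
  show ?thesis
    unfolding max_indegree_le_iff[OF n] eq by measurable
qed

lemma nn_cong:
  assumes "\<And>j. j \<in> {1..n} \<Longrightarrow> x j = y j" "i \<in> {1..n}"
  shows "nn n x i = nn n y i"
  unfolding nn_eq using assms by (rule nn_in_cong)

section \<open>Events of vanishing probability\<close>

context prob_space
begin

text \<open>Markov's inequality. The offset \<open>m\<close> is there because the statistics are
  shown to be measurable from two sample points on.\<close>

lemma prob_tendsto_0_if_nn_integral:
  assumes meas: "\<And>n. m \<le> n \<Longrightarrow> f n \<in> borel_measurable M"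
    and lim: "(\<lambda>n. \<integral>\<^sup>+w. f n w \<partial>M) \<longlonglongrightarrow> 0" and e: "0 < e"
  shows "(\<lambda>n. prob {w \<in> space M. ennreal e \<le> f n w}) \<longlonglongrightarrow> 0"
proof -
  have le: "ennreal (prob {w \<in> space M. ennreal e \<le> f n w}) \<le> ennreal (1 / e) * (\<integral>\<^sup>+w. f n w \<partial>M)"
    if "m \<le> n" for n
  proof -
    have [measurable]: "f n \<in> borel_measurable M" using meas[OF that] .
    have "1 \<le> ennreal (1 / e) * y" if "ennreal e \<le> y" for y
    proof -
      have "ennreal (1 / e) * ennreal e = 1" using e by (simp flip: ennreal_mult)
      then show ?thesis using mult_left_mono[OF that, of "ennreal (1 / e)"] by simp
    qed
    then have "ennreal (prob {w \<in> space M. ennreal e \<le> f n w}) \<le> emeasure M {w \<in> space M. 1 \<le> ennreal (1 / e) * f n w}"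
      unfolding emeasure_eq_measure[symmetric] by (intro emeasure_mono) auto
    also have "\<dots> \<le> ennreal (1 / e) * (\<integral>\<^sup>+w. f n w * indicator (space M) w \<partial>M)"
      by (rule nn_integral_Markov_inequality) auto
    also have "(\<integral>\<^sup>+w. f n w * indicator (space M) w \<partial>M) = (\<integral>\<^sup>+w. f n w \<partial>M)"
      by (intro nn_integral_cong) simp
    finally show ?thesis .
  qed
  have "(\<lambda>n. ennreal (1 / e) * (\<integral>\<^sup>+w. f n w \<partial>M)) \<longlonglongrightarrow> ennreal (1 / e) * 0"
    by (intro ennreal_tendsto_cmult lim) auto
  then have "(\<lambda>n. ennreal (1 / e) * (\<integral>\<^sup>+w. f n w \<partial>M)) \<longlonglongrightarrow> 0" by simp
  then have "(\<lambda>n. ennreal (prob {w \<in> space M. ennreal e \<le> f n w})) \<longlonglongrightarrow> 0"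
    by (rule tendsto_sandwich[OF _ _ tendsto_const, rotated 2])
      (auto intro!: eventually_sequentiallyI[of m] le)
  then have "(\<lambda>n. ennreal (prob {w \<in> space M. ennreal e \<le> f n w})) \<longlonglongrightarrow> ennreal 0" by simp
  then show ?thesis by (subst (asm) tendsto_ennreal_iff) auto
qed

lemma prob_tendsto_0_mono:
  assumes "(\<lambda>n. prob (B n)) \<longlonglongrightarrow> 0" "\<And>n. m \<le> n \<Longrightarrow> A n \<subseteq> B n" "\<And>n. m \<le> n \<Longrightarrow> B n \<in> events"
  shows "(\<lambda>n. prob (A n)) \<longlonglongrightarrow> 0"
proof (rule tendsto_sandwich[OF _ _ tendsto_const assms(1)])
  show "\<forall>\<^sub>F n in sequentially. prob (A n) \<le> prob (B n)"
    using assms(2,3) by (intro eventually_sequentiallyI[of m] finite_measure_mono) auto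
qed auto

lemma prob_tendsto_0_Un:
  assumes "(\<lambda>n. prob (A n)) \<longlonglongrightarrow> 0" "(\<lambda>n. prob (B n)) \<longlonglongrightarrow> 0"
    and "\<And>n. m \<le> n \<Longrightarrow> A n \<in> events" "\<And>n. m \<le> n \<Longrightarrow> B n \<in> events"
  shows "(\<lambda>n. prob (A n \<union> B n)) \<longlonglongrightarrow> 0"
proof (rule tendsto_sandwich[OF _ _ tendsto_const])
  show "(\<lambda>n. prob (A n) + prob (B n)) \<longlonglongrightarrow> 0"
    using tendsto_add[OF assms(1,2)] by simp
  show "\<forall>\<^sub>F n in sequentially. prob (A n \<union> B n) \<le> prob (A n) + prob (B n)"
    using assms(3,4) by (intro eventually_sequentiallyI[of m] measure_Un_le) auto
qed auto

lemma prob_tendsto_0_UN: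
  assumes "finite I" "\<And>i. i \<in> I \<Longrightarrow> (\<lambda>n. prob (A i n)) \<longlonglongrightarrow> 0"
    and "\<And>i n. i \<in> I \<Longrightarrow> m \<le> n \<Longrightarrow> A i n \<in> events"
  shows "(\<lambda>n. prob (\<Union>i\<in>I. A i n)) \<longlonglongrightarrow> 0"
proof (rule tendsto_sandwich[OF _ _ tendsto_const])
  show "(\<lambda>n. \<Sum>i\<in>I. prob (A i n)) \<longlonglongrightarrow> 0"
    by (rule tendsto_null_sum) (rule assms(2))
  show "\<forall>\<^sub>F n in sequentially. prob (\<Union>i\<in>I. A i n) \<le> (\<Sum>i\<in>I. prob (A i n))"
    using assms(1,3) by (intro eventually_sequentiallyI[of m] finite_measure_subadditive_finite) auto
qed auto

lemma prob_tendsto_1: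
  assumes "(\<lambda>n. prob (B n)) \<longlonglongrightarrow> 0" "\<And>n. m \<le> n \<Longrightarrow> B n \<in> events"
    and "\<And>n. m \<le> n \<Longrightarrow> E n \<in> events" "\<And>n. m \<le> n \<Longrightarrow> space M - B n \<subseteq> E n"
  shows "(\<lambda>n. prob (E n)) \<longlonglongrightarrow> 1"
proof (rule tendsto_sandwich[OF _ _ _ tendsto_const])
  show "(\<lambda>n. 1 - prob (B n)) \<longlonglongrightarrow> 1"
    using tendsto_diff[OF tendsto_const assms(1), of 1] by simp
  show "\<forall>\<^sub>F n in sequentially. 1 - prob (B n) \<le> prob (E n)"
  proof (rule eventually_sequentiallyI)
    fix n assume n: "m \<le> n"
    show "1 - prob (B n) \<le> prob (E n)"
      using assms(2,3,4)[OF n] by (subst prob_compl[symmetric]) (auto intro: finite_measure_mono)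
  qed
qed auto

end

context nn_sample
begin

abbreviation "Ys i w \<equiv> resp K Q (Xs i w) (Us i w)"

text \<open>The mean of \<open>p_joint\<close> over the uniforms with the points \<open>x\<close>
  held fixed, for points in \<open>G\<close>: the levels at a point and at its neighbour are then
  independent, so their probabilities multiply.\<close>

definition cmean :: "nat \<Rightarrow> nat \<Rightarrow> nat \<Rightarrow> (nat \<Rightarrow> 'h) \<Rightarrow> real" where
  "cmean k l n x = (1 / real n) * (\<Sum>i=1..n. q k (x i) * q l (x (nn n x i)))"

lemma Us_meas': "i \<in> {1..n} \<Longrightarrow> Us i \<in> borel_measurable M"
  by (rule Us_meas) auto

lemma prob_resp_Us:
  assumes x: "x \<in> G" and k: "k \<in> {1..K}" and i: "1 \<le> i"
  shows "prob {w \<in> space M. resp K Q x (Us i w) = k} = q k x"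
proof -
  have U[measurable]: "Us i \<in> borel_measurable M" using i by (intro Us_meas) auto
  have "Measurable.pred borel (\<lambda>u. resp K Q x u = k)" by (rule pred_resp_eq) auto
  then have S: "{u. resp K Q x u = k} \<in> sets lborel" by (simp add: pred_def)
  have "emeasure M {w \<in> space M. resp K Q x (Us i w) = k} = emeasure (distr M lborel (Us i)) {u. resp K Q x u = k}"
    using S by (subst emeasure_distr) (auto intro!: arg_cong[where f = "emeasure M"])
  also have "\<dots> = ennreal (q k x)"
    unfolding Us_distr[OF i] U_def[symmetric] by (rule prob_resp[OF x k])
  finally show ?thesis using q_bounds[OF k, of x] by (simp add: emeasure_eq_measure)
qed

text \<open>With the points frozen the neighbour graph is fixed and the levels are independent, so
  \<open>second_moment_pairs\<close> applies with the maximal in-degree; the factor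
  \<open>1 / n\<close> of \<open>p_joint\<close> enters squared.\<close>

lemma conditional_second_moment:
  assumes n: "2 \<le> n" and x: "\<And>i. i \<in> {1..n} \<Longrightarrow> x i \<in> G" and k: "k \<in> {1..K}" and l: "l \<in> {1..K}"
  shows "(\<integral>\<^sup>+w. ennreal ((p_joint n x (\<lambda>i. resp K Q (x i) (Us i w)) k l - cmean k l n x)\<^sup>2) \<partial>M)
    \<le> ennreal ((2 + 2 * real (max_indegree n x)) / real n)"
proof -
  define T where "T i w = resp K Q (x i) (Us i w)" for i w
  let ?N = "nn n x"
  have N: "?N i \<in> {1..n} - {i}" if "i \<in> {1..n}" for i
    unfolding nn_eq using nn_in_range[OF n that] .
  have indep: "indep_vars (\<lambda>_. count_space UNIV) T {1..n}"
    unfolding T_def[abs_def]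
    by (rule indep_vars_compose2[OF indep_vars_subset[OF Us_indep]]) (auto intro!: resp_meas)
  have Tm: "T i \<in> measurable M (count_space UNIV)" if "i \<in> {1..n}" for i
    using indep that by (auto simp: indep_vars_def)
  have pT: "prob {w \<in> space M. T i w = k} = q k (x i)" if "i \<in> {1..n}" "k \<in> {1..K}" for i k
    using prob_resp_Us[OF x[OF that(1)] that(2), of i] that(1) by (simp add: T_def)
  define Z where "Z w = (\<Sum>i=1..n. of_bool (T i w = k \<and> T (?N i) w = l) -
      prob {w \<in> space M. T i w = k} * prob {w \<in> space M. T (?N i) w = l})" for w
  have EZ: "expectation (\<lambda>w. (Z w)\<^sup>2) \<le> real (card {1..n}) * (2 + 2 * real (max_indegree n x))"
    unfolding Z_def using N max_indegree_ge by (intro second_moment_pairs[OF indep]) auto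
  have eq: "p_joint n x (\<lambda>i. T i w) k l - cmean k l n x = (1 / real n) * Z w" for w
  proof -
    have "Z w = (\<Sum>i=1..n. of_bool (T i w = k \<and> T (?N i) w = l) - q k (x i) * q l (x (?N i)))"
      unfolding Z_def
    proof (intro sum.cong refl)
      fix i assume i: "i \<in> {1..n}"
      then have "?N i \<in> {1..n}" using N by blast
      from pT[OF i k] pT[OF this l]
      show "of_bool (T i w = k \<and> T (?N i) w = l) - prob {w \<in> space M. T i w = k} * prob {w \<in> space M. T (?N i) w = l} =
          (of_bool (T i w = k \<and> T (?N i) w = l) - q k (x i) * q l (x (?N i)) :: real)"
        by simp
    qed
    then show ?thesis
      by (simp add: p_joint_def cmean_def sum_subtractf diff_divide_distrib)
  qed
  have Zm: "Z \<in> borel_measurable M"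
  proof -
    have "(\<lambda>w. of_bool (T i w = k \<and> T (?N i) w = l) :: real) \<in> borel_measurable M" if "i \<in> {1..n}" for i
    proof -
      have "?N i \<in> {1..n}" using N[OF that] by blast
      then have [measurable]: "T (?N i) \<in> measurable M (count_space UNIV)" "T i \<in> measurable M (count_space UNIV)"
        using that Tm by blast+
      show ?thesis by measurable
    qed
    then show ?thesis unfolding Z_def[abs_def] by measurable
  qed
  have Zb: "\<bar>Z w\<bar> \<le> real n" for w
  proof -
    have "\<bar>Z w\<bar> \<le> (\<Sum>i=1..n. 1)"
      unfolding Z_def
    proof (rule order_trans[OF sum_abs sum_mono])
      fix i
      have "0 \<le> prob {w \<in> space M. T i w = k} * prob {w \<in> space M. T (?N i) w = l}"
        "prob {w \<in> space M. T i w = k} * prob {w \<in> space M. T (?N i) w = l} \<le> 1"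
        by (auto intro!: mult_le_one)
      then show "\<bar>of_bool (T i w = k \<and> T (?N i) w = l) -
          prob {w \<in> space M. T i w = k} * prob {w \<in> space M. T (?N i) w = l}\<bar> \<le> (1 :: real)"
        by auto
    qed
    then show ?thesis by simp
  qed
  have "(Z w)\<^sup>2 \<le> (real n)\<^sup>2" for w
    using power_mono[OF Zb[of w], of 2] by simp
  then have int: "integrable M (\<lambda>w. ((1 / real n) * Z w)\<^sup>2)"
    using Zm by (intro integrable_const_bound[where B = 1]) (auto simp: power_mult_distrib power_divide divide_simps)
  have "(\<integral>\<^sup>+w. ennreal ((p_joint n x (\<lambda>i. T i w) k l - cmean k l n x)\<^sup>2) \<partial>M) =
      ennreal (expectation (\<lambda>w. ((1 / real n) * Z w)\<^sup>2))"
    unfolding eq using int by (intro nn_integral_eq_integral) auto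
  also have "expectation (\<lambda>w. ((1 / real n) * Z w)\<^sup>2) = (1 / real n)\<^sup>2 * expectation (\<lambda>w. (Z w)\<^sup>2)"
    by (simp only: power_mult_distrib Bochner_Integration.integral_mult_right_zero)
  also have "\<dots> \<le> (1 / real n)\<^sup>2 * (real n * (2 + 2 * real (max_indegree n x)))"
    using EZ by (intro mult_left_mono) auto
  also have "\<dots> = (2 + 2 * real (max_indegree n x)) / real n"
    using n by (simp add: power2_eq_square field_simps)
  finally show ?thesis by (simp add: T_def ennreal_leI)
qed

lemma borel_measurable_cmean:
  assumes A: "\<And>j. j \<in> {1..n} \<Longrightarrow> A j \<in> borel_measurable S" and n: "2 \<le> n"
    and [measurable]: "k \<in> {1..K}" "l \<in> {1..K}"
  shows "(\<lambda>s. cmean k l n (\<lambda>j. A j s)) \<in> borel_measurable S"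
proof -
  have 1: "(\<lambda>s. q k (A i s)) \<in> borel_measurable S" if "i \<in> {1..n}" for i
    using A[OF that] q_meas[OF assms(3)] by (rule measurable_compose)
  have 2: "(\<lambda>s. q l (A (nn_in {1..n} (\<lambda>j. A j s) i) s)) \<in> borel_measurable S" if "i \<in> {1..n}" for i
    using borel_measurable_nn_point[OF A n that] q_meas[OF assms(4)] by (rule measurable_compose)
  show ?thesis
    unfolding cmean_def nn_eq using 1 2 by (intro borel_measurable_times borel_measurable_const borel_measurable_sum)
qed

text \<open>On this event the variance bound is a deterministic sequence of order
  \<open>n powr (- 3/4)\<close>, which can be integrated although the degree condition is one in
  probability.\<close>

definition low :: "nat \<Rightarrow> (nat \<Rightarrow> 'h) \<Rightarrow> bool" where
  "low n x \<longleftrightarrow> real (max_indegree n x) \<le> real n powr (1/4)"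

lemma truncated_second_moment:
  assumes n: "2 \<le> n" and k: "k \<in> {1..K}" and l: "l \<in> {1..K}"
  shows "(\<integral>\<^sup>+w. ennreal (of_bool (low n (\<lambda>i. Xs i w)) *
      (p_joint n (\<lambda>i. Xs i w) (\<lambda>i. Ys i w) k l - cmean k l n (\<lambda>i. Xs i w))\<^sup>2) \<partial>M)
    \<le> ennreal ((2 + 2 * real n powr (1/4)) / real n)"
proof -
  let ?S = "PiM {1..} (\<lambda>_. borel :: 'h measure)" and ?T = "PiM {1..} (\<lambda>_. borel :: real measure)"
  define h where "h = (\<lambda>z :: (nat \<Rightarrow> 'h) \<times> (nat \<Rightarrow> real). ennreal (of_bool (low n (fst z)) *
    (p_joint n (fst z) (\<lambda>i. resp K Q (fst z i) (snd z i)) k l - cmean k l n (fst z))\<^sup>2))"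
  let ?A = "\<lambda>w. \<lambda>i\<in>{1..}. Xs i w" and ?B = "\<lambda>w. \<lambda>i\<in>{1..}. Us i w"
  have c1: "(\<lambda>z. fst z j) \<in> borel_measurable (?S \<Otimes>\<^sub>M ?T)" if "j \<in> {1..n}" for j
    using that by (intro measurable_compose[OF measurable_fst measurable_component_singleton]) auto
  have c2: "(\<lambda>z. snd z j) \<in> borel_measurable (?S \<Otimes>\<^sub>M ?T)" if "j \<in> {1..n}" for j
    using that by (intro measurable_compose[OF measurable_snd measurable_component_singleton]) auto
  have h: "h \<in> borel_measurable (?S \<Otimes>\<^sub>M ?T)"
  proof -
    have "Measurable.pred (?S \<Otimes>\<^sub>M ?T) (\<lambda>z. low n (fst z))"
      unfolding low_def by (rule pred_max_indegree[where X = "\<lambda>j z. fst z j", OF c1]) (use n in auto)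
    then have lw: "(\<lambda>z. of_bool (low n (fst z)) :: real) \<in> borel_measurable (?S \<Otimes>\<^sub>M ?T)"
      unfolding of_bool_def by (intro measurable_If borel_measurable_const) (simp_all only: pred_def)
    have pj: "(\<lambda>z. p_joint n (fst z) (\<lambda>i. resp K Q (fst z i) (snd z i)) k l) \<in> borel_measurable (?S \<Otimes>\<^sub>M ?T)"
      by (rule measurable_p_joint[where X = "\<lambda>j z. fst z j" and Y = "\<lambda>i z. resp K Q (fst z i) (snd z i)",
          OF c1 resp_meas[OF c1 c2] n])
    have cm: "(\<lambda>z. cmean k l n (fst z)) \<in> borel_measurable (?S \<Otimes>\<^sub>M ?T)"
      by (rule borel_measurable_cmean[where A = "\<lambda>j z. fst z j", OF c1 n k l])
    show ?thesis
      unfolding h_def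
      by (intro measurable_compose[OF _ measurable_ennreal] borel_measurable_times borel_measurable_power
          borel_measurable_diff lw pj cm)
  qed
  \<comment> \<open>\<open>h\<close> reads the restricted sequences only at the indices
    \<open>1, ..., n\<close>, where they agree with the samples. The points come from
    \<open>w\<close> and the uniforms from \<open>w'\<close>.\<close>
  have cong: "h (?A w, ?B w') = ennreal (of_bool (low n (\<lambda>i. Xs i w)) *
      (p_joint n (\<lambda>i. Xs i w) (\<lambda>i. resp K Q (Xs i w) (Us i w')) k l - cmean k l n (\<lambda>i. Xs i w))\<^sup>2)" for w w'
  proof -
    have N: "nn n (?A w) i = nn n (\<lambda>i. Xs i w) i" if "i \<in> {1..n}" for i
      using that by (intro nn_cong) auto
    have "p_joint n (?A w) (\<lambda>i. resp K Q (?A w i) (?B w' i)) = p_joint n (\<lambda>i. Xs i w) (\<lambda>i. resp K Q (Xs i w) (Us i w'))"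
      using N by (intro p_joint_cong n) auto
    moreover have "cmean k l n (?A w) = cmean k l n (\<lambda>i. Xs i w)"
      unfolding cmean_def using N nn_in_range[OF n, of _ "\<lambda>i. Xs i w"]
      by (intro arg_cong[where f = "\<lambda>t. 1 / real n * t"] sum.cong refl) (auto simp: nn_eq)
    moreover have "{j \<in> {1..n}. nn n (?A w) j = i} = {j \<in> {1..n}. nn n (\<lambda>i. Xs i w) j = i}" for i
      using N by auto
    then have "max_indegree n (?A w) = max_indegree n (\<lambda>i. Xs i w)"
      by (simp add: max_indegree_def)
    ultimately show ?thesis by (simp add: h_def low_def)
  qed
  have "(\<integral>\<^sup>+w. h (?A w, ?B w) \<partial>M) = (\<integral>\<^sup>+w. \<integral>\<^sup>+w'. h (?A w, ?B w') \<partial>M \<partial>M)"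
    by (rule nn_integral_indep_rv[OF XU_indep h])
  also have "\<dots> \<le> (\<integral>\<^sup>+w. ennreal ((2 + 2 * real n powr (1/4)) / real n) \<partial>M)"
  proof (rule nn_integral_mono_AE)
    show "AE w in M. (\<integral>\<^sup>+w'. h (?A w, ?B w') \<partial>M) \<le> ennreal ((2 + 2 * real n powr (1/4)) / real n)"
      using AE_Xs_G
    proof eventually_elim
      case (elim w)
      show ?case
      proof (cases "low n (\<lambda>i. Xs i w)")
        case True
        have "(\<integral>\<^sup>+w'. h (?A w, ?B w') \<partial>M) \<le> ennreal ((2 + 2 * real (max_indegree n (\<lambda>i. Xs i w))) / real n)"
          unfolding cong using True elim conditional_second_moment[OF n _ k l, of "\<lambda>i. Xs i w"] by simp
        also have "\<dots> \<le> ennreal ((2 + 2 * real n powr (1/4)) / real n)"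
          using True by (intro ennreal_leI divide_right_mono) (auto simp: low_def)
        finally show ?thesis .
      next
        case False
        then show ?thesis unfolding cong by simp
      qed
    qed
  qed
  finally show ?thesis unfolding cong by (simp add: emeasure_space_1)
qed

text \<open>
  The relabelling \<open>\<tau>\<close> is increasing off the point \<open>1\<close>, so it respects the tie-breaking by smallest index.
\<close>

lemma point_exchange:
  assumes n: "2 \<le> n" and i: "i \<in> {1..n}" and l: "l \<in> {1..K}"
  shows "(\<integral>\<^sup>+w. ennreal \<bar>q l (Xs (nn n (\<lambda>j. Xs j w) i) w) - q l (Xs i w)\<bar> \<partial>M) = gap l n"
proof -
  \<comment> \<open>The cycle that sends \<open>1\<close> to \<open>i\<close> and shifts
    \<open>2, ..., i\<close> down by one; all larger indices stay.\<close>
  define \<tau> where "\<tau> j = (if j = 1 then i else if j \<le> i then j - 1 else j)" for j :: nat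
  let ?P = "PiM {1..n} (\<lambda>_. borel :: 'h measure)"
  define h where "h x = ennreal \<bar>q l (x (nn_in {1..n} x 1)) - q l (x 1)\<bar>" for x :: "nat \<Rightarrow> 'h"
  have one: "1 \<in> {1..n}" using n by auto
  have h[measurable]: "h \<in> borel_measurable ?P"
  proof -
    have [measurable]: "(\<lambda>x. x (nn_in {1..n} x 1)) \<in> borel_measurable ?P"
      using borel_measurable_nn_point[of n "\<lambda>j x. x j" ?P 1] one n by simp
    have [measurable]: "(\<lambda>x. x 1) \<in> borel_measurable ?P" using one by measurable
    show ?thesis unfolding h_def using l by measurable
  qed
  have \<tau>_range: "\<tau> ` {1..n} = {1..n}"
  proof (intro equalityI subsetI)
    fix j assume j: "j \<in> {1..n}"
    consider "j = i" | "j < i" | "i < j" by linarith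
    then show "j \<in> \<tau> ` {1..n}"
    proof cases
      case 1 then show ?thesis using one by (intro image_eqI[of _ _ 1]) (auto simp: \<tau>_def)
    next
      case 2 then show ?thesis using j i by (intro image_eqI[of _ _ "Suc j"]) (auto simp: \<tau>_def)
    next
      case 3 then show ?thesis using j i by (intro image_eqI[of _ _ j]) (auto simp: \<tau>_def)
    qed
  qed (use i in \<open>auto simp: \<tau>_def split: if_splits\<close>)
  then have inj: "inj_on \<tau> {1..n}"
    by (intro eq_card_imp_inj_on) auto
  have mono: "strict_mono_on ({1..n} - {1}) \<tau>"
    by (auto simp: strict_mono_on_def \<tau>_def)
  have \<tau>1: "\<tau> 1 = i" by (simp add: \<tau>_def)
  have nn_\<tau>: "nn n x i = \<tau> (nn_in {1..n} (x \<circ> \<tau>) 1)" for x :: "nat \<Rightarrow> 'h"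
  proof -
    have "2 \<in> {1..n} - {1}" using n by auto
    then have "{1..n} - {1} \<noteq> {}" by blast
    moreover have "\<tau> 1 \<notin> \<tau> ` ({1..n} - {1})" using inj one by (auto dest: inj_onD)
    ultimately have "nn_in (\<tau> ` {1..n}) x (\<tau> 1) = \<tau> (nn_in {1..n} (x \<circ> \<tau>) 1)"
      using mono by (intro nn_in_reindex) auto
    then show ?thesis unfolding \<tau>_range \<tau>1 nn_eq .
  qed
  have hcong: "h (\<lambda>j\<in>{1..n}. x j) = h x" for x
  proof -
    have "nn_in {1..n} (\<lambda>j\<in>{1..n}. x j) 1 = nn_in {1..n} x 1"
      using one by (intro nn_in_cong) auto
    then show ?thesis using nn_in_range[OF n one, of x] one by (auto simp: h_def)
  qed
  have int: "(\<integral>\<^sup>+w. h (\<lambda>j. Xs (\<sigma> j) w) \<partial>M) = (\<integral>\<^sup>+x. h x \<partial>PiM {1..n} (\<lambda>_. distr M borel X))"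
    if \<sigma>: "inj_on \<sigma> {1..n}" "\<sigma> ` {1..n} \<subseteq> {1..}" for \<sigma>
  proof -
    have rest: "(\<lambda>w. \<lambda>j\<in>{1..n}. Xs (\<sigma> j) w) \<in> measurable M ?P"
      using \<sigma>(2) by (intro measurable_restrict Xs_meas) blast
    show ?thesis
      unfolding Xs_law[OF \<sigma>, symmetric]
      using h by (subst nn_integral_distr[OF rest]) (simp_all only: measurable_distr_eq1 hcong)
  qed
  have "(\<integral>\<^sup>+w. ennreal \<bar>q l (Xs (nn n (\<lambda>j. Xs j w) i) w) - q l (Xs i w)\<bar> \<partial>M) = (\<integral>\<^sup>+w. h (\<lambda>j. Xs (\<tau> j) w) \<partial>M)"
    by (simp only: h_def nn_\<tau> \<tau>1 o_def)
  also have "\<dots> = (\<integral>\<^sup>+w. h (\<lambda>j. Xs j w) \<partial>M)"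
    using int[OF inj] int[of "\<lambda>j. j"] \<tau>_range by auto
  also have "\<dots> = gap l n"
    by (simp add: h_def gap_def XN_def)
  finally show ?thesis .
qed

text \<open>\<open>cmean\<close> with each neighbour replaced by the point itself, which makes it an
  average of i.i.d. terms with mean \<open>c k l\<close>.\<close>

definition hmean :: "nat \<Rightarrow> nat \<Rightarrow> nat \<Rightarrow> 'w \<Rightarrow> real" where
  "hmean k l n w = (1 / real n) * (\<Sum>i=1..n. q k (Xs i w) * q l (Xs i w))"

lemma q_Xs_meas: "i \<in> {1..n} \<Longrightarrow> k \<in> {1..K} \<Longrightarrow> (\<lambda>w. q k (Xs i w)) \<in> borel_measurable M"
  by (rule measurable_compose[OF Xs_meas' q_meas])

lemma hmean_meas: "k \<in> {1..K} \<Longrightarrow> l \<in> {1..K} \<Longrightarrow> hmean k l n \<in> borel_measurable M"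
  unfolding hmean_def[abs_def]
  by (intro borel_measurable_times borel_measurable_const borel_measurable_sum q_Xs_meas)

lemma cmean_hmean:
  assumes k: "k \<in> {1..K}"
  shows "\<bar>cmean k l n (\<lambda>i. Xs i w) - hmean k l n w\<bar> \<le>
    (1 / real n) * (\<Sum>i=1..n. \<bar>q l (Xs (nn n (\<lambda>j. Xs j w) i) w) - q l (Xs i w)\<bar>)"
proof -
  define d where "d i = q l (Xs (nn n (\<lambda>j. Xs j w) i) w) - q l (Xs i w)" for i
  have "cmean k l n (\<lambda>i. Xs i w) - hmean k l n w = (1 / real n) * (\<Sum>i=1..n. q k (Xs i w) * d i)"
    unfolding d_def
    by (simp add: cmean_def hmean_def right_diff_distrib sum_subtractf diff_divide_distrib)
  also have "\<bar>\<dots>\<bar> = (1 / real n) * \<bar>\<Sum>i=1..n. q k (Xs i w) * d i\<bar>"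
    unfolding d_def abs_mult by simp
  also have "\<dots> \<le> (1 / real n) * (\<Sum>i=1..n. \<bar>d i\<bar>)"
  proof (rule mult_left_mono)
    have "\<bar>\<Sum>i=1..n. q k (Xs i w) * d i\<bar> \<le> (\<Sum>i=1..n. \<bar>q k (Xs i w) * d i\<bar>)"
      by (rule sum_abs)
    also have "\<dots> \<le> (\<Sum>i=1..n. \<bar>d i\<bar>)"
    proof (rule sum_mono)
      fix i
      have "\<bar>q k (Xs i w)\<bar> \<le> 1"
        using q_bounds[OF k, of "Xs i w"] by linarith
      from mult_right_mono[OF this abs_ge_zero[of "d i"]]
      show "\<bar>q k (Xs i w) * d i\<bar> \<le> \<bar>d i\<bar>" by (simp add: abs_mult)
    qed
    finally show "\<bar>\<Sum>i=1..n. q k (Xs i w) * d i\<bar> \<le> (\<Sum>i=1..n. \<bar>d i\<bar>)" .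
  qed simp
  finally show ?thesis unfolding d_def .
qed

text \<open>The difference is an average of changes of \<open>q l\<close> towards the neighbour,
  with weights \<open>q k\<close> between \<open>0\<close> and \<open>1\<close>. By
  \<open>point_exchange\<close> every index contributes \<open>gap l n\<close> in the mean.\<close>

lemma cmean_hmean_gap:
  assumes n: "2 \<le> n" and k: "k \<in> {1..K}" and l: "l \<in> {1..K}"
  shows "(\<integral>\<^sup>+w. ennreal \<bar>cmean k l n (\<lambda>i. Xs i w) - hmean k l n w\<bar> \<partial>M) \<le> gap l n"
proof -
  let ?d = "\<lambda>i w. \<bar>q l (Xs (nn n (\<lambda>j. Xs j w) i) w) - q l (Xs i w)\<bar>"
  have d: "?d i \<in> borel_measurable M" if "i \<in> {1..n}" for i
    unfolding nn_eq using that
    by (intro borel_measurable_abs borel_measurable_diff q_Xs_meas l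
        measurable_compose[OF borel_measurable_nn_point[OF Xs_meas' n] q_meas])
  have "(\<integral>\<^sup>+w. ennreal \<bar>cmean k l n (\<lambda>i. Xs i w) - hmean k l n w\<bar> \<partial>M) \<le>
      (\<integral>\<^sup>+w. ennreal (1 / real n) * (\<Sum>i=1..n. ennreal (?d i w)) \<partial>M)"
  proof (rule nn_integral_mono)
    fix w
    have "ennreal \<bar>cmean k l n (\<lambda>i. Xs i w) - hmean k l n w\<bar> \<le> ennreal ((1 / real n) * (\<Sum>i=1..n. ?d i w))"
      by (rule ennreal_leI[OF cmean_hmean[OF k]])
    also have "\<dots> = ennreal (1 / real n) * (\<Sum>i=1..n. ennreal (?d i w))"
      by (subst ennreal_mult) (auto intro!: sum_nonneg arg_cong[where f = "\<lambda>t. _ * t"] sum_ennreal[symmetric])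
    finally show "ennreal \<bar>cmean k l n (\<lambda>i. Xs i w) - hmean k l n w\<bar> \<le> ennreal (1 / real n) * (\<Sum>i=1..n. ennreal (?d i w))" .
  qed
  also have "\<dots> = ennreal (1 / real n) * (\<Sum>i=1..n. \<integral>\<^sup>+w. ennreal (?d i w) \<partial>M)"
  proof -
    have "(\<integral>\<^sup>+w. ennreal (1 / real n) * (\<Sum>i=1..n. ennreal (?d i w)) \<partial>M) =
        ennreal (1 / real n) * (\<integral>\<^sup>+w. (\<Sum>i=1..n. ennreal (?d i w)) \<partial>M)"
      by (intro nn_integral_cmult borel_measurable_sum measurable_compose[OF d measurable_ennreal])
    also have "(\<integral>\<^sup>+w. (\<Sum>i=1..n. ennreal (?d i w)) \<partial>M) = (\<Sum>i=1..n. \<integral>\<^sup>+w. ennreal (?d i w) \<partial>M)"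
      by (intro nn_integral_sum measurable_compose[OF d measurable_ennreal])
    finally show ?thesis .
  qed
  also have "\<dots> = ennreal (1 / real n) * (of_nat n * gap l n)"
    using point_exchange[OF n _ l] by simp
  also have "\<dots> = gap l n"
    using n by (simp add: mult.assoc[symmetric] ennreal_of_nat_eq_real_of_nat flip: ennreal_mult)
  finally show ?thesis .
qed

text \<open>A weak law of large numbers: distinct terms are independent and centred, so only the
  \<open>n\<close> diagonal pairs remain.\<close>

lemma hmean_second_moment:
  assumes n: "1 \<le> n" and k: "k \<in> {1..K}" and l: "l \<in> {1..K}"
  shows "(\<integral>\<^sup>+w. ennreal ((hmean k l n w - c k l)\<^sup>2) \<partial>M) \<le> ennreal (1 / real n)"
proof -
  define g where "g x = q k x * q l x - c k l" for x
  have gm: "g \<in> borel_measurable borel"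
    unfolding g_def[abs_def] using k l by measurable
  have c_bounds: "0 \<le> c k l" "c k l \<le> 1"
  proof -
    show "0 \<le> c k l" unfolding c_def using qq_bound[OF k l] by (intro Bochner_Integration.integral_nonneg) auto
    have "c k l \<le> (\<integral>w. 1 \<partial>M)"
      unfolding c_def using qq_bound[OF k l] by (intro integral_mono integrable_qq k l) auto
    then show "c k l \<le> 1" by (simp add: prob_space)
  qed
  have gb: "\<bar>g x\<bar> \<le> 1" for x
    using qq_bound[OF k l, of x x] c_bounds by (auto simp: g_def abs_le_iff)
  have gX: "(\<lambda>w. g (Xs i w)) \<in> borel_measurable M" if "i \<in> {1..n}" for i
    by (rule measurable_compose[OF Xs_meas'[OF that] gm])
  have Eg: "expectation (\<lambda>w. g (Xs i w)) = 0" if i: "i \<in> {1..n}" for i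
  proof -
    have "expectation (\<lambda>w. g (Xs i w)) = (\<integral>x. g x \<partial>distr M borel (Xs i))"
      using Xs_meas'[OF i] gm by (subst integral_distr) auto
    also have "\<dots> = expectation (\<lambda>w. g (X w))"
      using i gm by (subst Xs_distr) (auto simp: integral_distr)
    also have "\<dots> = 0"
      unfolding g_def using integrable_qq[OF k l] by (simp add: c_def prob_space)
    finally show ?thesis .
  qed
  have S: "expectation (\<lambda>w. (\<Sum>i\<in>{1..n}. g (Xs i w))\<^sup>2) \<le> real (card (Id \<inter> {1..n} \<times> {1..n}))"
  proof (rule second_moment_sum[OF _ gX gb])
    fix i j assume ij: "i \<in> {1..n}" "j \<in> {1..n}" "(i, j) \<notin> Id"
    have ind: "indep_var (PiM {i} (\<lambda>_. borel)) (\<lambda>w. restrict (\<lambda>i. Xs i w) {i})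
        (PiM {j} (\<lambda>_. borel)) (\<lambda>w. restrict (\<lambda>i. Xs i w) {j})"
      using ij by (intro indep_var_restrict[OF Xs_indep]) auto
    have F: "(\<lambda>f. g (f i)) \<in> borel_measurable (PiM {i} (\<lambda>_. borel))" for i :: nat
      by (intro measurable_compose[OF _ gm] measurable_component_singleton) auto
    have "indep_var borel ((\<lambda>f. g (f i)) \<circ> (\<lambda>w. restrict (\<lambda>i. Xs i w) {i}))
        borel ((\<lambda>f. g (f j)) \<circ> (\<lambda>w. restrict (\<lambda>i. Xs i w) {j}))"
      by (rule indep_var_compose[OF ind F F])
    then have "indep_var borel (\<lambda>w. g (Xs i w)) borel (\<lambda>w. g (Xs j w))"
      by (simp add: o_def)
    moreover have "integrable M (\<lambda>w. g (Xs i w))" if "i \<in> {1..n}" for i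
      using gX[OF that] gb by (intro integrable_bounded_1)
    ultimately show "expectation (\<lambda>w. g (Xs i w) * g (Xs j w)) = 0"
      using ij Eg by (subst indep_var_lebesgue_integral) auto
  qed auto
  have "Id \<inter> {1..n} \<times> {1..n} = (\<lambda>i. (i, i)) ` {1..n}" by auto
  then have cd: "card (Id \<inter> {1..n} \<times> {1..n}) = n"
    by (simp add: card_image inj_on_def)
  have eq: "hmean k l n w - c k l = (1 / real n) * (\<Sum>i\<in>{1..n}. g (Xs i w))" for w
    using n by (simp add: hmean_def g_def sum_subtractf diff_divide_distrib)
  have b: "\<bar>hmean k l n w - c k l\<bar> \<le> 1" for w
  proof -
    have "\<bar>\<Sum>i\<in>{1..n}. g (Xs i w)\<bar> \<le> (\<Sum>i\<in>{1..n}. 1)"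
      using gb by (intro order_trans[OF sum_abs sum_mono])
    then show ?thesis unfolding eq using n by (simp add: abs_mult divide_simps)
  qed
  have "integrable M (\<lambda>w. (hmean k l n w - c k l)\<^sup>2)"
    using b hmean_meas[OF k l, of n]
    by (intro integrable_bounded_1 borel_measurable_power borel_measurable_diff borel_measurable_const)
      (auto simp: abs_square_le_1)
  then have "(\<integral>\<^sup>+w. ennreal ((hmean k l n w - c k l)\<^sup>2) \<partial>M) = ennreal (expectation (\<lambda>w. (hmean k l n w - c k l)\<^sup>2))"
    by (intro nn_integral_eq_integral) auto
  also have "expectation (\<lambda>w. (hmean k l n w - c k l)\<^sup>2) = (1 / real n)\<^sup>2 * expectation (\<lambda>w. (\<Sum>i\<in>{1..n}. g (Xs i w))\<^sup>2)"
    by (simp only: eq power_mult_distrib Bochner_Integration.integral_mult_right_zero)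
  also have "\<dots> \<le> (1 / real n)\<^sup>2 * real n"
    using S unfolding cd by (intro mult_left_mono) auto
  also have "\<dots> = 1 / real n" using n by (simp add: power2_eq_square)
  finally show ?thesis by (simp add: ennreal_leI)
qed

lemma Ys_meas: "i \<in> {1..n} \<Longrightarrow> (\<lambda>w. Ys i w) \<in> measurable M (count_space UNIV)"
  by (intro resp_meas Xs_meas' Us_meas')

lemma p_joint_meas:
  assumes "2 \<le> n"
  shows "(\<lambda>w. p_joint n (\<lambda>i. Xs i w) (\<lambda>i. Ys i w) k l) \<in> borel_measurable M"
  by (rule measurable_p_joint[OF Xs_meas' Ys_meas assms])

text \<open>Three errors are separated, each with a third of the tolerance: the randomness of the
  levels given the points (\<open>B\<close>), the move from the neighbour to the point itself
  (\<open>C\<close>) and the average over the points (\<open>D\<close>). The event \<open>A\<close>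
  of a large in-degree is set aside.\<close>

lemma p_joint_tendsto:
  assumes k: "k \<in> {1..K}" and l: "l \<in> {1..K}" and gap: "gap l \<longlonglongrightarrow> 0"
    and deg: "small_o_prob M (\<lambda>n w. real (max_indegree n (\<lambda>i. Xs i w))) (\<lambda>n. real n powr (1/4))"
    and e: "0 < e"
  shows "(\<lambda>n. prob {w \<in> space M. e < \<bar>p_joint n (\<lambda>i. Xs i w) (\<lambda>i. Ys i w) k l - c k l\<bar>}) \<longlonglongrightarrow> 0"
proof -
  define \<delta> where "\<delta> = e / 3"
  have \<delta>: "0 < \<delta>" using e by (simp add: \<delta>_def)
  let ?p = "\<lambda>n w. p_joint n (\<lambda>i. Xs i w) (\<lambda>i. Ys i w) k l" and ?m = "\<lambda>n w. cmean k l n (\<lambda>i. Xs i w)"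
  define fB where "fB n w = ennreal (of_bool (low n (\<lambda>i. Xs i w)) * (?p n w - ?m n w)\<^sup>2)" for n w
  define fC where "fC n w = ennreal \<bar>?m n w - hmean k l n w\<bar>" for n w
  define fD where "fD n w = ennreal ((hmean k l n w - c k l)\<^sup>2)" for n w
  define A where "A n = {w \<in> space M. \<not> low n (\<lambda>i. Xs i w)}" for n
  define B where "B n = {w \<in> space M. ennreal (\<delta>\<^sup>2) \<le> fB n w}" for n
  define C where "C n = {w \<in> space M. ennreal \<delta> \<le> fC n w}" for n
  define D where "D n = {w \<in> space M. ennreal (\<delta>\<^sup>2) \<le> fD n w}" for n
  have lowm: "Measurable.pred M (\<lambda>w. low n (\<lambda>i. Xs i w))" if "2 \<le> n" for n
    unfolding low_def using that by (intro pred_max_indegree Xs_meas') auto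
  have mm: "?m n \<in> borel_measurable M" if "2 \<le> n" for n
    by (rule borel_measurable_cmean[OF Xs_meas' that k l])
  have fB: "fB n \<in> borel_measurable M" if "2 \<le> n" for n
  proof -
    have "(\<lambda>w. of_bool (low n (\<lambda>i. Xs i w)) :: real) \<in> borel_measurable M"
      unfolding of_bool_def using lowm[OF that] by (intro measurable_If borel_measurable_const) (simp_all only: pred_def)
    then show ?thesis
      unfolding fB_def[abs_def]
      by (intro measurable_compose[OF _ measurable_ennreal] borel_measurable_times borel_measurable_power
          borel_measurable_diff p_joint_meas mm that)
  qed
  have fC: "fC n \<in> borel_measurable M" if "2 \<le> n" for n
    unfolding fC_def[abs_def]
    by (intro measurable_compose[OF _ measurable_ennreal] borel_measurable_abs borel_measurable_diff mm that hmean_meas k l)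
  have fD: "fD n \<in> borel_measurable M" for n
    unfolding fD_def[abs_def]
    by (intro measurable_compose[OF _ measurable_ennreal] borel_measurable_power borel_measurable_diff
        borel_measurable_const hmean_meas k l)
  have A_ev: "A n \<in> events" if "2 \<le> n" for n
    using lowm[OF that] unfolding A_def by measurable
  have B_ev: "B n \<in> events" if "2 \<le> n" for n
    using fB[OF that] unfolding B_def by measurable
  have C_ev: "C n \<in> events" if "2 \<le> n" for n
    using fC[OF that] unfolding C_def by measurable
  have D_ev: "D n \<in> events" for n
    using fD[of n] unfolding D_def by measurable
  have A0: "(\<lambda>n. prob (A n)) \<longlonglongrightarrow> 0"
  proof -
    have "(\<lambda>n. prob {w \<in> space M. dist (real (max_indegree n (\<lambda>i. Xs i w)) / real n powr (1/4)) 0 > 1}) \<longlonglongrightarrow> 0"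
      using deg unfolding small_o_prob_def tendsto_in_prob_def by (rule allE[of _ 1]) simp
    moreover have "\<forall>\<^sub>F n in sequentially. prob {w \<in> space M. dist (real (max_indegree n (\<lambda>i. Xs i w)) / real n powr (1/4)) 0 > 1} = prob (A n)"
      using eventually_ge_at_top[of 1]
    proof eventually_elim
      case (elim n)
      then have "0 < real n powr (1/4)" by simp
      then show ?case by (simp add: A_def low_def not_le less_divide_eq)
    qed
    ultimately show ?thesis by (rule Lim_transform_eventually)
  qed
  have B0: "(\<lambda>n. prob (B n)) \<longlonglongrightarrow> 0"
    unfolding B_def
  proof (rule prob_tendsto_0_if_nn_integral[OF fB])
    have "(\<lambda>n. 2 * inverse (real n) + 2 * real n powr - (3/4)) \<longlonglongrightarrow> 2 * 0 + 2 * 0"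
      by (intro tendsto_intros lim_inverse_n tendsto_neg_powr filterlim_real_sequentially) auto
    moreover have "\<forall>\<^sub>F n in sequentially. 2 * inverse (real n) + 2 * real n powr - (3/4) = (2 + 2 * real n powr (1/4)) / real n"
      using eventually_ge_at_top[of 1]
    proof eventually_elim
      case (elim n)
      then have "real n powr - (3/4) = real n powr (1/4) / real n powr 1"
        by (subst powr_diff[symmetric]) simp
      with elim show ?case by (simp add: field_simps)
    qed
    ultimately have "(\<lambda>n. (2 + 2 * real n powr (1/4)) / real n) \<longlonglongrightarrow> 2 * 0 + 2 * 0"
      by (rule Lim_transform_eventually)
    from tendsto_ennrealI[OF this]
    have lim: "(\<lambda>n. ennreal ((2 + 2 * real n powr (1/4)) / real n)) \<longlonglongrightarrow> 0"
      by (simp only: mult_zero_right add_0 ennreal_0)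
    have ev: "\<forall>\<^sub>F n in sequentially. integral\<^sup>N M (fB n) \<le> ennreal ((2 + 2 * real n powr (1/4)) / real n)"
      unfolding fB_def[abs_def] using truncated_second_moment[OF _ k l] by (rule eventually_sequentiallyI)
    show "(\<lambda>n. integral\<^sup>N M (fB n)) \<longlonglongrightarrow> 0"
      by (rule tendsto_sandwich[OF _ ev tendsto_const lim]) simp
  qed (use \<delta> in auto)
  have C0: "(\<lambda>n. prob (C n)) \<longlonglongrightarrow> 0"
    unfolding C_def
  proof (rule prob_tendsto_0_if_nn_integral[OF fC])
    have ev: "\<forall>\<^sub>F n in sequentially. integral\<^sup>N M (fC n) \<le> gap l n"
      unfolding fC_def[abs_def] using cmean_hmean_gap[OF _ k l] by (rule eventually_sequentiallyI)
    show "(\<lambda>n. integral\<^sup>N M (fC n)) \<longlonglongrightarrow> 0"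
      by (rule tendsto_sandwich[OF _ ev tendsto_const gap]) simp
  qed (use \<delta> in auto)
  have D0: "(\<lambda>n. prob (D n)) \<longlonglongrightarrow> 0"
    unfolding D_def
  proof (rule prob_tendsto_0_if_nn_integral[OF fD])
    have "(\<lambda>n. ennreal (1 / real n)) \<longlonglongrightarrow> ennreal 0"
      using lim_1_over_n by (intro tendsto_ennrealI)
    then have lim: "(\<lambda>n. ennreal (1 / real n)) \<longlonglongrightarrow> 0" by simp
    have ev: "\<forall>\<^sub>F n in sequentially. integral\<^sup>N M (fD n) \<le> ennreal (1 / real n)"
      unfolding fD_def[abs_def] using hmean_second_moment[OF _ k l] by (rule eventually_sequentiallyI)
    show "(\<lambda>n. integral\<^sup>N M (fD n)) \<longlonglongrightarrow> 0"
      by (rule tendsto_sandwich[OF _ ev tendsto_const lim]) simp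
  qed (use \<delta> in auto)
  have "(\<lambda>n. prob (A n \<union> B n \<union> (C n \<union> D n))) \<longlonglongrightarrow> 0"
  proof (rule prob_tendsto_0_Un[of _ _ 2])
    show "(\<lambda>n. prob (A n \<union> B n)) \<longlonglongrightarrow> 0"
      by (rule prob_tendsto_0_Un[OF A0 B0 A_ev B_ev])
    show "(\<lambda>n. prob (C n \<union> D n)) \<longlonglongrightarrow> 0"
      by (rule prob_tendsto_0_Un[OF C0 D0 C_ev D_ev])
  qed (intro sets.Un A_ev B_ev C_ev D_ev; assumption)+
  then show ?thesis
  proof (rule prob_tendsto_0_mono[of _ 2])
    fix n :: nat assume n: "2 \<le> n"
    show "A n \<union> B n \<union> (C n \<union> D n) \<in> events"
      by (intro sets.Un A_ev B_ev C_ev D_ev n)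
    show "{w \<in> space M. e < \<bar>?p n w - c k l\<bar>} \<subseteq> A n \<union> B n \<union> (C n \<union> D n)"
    proof (rule subsetI, rule ccontr)
      fix w assume w: "w \<in> {w \<in> space M. e < \<bar>?p n w - c k l\<bar>}" and no: "w \<notin> A n \<union> B n \<union> (C n \<union> D n)"
      then have lw: "low n (\<lambda>i. Xs i w)" by (auto simp: A_def)
      have sq: "\<bar>t\<bar> < \<delta>" if "\<not> \<delta>\<^sup>2 \<le> t\<^sup>2" for t
        using that \<delta> abs_le_square_iff[of \<delta> t] by simp
      have "\<not> \<delta>\<^sup>2 \<le> (?p n w - ?m n w)\<^sup>2" "\<not> \<delta>\<^sup>2 \<le> (hmean k l n w - c k l)\<^sup>2"
        using w no lw by (auto simp: B_def D_def fB_def fD_def)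
      then have "\<bar>?p n w - ?m n w\<bar> < \<delta>" "\<bar>hmean k l n w - c k l\<bar> < \<delta>" by (auto intro: sq)
      moreover have "\<bar>?m n w - hmean k l n w\<bar> < \<delta>"
        using w no by (auto simp: C_def fC_def not_le)
      ultimately have "\<bar>?p n w - c k l\<bar> < 3 * \<delta>" by linarith
      with w show False by (simp add: \<delta>_def)
    qed
  qed
qed

section \<open>Divergence\<close>

text \<open>The rows of the limits \<open>c k l\<close> sum to \<open>pr k\<close>, and
  \<open>c\<close> is symmetric, so both margins approach \<open>pr k\<close> with \<open>K\<close>
  errors each.\<close>

lemma row_col_close:
  assumes k: "k \<in> {1..K}"
    and close: "\<And>k l. k \<in> {1..K} \<Longrightarrow> l \<in> {1..K} \<Longrightarrow> \<bar>p_joint n x y k l - c k l\<bar> \<le> \<delta>"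
  shows "\<bar>p_row K n x y k - pr k\<bar> \<le> real K * \<delta>" "\<bar>q_col K n x y k - pr k\<bar> \<le> real K * \<delta>"
proof -
  have "p_row K n x y k - pr k = (\<Sum>l=1..K. p_joint n x y k l - c k l)"
    using sum_c[OF k] by (simp add: p_row_def sum_subtractf)
  also have "\<bar>\<dots>\<bar> \<le> (\<Sum>l=1..K. \<delta>)"
    by (intro order_trans[OF sum_abs sum_mono] close k)
  finally show "\<bar>p_row K n x y k - pr k\<bar> \<le> real K * \<delta>" by simp
  have "q_col K n x y k - pr k = (\<Sum>l=1..K. p_joint n x y l k - c l k)"
    using sum_c[OF k] by (simp add: q_col_def sum_subtractf c_sym[of _ k])
  also have "\<bar>\<dots>\<bar> \<le> (\<Sum>l=1..K. \<delta>)"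
    by (intro order_trans[OF sum_abs sum_mono] close k)
  finally show "\<bar>q_col K n x y k - pr k\<bar> \<le> real K * \<delta>" by simp
qed

text \<open>The errors are \<open>\<delta>\<close> from \<open>p_joint\<close> and
  \<open>K * \<delta>\<close> from each of the two margins, whose cofactors are at most
  \<open>1\<close>.\<close>

lemma dep_dev_close:
  assumes k: "k \<in> {1..K}"
    and close: "\<And>k l. k \<in> {1..K} \<Longrightarrow> l \<in> {1..K} \<Longrightarrow> \<bar>p_joint n x y k l - c k l\<bar> \<le> \<delta>"
  shows "c k k - (pr k)\<^sup>2 - (1 + 2 * real K) * \<delta> \<le> dep_dev K n x y (k, k)"
proof -
  let ?p = "p_row K n x y k" and ?q = "q_col K n x y k"
  have "?p * ?q - pr k * pr k = ?q * (?p - pr k) + pr k * (?q - pr k)"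
    by (simp add: algebra_simps)
  also have "\<dots> \<le> \<bar>?q\<bar> * \<bar>?p - pr k\<bar> + \<bar>pr k\<bar> * \<bar>?q - pr k\<bar>"
    by (intro add_mono) (simp_all flip: abs_mult)
  also have "\<dots> \<le> 1 * (real K * \<delta>) + 1 * (real K * \<delta>)"
    using row_col_close[OF k close] q_col_nonneg[of K n x y k] q_col_le_1[OF k, of n x y] pr_bounds[of k]
    by (intro add_mono mult_mono) auto
  finally show ?thesis
    using close[OF k k] by (simp add: dep_dev_def power2_eq_square abs_le_iff algebra_simps)
qed

text \<open>The rate \<open>sqrt n\<close> is stated for the length of \<open>P_n\<close> and for
  the square root of the statistic, so the statistic itself is of order \<open>n\<close>.\<close>

theorem divergence:
  assumes pos: "\<And>k. k \<in> {1..K} \<Longrightarrow> 0 < pr k"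
    and gap: "\<And>l. l \<in> {1..K} \<Longrightarrow> gap l \<longlonglongrightarrow> 0"
    and deg: "small_o_prob M (\<lambda>n w. real (max_indegree n (\<lambda>i. Xs i w))) (\<lambda>n. real n powr (1/4))"
    and dep: "\<not> indep_rv M borel X (count_space {1..K}) Y"
  shows "tendsto_top_in_prob M (\<lambda>n w. I_stat K n (\<lambda>i. Xs i w) (\<lambda>i. Ys i w))"
    and "exact_order_in_prob M (\<lambda>n w. vec_norm2 (P_stat K n (\<lambda>i. Xs i w) (\<lambda>i. Ys i w))) (\<lambda>n. sqrt (real n))"
    and "exact_order_in_prob M (\<lambda>n w. sqrt (I_stat K n (\<lambda>i. Xs i w) (\<lambda>i. Ys i w))) (\<lambda>n. sqrt (real n))"
proof -
  obtain k0 where k0: "k0 \<in> {1..K - 1}" and v0: "c k0 k0 - (pr k0)\<^sup>2 > 0"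
    by (rule dependent_variance[OF dep])
  \<comment> \<open>Half of the limiting variance and half of the smallest level probability are
    kept as lower bounds. The other halves absorb the errors
    \<open>(1 + 2 * real K) * \<delta>\<close> and \<open>real K * \<delta>\<close>, which dictates
    \<open>\<delta>\<close>.\<close>
  define v where "v = (c k0 k0 - (pr k0)\<^sup>2) / 2"
  define \<pi> where "\<pi> = Min (pr ` {1..K}) / 2"
  define \<delta> where "\<delta> = min (v / (1 + 2 * real K)) (\<pi> / real K)"
  have v: "0 < v" using v0 by (simp add: v_def)
  have "Min (pr ` {1..K}) > 0" using pos K2 by (subst Min_gr_iff) auto
  then have \<pi>: "0 < \<pi>" by (simp add: \<pi>_def)
  have pr_ge: "2 * \<pi> \<le> pr k" if "k \<in> {1..K}" for k
    using that by (simp add: \<pi>_def)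
  have \<delta>: "0 < \<delta>" using v \<pi> K2 by (simp add: \<delta>_def)
  have \<delta>v: "(1 + 2 * real K) * \<delta> \<le> v"
  proof -
    have "\<delta> \<le> v / (1 + 2 * real K)" by (simp add: \<delta>_def)
    then show ?thesis by (simp add: pos_le_divide_eq mult.commute)
  qed
  have \<delta>\<pi>: "real K * \<delta> \<le> \<pi>"
  proof -
    have "\<delta> \<le> \<pi> / real K" by (simp add: \<delta>_def)
    then show ?thesis using K2 by (simp add: pos_le_divide_eq mult.commute)
  qed
  \<comment> \<open>Outside \<open>Bad n\<close> all joint frequencies are within
    \<open>\<delta>\<close> of their limits and some point is not in a mutual pair; these two facts
    yield the assumptions of \<open>stat_bounds\<close>.\<close>
  define Bad where "Bad n = (\<Union>(k, l)\<in>{1..K} \<times> {1..K}.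
      {w \<in> space M. \<delta> < \<bar>p_joint n (\<lambda>i. Xs i w) (\<lambda>i. Ys i w) k l - c k l\<bar>})
    \<union> {w \<in> space M. all_mutual {1..n} (\<lambda>i. Xs i w)}" for n
  have dev_ev: "{w \<in> space M. \<delta> < \<bar>p_joint n (\<lambda>i. Xs i w) (\<lambda>i. Ys i w) k l - c k l\<bar>} \<in> events" if "2 \<le> n" for n k l
    using p_joint_meas[OF that, of k l] by measurable
  have mut_ev: "{w \<in> space M. all_mutual {1..n} (\<lambda>i. Xs i w)} \<in> events" if "2 \<le> n" for n
    using pred_all_mutual[OF Xs_meas' that] by (simp add: pred_def)
  have Bad_ev: "Bad n \<in> events" if "2 \<le> n" for n
    unfolding Bad_def using that by (intro sets.Un sets.finite_UN mut_ev) (auto intro: dev_ev)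
  have Bad0: "(\<lambda>n. prob (Bad n)) \<longlonglongrightarrow> 0"
    unfolding Bad_def
  proof (rule prob_tendsto_0_Un[of _ _ 2])
    show "(\<lambda>n. prob (\<Union>(k, l)\<in>{1..K} \<times> {1..K}.
      {w \<in> space M. \<delta> < \<bar>p_joint n (\<lambda>i. Xs i w) (\<lambda>i. Ys i w) k l - c k l\<bar>})) \<longlonglongrightarrow> 0"
      by (rule prob_tendsto_0_UN[where m = 2])
        (auto simp del: One_nat_def intro!: p_joint_tendsto gap deg \<delta> dev_ev)
  qed (auto simp del: One_nat_def intro!: prob_all_mutual_tendsto mut_ev sets.finite_UN dev_ev)
  \<comment> \<open>The constant of \<open>sqrt_I_stat_upper\<close>.\<close>
  define \<kappa> where "\<kappa> = real ((K - 1)\<^sup>2) * (4 / \<pi> * (2 + 2 * real K))"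
  have \<kappa>: "0 < \<kappa>" using K2 \<pi> by (simp add: \<kappa>_def)
  have good: "real n * v\<^sup>2 \<le> I_stat K n (\<lambda>i. Xs i w) (\<lambda>i. Ys i w) \<and>
      sqrt (I_stat K n (\<lambda>i. Xs i w) (\<lambda>i. Ys i w)) \<le> \<kappa> * sqrt (real n) \<and>
      v * sqrt (real n) \<le> vec_norm2 (P_stat K n (\<lambda>i. Xs i w) (\<lambda>i. Ys i w))"
    if n: "2 \<le> n" and w: "w \<in> space M - Bad n" for n w
  proof -
    let ?x = "\<lambda>i. Xs i w" and ?y = "\<lambda>i. Ys i w"
    have close: "\<bar>p_joint n ?x ?y k l - c k l\<bar> \<le> \<delta>" if "k \<in> {1..K}" "l \<in> {1..K}" for k l
      using w that unfolding Bad_def by (auto simp: not_less simp del: One_nat_def)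
    have k0': "k0 \<in> {1..K}" using k0 by auto
    have dd: "v \<le> dep_dev K n ?x ?y (k0, k0)"
      using dep_dev_close[OF k0' close] \<delta>v by (simp add: v_def)
    have p_row_pi: "\<pi> \<le> p_row K n ?x ?y k" if k: "k \<in> {1..K}" for k
    proof -
      have "\<bar>p_row K n ?x ?y k - pr k\<bar> \<le> real K * \<delta>"
        by (rule row_col_close(1)[OF k close])
      then show ?thesis using pr_ge[OF k] \<delta>\<pi> by linarith
    qed
    have mutual: "mutual_frac n ?x < 1"
      using w by (intro mutual_frac_less_1) (auto simp: Bad_def)
    interpret stat_bounds K n ?x ?y \<pi>
      by (rule stat_bounds.intro[OF K2 n \<pi> p_row_pi mutual])
    have "v\<^sup>2 \<le> (dep_dev K n ?x ?y (k0, k0))\<^sup>2"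
      using dd v by (intro power_mono) auto
    then have "real n * v\<^sup>2 \<le> real n * (dep_dev K n ?x ?y (k0, k0))\<^sup>2"
      by (intro mult_left_mono) auto
    also have "\<dots> \<le> I_stat K n ?x ?y" by (rule I_stat_lower[OF k0])
    finally have 1: "real n * v\<^sup>2 \<le> I_stat K n ?x ?y" .
    have 2: "sqrt (I_stat K n ?x ?y) \<le> \<kappa> * sqrt (real n)"
      using sqrt_I_stat_upper by (simp add: \<kappa>_def mult.commute)
    have "v * sqrt (real n) \<le> sqrt (real n) * \<bar>dep_dev K n ?x ?y (k0, k0)\<bar>"
      using dd v by (subst mult.commute) (intro mult_left_mono, auto)
    also have "\<dots> \<le> vec_norm2 (P_stat K n ?x ?y)"
      by (rule vec_norm2_P_stat_lower[OF k0])
    finally show ?thesis using 1 2 by simp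
  qed
  have ev: "{w \<in> space M. \<Phi> (I_stat K n (\<lambda>i. Xs i w) (\<lambda>i. Ys i w)) (P_stat K n (\<lambda>i. Xs i w) (\<lambda>i. Ys i w))} \<in> events"
    if "2 \<le> n" for n \<Phi>
    by (rule sets_stat_event[where Y = "\<lambda>i w. Ys i w", OF Xs_meas' Ys_meas that])
  show "tendsto_top_in_prob M (\<lambda>n w. I_stat K n (\<lambda>i. Xs i w) (\<lambda>i. Ys i w))"
    unfolding tendsto_top_in_prob_def
  proof
    fix C :: real
    \<comment> \<open>From this sample size on, the lower bound \<open>n * v\<^sup>2\<close> exceeds
      \<open>C\<close>.\<close>
    obtain n1 where n1: "C / v\<^sup>2 < real n1" using reals_Archimedean2 by blast
    show "(\<lambda>n. prob {w \<in> space M. C < I_stat K n (\<lambda>i. Xs i w) (\<lambda>i. Ys i w)}) \<longlonglongrightarrow> 1"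
    proof (rule prob_tendsto_1[OF Bad0, where m = "max 2 n1"])
      fix n assume n: "max 2 n1 \<le> n"
      then have n2: "2 \<le> n" by simp
      show "Bad n \<in> events" by (rule Bad_ev[OF n2])
      show "{w \<in> space M. C < I_stat K n (\<lambda>i. Xs i w) (\<lambda>i. Ys i w)} \<in> events"
        using ev[OF n2, of "\<lambda>i _. C < i"] .
      have "C / v\<^sup>2 < real n" using n1 n by linarith
      then have "C < real n * v\<^sup>2" using v by (simp add: pos_divide_less_eq)
      then show "space M - Bad n \<subseteq> {w \<in> space M. C < I_stat K n (\<lambda>i. Xs i w) (\<lambda>i. Ys i w)}"
        using good[OF n2] by fastforce
    qed
  qed
  show "exact_order_in_prob M (\<lambda>n w. vec_norm2 (P_stat K n (\<lambda>i. Xs i w) (\<lambda>i. Ys i w))) (\<lambda>n. sqrt (real n))"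
    unfolding exact_order_in_prob_def
  proof (intro exI conjI)
    show "(\<lambda>n. prob {w \<in> space M. v * sqrt (real n) \<le> vec_norm2 (P_stat K n (\<lambda>i. Xs i w) (\<lambda>i. Ys i w)) \<and>
        vec_norm2 (P_stat K n (\<lambda>i. Xs i w) (\<lambda>i. Ys i w)) \<le> real (K - 1) * sqrt (real n)}) \<longlonglongrightarrow> 1"
    proof (rule prob_tendsto_1[OF Bad0 Bad_ev, where m = 2])
      fix n :: nat assume n: "2 \<le> n"
      show "{w \<in> space M. v * sqrt (real n) \<le> vec_norm2 (P_stat K n (\<lambda>i. Xs i w) (\<lambda>i. Ys i w)) \<and>
          vec_norm2 (P_stat K n (\<lambda>i. Xs i w) (\<lambda>i. Ys i w)) \<le> real (K - 1) * sqrt (real n)} \<in> events"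
        using ev[OF n, of "\<lambda>_ P. v * sqrt (real n) \<le> vec_norm2 P \<and> vec_norm2 P \<le> real (K - 1) * sqrt (real n)"] .
      show "space M - Bad n \<subseteq> {w \<in> space M. v * sqrt (real n) \<le> vec_norm2 (P_stat K n (\<lambda>i. Xs i w) (\<lambda>i. Ys i w)) \<and>
          vec_norm2 (P_stat K n (\<lambda>i. Xs i w) (\<lambda>i. Ys i w)) \<le> real (K - 1) * sqrt (real n)}"
        using good[OF n] vec_norm2_P_stat_upper[of K n] by (auto simp: mult.commute)
    qed
  qed (use v K2 in auto)
  show "exact_order_in_prob M (\<lambda>n w. sqrt (I_stat K n (\<lambda>i. Xs i w) (\<lambda>i. Ys i w))) (\<lambda>n. sqrt (real n))"
    unfolding exact_order_in_prob_def
  proof (intro exI conjI)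
    show "(\<lambda>n. prob {w \<in> space M. v * sqrt (real n) \<le> sqrt (I_stat K n (\<lambda>i. Xs i w) (\<lambda>i. Ys i w)) \<and>
        sqrt (I_stat K n (\<lambda>i. Xs i w) (\<lambda>i. Ys i w)) \<le> \<kappa> * sqrt (real n)}) \<longlonglongrightarrow> 1"
    proof (rule prob_tendsto_1[OF Bad0 Bad_ev, where m = 2])
      fix n :: nat assume n: "2 \<le> n"
      show "{w \<in> space M. v * sqrt (real n) \<le> sqrt (I_stat K n (\<lambda>i. Xs i w) (\<lambda>i. Ys i w)) \<and>
          sqrt (I_stat K n (\<lambda>i. Xs i w) (\<lambda>i. Ys i w)) \<le> \<kappa> * sqrt (real n)} \<in> events"
        using ev[OF n, of "\<lambda>i _. v * sqrt (real n) \<le> sqrt i \<and> sqrt i \<le> \<kappa> * sqrt (real n)"] .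
      have "v * sqrt (real n) \<le> sqrt t" if "real n * v\<^sup>2 \<le> t" for t
        using real_sqrt_le_mono[OF that] v by (simp add: real_sqrt_mult mult.commute)
      then show "space M - Bad n \<subseteq> {w \<in> space M. v * sqrt (real n) \<le> sqrt (I_stat K n (\<lambda>i. Xs i w) (\<lambda>i. Ys i w)) \<and>
          sqrt (I_stat K n (\<lambda>i. Xs i w) (\<lambda>i. Ys i w)) \<le> \<kappa> * sqrt (real n)}"
        using good[OF n] by auto
    qed
  qed (use v \<kappa> in auto)
qed

end

theorem corollary2:
  fixes M :: "'w measure"
    and X :: "'w \<Rightarrow> 'h::{metric_space, second_countable_topology}"
    and Y :: "'w \<Rightarrow> nat"
    and K :: nat
    and Q :: "nat \<Rightarrow> 'h \<Rightarrow> real"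
    and Xs :: "nat \<Rightarrow> 'w \<Rightarrow> 'h"
    and Us :: "nat \<Rightarrow> 'w \<Rightarrow> real"
    and Ys :: "nat \<Rightarrow> 'w \<Rightarrow> nat"
  assumes "prob_space M"
    and "X \<in> measurable M borel"
    and "K \<ge> 2"
    and "Y \<in> measurable M (count_space {1..K})"
    and "\<And>k. k \<in> {1..K} \<Longrightarrow> measure M {w \<in> space M. Y w = k} > 0"
    and "\<And>k. k \<in> {1..K} \<Longrightarrow> Q k \<in> borel_measurable borel"
    and "\<And>k. k \<in> {1..K} \<Longrightarrow>
           AE w in M. Q k (X w) =
             real_cond_exp M (vimage_algebra (space M) X borel) (indicator {w \<in> space M. Y w = k}) w"
    and "prob_space.indep_vars M (\<lambda>_. borel) Xs {1..}"
    and "\<And>i. i \<ge> 1 \<Longrightarrow> distr M borel (Xs i) = distr M borel X"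
    and "prob_space.indep_vars M (\<lambda>_. borel) Us {1..}"
    and "\<And>i. i \<ge> 1 \<Longrightarrow> distr M lborel (Us i) = uniform_measure lborel {0<..<1}"
    and "indep_rv M
           (PiM {1..} (\<lambda>_. borel)) (\<lambda>w. \<lambda>i\<in>{1..}. Xs i w)
           (PiM {1..} (\<lambda>_. borel)) (\<lambda>w. \<lambda>i\<in>{1..}. Us i w)"
    and "\<And>i w. Ys i w = resp K Q (Xs i w) (Us i w)"
    and "continuous_on UNIV (cdf (distr M borel (\<lambda>w. dist (Xs 1 w) (Xs 2 w))))"
    and "(AE u in lborel. u \<in> {0<..<1} \<longrightarrow>
            tendsto_in_prob M
              (\<lambda>n w. resp K Q (Xs (nn n (\<lambda>i. Xs i w) 1) w) u)
              (\<lambda>w. resp K Q (Xs 1 w) u))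
         \<or> (\<forall>k\<in>{1..K}. AE x in distr M borel X. isCont (Q k) x)"
    and "small_o_prob M (\<lambda>n w. real (max_indegree n (\<lambda>i. Xs i w))) (\<lambda>n. real n powr (1/4))"
    and "\<not> indep_rv M borel X (count_space {1..K}) Y"
  shows "tendsto_top_in_prob M (\<lambda>n w. I_stat K n (\<lambda>i. Xs i w) (\<lambda>i. Ys i w))
    \<and> exact_order_in_prob M (\<lambda>n w. vec_norm2 (P_stat K n (\<lambda>i. Xs i w) (\<lambda>i. Ys i w))) (\<lambda>n. sqrt (real n))
    \<and> exact_order_in_prob M (\<lambda>n w. sqrt (I_stat K n (\<lambda>i. Xs i w) (\<lambda>i. Ys i w))) (\<lambda>n. sqrt (real n))"
proof -
  interpret prob_space M by fact
  interpret nn_sample M X Y K Q Xs Us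
    by (intro nn_sample.intro nn_sample_axioms.intro) fact+
  have Ys: "Ys = (\<lambda>i w. resp K Q (Xs i w) (Us i w))"
    using assms(13) by (intro ext)
  have gap: "gap l \<longlonglongrightarrow> 0" if l: "l \<in> {1..K}" for l
    using assms(15)
  proof
    assume "AE u in lborel. u \<in> {0<..<1} \<longrightarrow>
        tendsto_in_prob M (\<lambda>n w. resp K Q (Xs (nn n (\<lambda>i. Xs i w) 1) w) u) (\<lambda>w. resp K Q (Xs 1 w) u)"
    then show ?thesis by (rule gap_tendsto_resp[OF l])
  next
    assume "\<forall>k\<in>{1..K}. AE x in distr M borel X. isCont (Q k) x"
    with l show ?thesis by (intro gap_tendsto_continuous) auto
  qed
  have pos: "0 < pr k" if "k \<in> {1..K}" for k
    using assms(5)[OF that] by (simp add: pr_def)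
  show ?thesis
    unfolding Ys using divergence[OF pos gap assms(16,17)] by blast
qed

end
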